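(* Let $k\ge0$, $p,q\in\mathbb N_0$, $\mu\in\mathbb C^p$, $\nu\in\mathbb C^q$ with $\nu_i\notin\{0,k,\dots,k(n-1)\}-\mathbb N_0$ for all $i=1,\dots,q$ (so $[\nu]_\lambda\ne0$ for all $\lambda\in\Lambda_n^+$). (1) If $p\le q$, the series ${}_pK_q(\mu;\nu;\cdot,\cdot)$ and ${}_pF_q(\mu;\nu;\cdot,\cdot)$ define entire functions on $\mathbb C^n\times\mathbb C^n$. (2) If $p=q+1$, they define holomorphic functions on $\{(z,w)\in\mathbb C^n\times\mathbb C^n:\|z\|_\infty\|w\|_\infty<1\}$. Moreover, these series are holomorphic in the parameters $(\mu,\nu)$ on $\{(\mu,\nu)\in\mathbb C^p\times\mathbb C^q:\nu_i\notin\{0,k,\dots,k(n-1)\}-\mathbb N_0\text{ for all }i\}$.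
   Context: $s_{ij}$ transposition of coordinates; Dunkl operators $T_\xi f(x)=\partial_\xi f(x)+k\sum_{i<j}(\xi_i-\xi_j)\frac{f(x)-f(s_{ij}x)}{x_i-x_j}$, $T_j=T_{e_j}$; $\underline1=(1,\dots,1)$; $[\mu]_\eta=\prod_{j=1}^n(\mu-k(j-1))_{\eta_j}$ (Pochhammer symbols). Jack polynomials: $\Lambda_n^+$ partitions of length $\le n$; $\eta_+$ decreasing rearrangement, $|\eta|=\sum\eta_i$. Order $\prec$ on $\mathbb N_0^n$: $\kappa\prec\eta$ iff $\kappa_+$ strictly below $\eta_+$ in dominance order (same weight, partial sums $\le$), or $\kappa_+=\eta_+$ and $w_\eta<w_\kappa$ in Bruhat order ($w_\eta$ shortest permutation with $w_\eta\eta_+=\eta$). With $\mathcal D_j=x_jT_j+k(1-n)+k\sum_{i>j}s_{ij}$, $\overline\eta_j=\eta_j-k\#\{i<j:\eta_i\ge\eta_j\}-k\#\{i>j:\eta_i>\eta_j\}$, $E_\eta$ is the unique polynomial $x^\eta+\sum_{\kappa\prec\eta}c_{\eta\kappa}x^\kappa$ with $\mathcal D_jE_\eta=\overline\eta_jE_\eta$. Let $c_\eta$ be the unique scalars with $(z_1+\dots+z_n)^m=\sum_{|\eta|=m}c_\eta E_\eta(z)$ for all $m$ (positive), $L_\eta=c_\eta E_\eta$, $C_\lambda=\sum_{\eta\in\mathcal S_n\lambda}L_\eta$ (distinct rearrangements). Hypergeometric series: $[\mu]_\lambda=\prod_{i=1}^p[\mu_i]_\lambda$, $[\nu]_\lambda=\prod_{i=1}^q[\nu_i]_\lambda$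 (empty product $1$); ${}_pK_q(\mu;\nu;z,w)=\sum_{\eta\in\mathbb N_0^n}\frac{[\mu]_{\eta_+}}{[\nu]_{\eta_+}}\frac{L_\eta(z)L_\eta(w)}{|\eta|!L_\eta(\underline1)}$, ${}_pF_q(\mu;\nu;z,w)=\sum_{\lambda\in\Lambda_n^+}\frac{[\mu]_\lambda}{[\nu]_\lambda}\frac{C_\lambda(z)C_\lambda(w)}{|\lambda|!C_\lambda(\underline1)}$. *)

theory Defs
  imports "HOL-Analysis.Analysis"
begin

(* Conventions: n is the dimension; coordinates are indexed 0..n-1.
   Vectors in C^d are functions nat => complex vanishing from index d on;
   multi-indices in N_0^n are functions nat => nat vanishing from index n on. *)

definition cvec :: "nat \<Rightarrow> (nat \<Rightarrow> complex) set" where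
  "cvec d = {z. \<forall>i\<ge>d. z i = 0}"

definition multi :: "nat \<Rightarrow> (nat \<Rightarrow> nat) set" where
  "multi n = {\<eta>. \<forall>i\<ge>n. \<eta> i = 0}"

definition weight :: "nat \<Rightarrow> (nat \<Rightarrow> nat) \<Rightarrow> nat" where
  "weight n \<eta> = (\<Sum>i<n. \<eta> i)"

definition mono :: "nat \<Rightarrow> (nat \<Rightarrow> nat) \<Rightarrow> (nat \<Rightarrow> complex) \<Rightarrow> complex" where
  "mono n \<eta> x = (\<Prod>i<n. x i ^ \<eta> i)"

definition plus_part :: "nat \<Rightarrow> (nat \<Rightarrow> nat) \<Rightarrow> (nat \<Rightarrow> nat)" where
  "plus_part n \<eta> = (\<lambda>i. if i < n then rev (sort (map \<eta> [0..<n])) ! i else 0)"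

definition partitions :: "nat \<Rightarrow> (nat \<Rightarrow> nat) set" where
  "partitions n = {la \<in> multi n. \<forall>i j. i \<le> j \<and> j < n \<longrightarrow> la j \<le> la i}"

definition dom_le :: "nat \<Rightarrow> (nat \<Rightarrow> nat) \<Rightarrow> (nat \<Rightarrow> nat) \<Rightarrow> bool" where
  "dom_le n \<kappa> la \<longleftrightarrow> weight n \<kappa> = weight n la \<and> (\<forall>m\<le>n. (\<Sum>i<m. \<kappa> i) \<le> (\<Sum>i<m. la i))"

definition swp :: "nat \<Rightarrow> nat \<Rightarrow> nat \<Rightarrow> nat" where
  "swp a b = (\<lambda>x. if x = a then b else if x = b then a else x)"

definition act :: "(nat \<Rightarrow> nat) \<Rightarrow> (nat \<Rightarrow> nat) \<Rightarrow> (nat \<Rightarrow> nat)" where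
  "act w \<eta> = \<eta> \<circ> inv w"

definition perm_len :: "nat \<Rightarrow> (nat \<Rightarrow> nat) \<Rightarrow> nat" where
  "perm_len n w = card {(i, j). i < j \<and> j < n \<and> w j < w i}"

definition w_of :: "nat \<Rightarrow> (nat \<Rightarrow> nat) \<Rightarrow> (nat \<Rightarrow> nat)" where
  "w_of n \<eta> = (THE w. w permutes {..<n} \<and> act w (plus_part n \<eta>) = \<eta> \<and>
      (\<forall>v. v permutes {..<n} \<and> act v (plus_part n \<eta>) = \<eta> \<longrightarrow> perm_len n w \<le> perm_len n v))"

definition bruhat_step :: "nat \<Rightarrow> ((nat \<Rightarrow> nat) \<times> (nat \<Rightarrow> nat)) set" where
  "bruhat_step n = {(u, swp a b \<circ> u) | u a b. u permutes {..<n} \<and> a < b \<and> b < n \<and>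
      perm_len n u < perm_len n (swp a b \<circ> u)}"

definition bruhat_less :: "nat \<Rightarrow> (nat \<Rightarrow> nat) \<Rightarrow> (nat \<Rightarrow> nat) \<Rightarrow> bool" where
  "bruhat_less n u v \<longleftrightarrow> (u, v) \<in> (bruhat_step n)\<^sup>+"

definition prec :: "nat \<Rightarrow> (nat \<Rightarrow> nat) \<Rightarrow> (nat \<Rightarrow> nat) \<Rightarrow> bool" where
  "prec n \<kappa> \<eta> \<longleftrightarrow>
     (dom_le n (plus_part n \<kappa>) (plus_part n \<eta>) \<and> plus_part n \<kappa> \<noteq> plus_part n \<eta>) \<or>
     (plus_part n \<kappa> = plus_part n \<eta> \<and> bruhat_less n (w_of n \<eta>) (w_of n \<kappa>))"

definition dunkl :: "nat \<Rightarrow> real \<Rightarrow> (nat \<Rightarrow> complex) \<Rightarrow> ((nat \<Rightarrow> complex) \<Rightarrow> complex)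
    \<Rightarrow> (nat \<Rightarrow> complex) \<Rightarrow> complex" where
  "dunkl n k \<xi> f x =
     deriv (\<lambda>t. f (\<lambda>i. x i + t * \<xi> i)) 0 +
     of_real k * (\<Sum>i<n. \<Sum>j<n. if i < j then (\<xi> i - \<xi> j) * (f x - f (x \<circ> swp i j)) / (x i - x j) else 0)"

definition unit_vec :: "nat \<Rightarrow> nat \<Rightarrow> complex" where
  "unit_vec j = (\<lambda>i. if i = j then 1 else 0)"

definition cherD :: "nat \<Rightarrow> real \<Rightarrow> nat \<Rightarrow> ((nat \<Rightarrow> complex) \<Rightarrow> complex) \<Rightarrow> (nat \<Rightarrow> complex) \<Rightarrow> complex" where
  "cherD n k j f x = x j * dunkl n k (unit_vec j) f x + of_real (k * (1 - real n)) * f x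
      + of_real k * (\<Sum>i\<in>{j<..<n}. f (x \<circ> swp i j))"

definition eta_bar :: "nat \<Rightarrow> real \<Rightarrow> (nat \<Rightarrow> nat) \<Rightarrow> nat \<Rightarrow> complex" where
  "eta_bar n k \<eta> j = of_real (real (\<eta> j) - k * real (card {i. i < j \<and> \<eta> j \<le> \<eta> i})
      - k * real (card {i. j < i \<and> i < n \<and> \<eta> j < \<eta> i}))"

(* points with pairwise distinct coordinates (where the difference quotients are literal) *)
definition generic :: "nat \<Rightarrow> (nat \<Rightarrow> complex) set" where
  "generic n = {x \<in> cvec n. \<forall>i<n. \<forall>j<n. i \<noteq> j \<longrightarrow> x i \<noteq> x j}"

definition jackE :: "nat \<Rightarrow> real \<Rightarrow> (nat \<Rightarrow> nat) \<Rightarrow> (nat \<Rightarrow> complex) \<Rightarrow> complex" where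
  "jackE n k \<eta> = (THE f. (\<exists>c. f = (\<lambda>x. mono n \<eta> x +
        (\<Sum>\<kappa>\<in>{\<kappa> \<in> multi n. prec n \<kappa> \<eta>}. c \<kappa> * mono n \<kappa> x))) \<and>
      (\<forall>j<n. \<forall>x\<in>generic n. cherD n k j f x = eta_bar n k \<eta> j * f x))"

definition cjack :: "nat \<Rightarrow> real \<Rightarrow> (nat \<Rightarrow> nat) \<Rightarrow> complex" where
  "cjack n k = (THE c. (\<forall>\<eta>. \<eta> \<notin> multi n \<longrightarrow> c \<eta> = 0) \<and>
      (\<forall>m z. (\<Sum>i<n. z i) ^ m = (\<Sum>\<eta>\<in>{\<eta> \<in> multi n. weight n \<eta> = m}. c \<eta> * jackE n k \<eta> z)))"

definition jackL :: "nat \<Rightarrow> real \<Rightarrow> (nat \<Rightarrow> nat) \<Rightarrow> (nat \<Rightarrow> complex) \<Rightarrow> complex" where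
  "jackL n k \<eta> z = cjack n k \<eta> * jackE n k \<eta> z"

definition jackC :: "nat \<Rightarrow> real \<Rightarrow> (nat \<Rightarrow> nat) \<Rightarrow> (nat \<Rightarrow> complex) \<Rightarrow> complex" where
  "jackC n k la z = (\<Sum>\<eta>\<in>{\<eta> \<in> multi n. plus_part n \<eta> = la}. jackL n k \<eta> z)"

definition one_vec :: "nat \<Rightarrow> nat \<Rightarrow> complex" where
  "one_vec n = (\<lambda>i. if i < n then 1 else 0)"

definition gpoch :: "nat \<Rightarrow> real \<Rightarrow> complex \<Rightarrow> (nat \<Rightarrow> nat) \<Rightarrow> complex" where
  "gpoch n k \<mu> \<eta> = (\<Prod>j<n. pochhammer (\<mu> - of_real (k * real j)) (\<eta> j))"

definition gpochv :: "nat \<Rightarrow> real \<Rightarrow> nat \<Rightarrow> (nat \<Rightarrow> complex) \<Rightarrow> (nat \<Rightarrow> nat) \<Rightarrow> complex" where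
  "gpochv n k p \<mu> \<eta> = (\<Prod>i<p. gpoch n k (\<mu> i) \<eta>)"

definition Kterm :: "nat \<Rightarrow> real \<Rightarrow> nat \<Rightarrow> nat \<Rightarrow> (nat \<Rightarrow> complex) \<Rightarrow> (nat \<Rightarrow> complex)
    \<Rightarrow> (nat \<Rightarrow> complex) \<Rightarrow> (nat \<Rightarrow> complex) \<Rightarrow> (nat \<Rightarrow> nat) \<Rightarrow> complex" where
  "Kterm n k p q \<mu> \<nu> z w \<eta> =
     gpochv n k p \<mu> (plus_part n \<eta>) / gpochv n k q \<nu> (plus_part n \<eta>) *
     (jackL n k \<eta> z * jackL n k \<eta> w / (of_nat (fact (weight n \<eta>)) * jackL n k \<eta> (one_vec n)))"

definition Fterm :: "nat \<Rightarrow> real \<Rightarrow> nat \<Rightarrow> nat \<Rightarrow> (nat \<Rightarrow> complex) \<Rightarrow> (nat \<Rightarrow> complex)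
    \<Rightarrow> (nat \<Rightarrow> complex) \<Rightarrow> (nat \<Rightarrow> complex) \<Rightarrow> (nat \<Rightarrow> nat) \<Rightarrow> complex" where
  "Fterm n k p q \<mu> \<nu> z w la =
     gpochv n k p \<mu> la / gpochv n k q \<nu> la *
     (jackC n k la z * jackC n k la w / (of_nat (fact (weight n la)) * jackC n k la (one_vec n)))"

definition Kser :: "nat \<Rightarrow> real \<Rightarrow> nat \<Rightarrow> nat \<Rightarrow> (nat \<Rightarrow> complex) \<Rightarrow> (nat \<Rightarrow> complex)
    \<Rightarrow> (nat \<Rightarrow> complex) \<Rightarrow> (nat \<Rightarrow> complex) \<Rightarrow> complex" where
  "Kser n k p q \<mu> \<nu> z w = infsum (Kterm n k p q \<mu> \<nu> z w) (multi n)"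

definition Fser :: "nat \<Rightarrow> real \<Rightarrow> nat \<Rightarrow> nat \<Rightarrow> (nat \<Rightarrow> complex) \<Rightarrow> (nat \<Rightarrow> complex)
    \<Rightarrow> (nat \<Rightarrow> complex) \<Rightarrow> (nat \<Rightarrow> complex) \<Rightarrow> complex" where
  "Fser n k p q \<mu> \<nu> z w = infsum (Fterm n k p q \<mu> \<nu> z w) (partitions n)"

definition holo2 :: "nat \<Rightarrow> nat \<Rightarrow> ((nat \<Rightarrow> complex) \<times> (nat \<Rightarrow> complex)) set
    \<Rightarrow> ((nat \<Rightarrow> complex) \<Rightarrow> (nat \<Rightarrow> complex) \<Rightarrow> complex) \<Rightarrow> bool" where
  "holo2 a b U F \<longleftrightarrow> U \<subseteq> cvec a \<times> cvec b \<and> continuous_on U (\<lambda>(z, w). F z w) \<and>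
     (\<forall>(z, w)\<in>U. (\<forall>i<a. (\<lambda>t. F (z(i := t)) w) field_differentiable (at (z i))) \<and>
                 (\<forall>i<b. (\<lambda>t. F z (w(i := t))) field_differentiable (at (w i))))"

definition supnorm :: "nat \<Rightarrow> (nat \<Rightarrow> complex) \<Rightarrow> real" where
  "supnorm n z = Max (insert 0 ((\<lambda>i. cmod (z i)) ` {..<n}))"

definition params :: "nat \<Rightarrow> real \<Rightarrow> nat \<Rightarrow> nat \<Rightarrow> ((nat \<Rightarrow> complex) \<times> (nat \<Rightarrow> complex)) set" where
  "params n k p q = {(\<mu>, \<nu>). \<mu> \<in> cvec p \<and> \<nu> \<in> cvec q \<and>
      (\<forall>i<q. \<forall>j<n. \<forall>m::nat. \<nu> i \<noteq> of_real (k * real j) - of_nat m)}"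

definition bidisc :: "nat \<Rightarrow> ((nat \<Rightarrow> complex) \<times> (nat \<Rightarrow> complex)) set" where
  "bidisc n = {(z, w). z \<in> cvec n \<and> w \<in> cvec n \<and> supnorm n z * supnorm n w < 1}"

end

theory Submission
  imports Defs "HOL-Complex_Analysis.Complex_Analysis"
begin

text \<open>
  The nonsymmetric Jack polynomials are generated from \<open>E\<^sub>0 = 1\<close> by the raising operator
  \<open>\<Phi> f(x) = x\<^sub>n f(x\<^sub>n, x\<^sub>1, \<dots>, x\<^sub>n\<^sub>-\<^sub>1)\<close> and by the steps \<open>E\<^bsub>s\<^sub>i\<eta>\<^esub> = (s\<^sub>i + c) E\<^sub>\<eta>\<close> for \<open>\<eta>\<^sub>i < \<eta>\<^sub>i\<^sub>+\<^sub>1\<close>, where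
  \<open>c = k / (\<eta>\<^sub>i\<^sub>+\<^sub>1 bar - \<eta>\<^sub>i bar) \<ge> 0\<close>; these upward steps reach every composition, so all coefficients
  are nonnegative.  Comparing coefficients in \<open>s\<^sub>i e\<^sup>m = e\<^sup>m\<close> and in \<open>D\<^sub>n e\<^sup>m\<close>, where \<open>e = x\<^sub>1 + \<dots> + x\<^sub>n\<close>, gives
  recursions along the same two steps for the \<open>c\<^sub>\<eta>\<close>, which are therefore nonnegative as well.  Hence
  \<open>|L\<^sub>\<eta>(z)| \<le> \<parallel>z\<parallel>\<^sup>m L\<^sub>\<eta>(1)\<close> for \<open>m = |\<eta>|\<close>, and it remains to sum the numbers \<open>L\<^sub>\<eta>(1)\<close>.  For \<open>p \<le> q\<close> it
  suffices that they add up to \<open>n\<^sup>m\<close> in degree \<open>m\<close>.  For \<open>p = q + 1\<close> the quotient of Pochhammer symbols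
  is at most \<open>[\<mu>]\<^sub>\<eta>\<close> for a large real \<open>\<mu>\<close>, up to a factor \<open>C S\<^sup>m\<close> with \<open>S > 1\<close> arbitrary, and the
  recursions yield the binomial formula \<open>\<Sum>\<^sub>|\<^sub>\<eta>\<^sub>|\<^sub>=\<^sub>m [\<mu>]\<^sub>\<eta> L\<^sub>\<eta>(1) = (n \<mu>)\<^sub>m\<close>.
\<close>

section \<open>Compositions\<close>

text \<open>The order \<open>prec\<close> in the definition of \<open>jackE\<close> is awkward to
  follow through raising and transpositions. Existence is therefore proved with supports in chains
  of two elementary moves \<open>stp\<close>, and \<open>prec\<close> enters only at the end, where
  such chains are shown to imply it. Uniqueness comes from the spectrum: for \<open>k > 0\<close>
  the eigenvalues determine the ranks and hence the composition, for \<open>k = 0\<close> they are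
  its entries. The constant \<open>c\<close> of the step is dictated by the relation D_i s_i = s_i
  D_{i+1} + k: it is what makes s_i + c exchange two eigenvalues. The difference quotients are
  literal only where the coordinates are distinct, so all operator identities live there, and
  polynomials have to be compared on such points alone. The binomial formula needs no generating
  function. With weights [\<mu>]_\<eta> L_\<eta>(1) the mean of the j-th eigenvalue plus k (j - 1)
  is the same for every j, hence equal to m / n; inserted into the raising recursion this produces
  the factor n \<mu> + m. The numbers L_\<eta>(1) are only shown to be nonnegative. Where one is 0,
  L_\<eta> vanishes as well and the quotient in the series is 0.\<close>

lemma swp_permutes: "a < n \<Longrightarrow> b < n \<Longrightarrow> swp a b permutes {..<n}"
proof -
  assume "a < n" "b < n"
  moreover have "swp a b = Transposition.transpose a b"
    by (auto simp: swp_def fun_eq_iff Transposition.transpose_def)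
  ultimately show ?thesis
    by (simp add: permutes_swap_id)
qed

lemma swp_swp [simp]: "swp a b (swp a b x) = x"
  by (auto simp: swp_def)

lemma comp_swp_swp [simp]: "f \<circ> swp a b \<circ> swp a b = f"
  by (auto simp: fun_eq_iff)

lemma swp_commute: "swp a b = swp b a"
  by (auto simp: swp_def fun_eq_iff)

lemma swp_eq_iff [simp]: "swp a b x = swp a b y \<longleftrightarrow> x = y"
  by (auto simp: swp_def)

lemma swp_less_iff [simp]: "a < n \<Longrightarrow> b < n \<Longrightarrow> swp a b x < n \<longleftrightarrow> x < n"
  by (auto simp: swp_def)

lemma swp_conj: "swp a b (swp c d x) = swp (swp a b c) (swp a b d) (swp a b x)"
  by (auto simp: swp_def)

lemma multi_permutes: "\<eta> \<in> multi n \<Longrightarrow> p permutes {..<n} \<Longrightarrow> \<eta> \<circ> p \<in> multi n"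
  by (auto simp: multi_def permutes_not_in)

lemma weight_permutes: "p permutes {..<n} \<Longrightarrow> weight n (\<eta> \<circ> p) = weight n \<eta>"
  unfolding weight_def comp_def by (rule sum.permute[symmetric, unfolded comp_def])

definition hom :: "nat \<Rightarrow> nat \<Rightarrow> (nat \<Rightarrow> nat) set" where
  "hom n m = {\<eta> \<in> multi n. weight n \<eta> = m}"

lemma hom_multi: "\<eta> \<in> hom n m \<Longrightarrow> \<eta> \<in> multi n"
  by (simp add: hom_def)

lemma hom_le: "\<eta> \<in> hom n m \<Longrightarrow> \<eta> i \<le> m"
  by (cases "i < n") (auto simp: hom_def weight_def multi_def intro: member_le_sum)

lemma finite_hom [simp]: "finite (hom n m)"
proof (rule finite_subset)
  show "hom n m \<subseteq> {f. \<forall>x. (x \<in> {..<n} \<longrightarrow> f x \<in> {..m}) \<and> (x \<notin> {..<n} \<longrightarrow> f x = 0)}"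
    by (auto intro: hom_le dest: hom_multi simp: multi_def)
  show "finite {f. \<forall>x. (x \<in> {..<n} \<longrightarrow> f x \<in> {..m}) \<and> (x \<notin> {..<n} \<longrightarrow> f x = (0::nat))}"
    by (rule finite_set_of_finite_funs) auto
qed

lemma hom_permutes: "\<eta> \<in> hom n m \<Longrightarrow> p permutes {..<n} \<Longrightarrow> \<eta> \<circ> p \<in> hom n m"
  by (simp add: hom_def multi_permutes weight_permutes)

lemma hom_swp_iff [simp]:
  assumes "a < n" "b < n"
  shows "\<eta> \<circ> swp a b \<in> hom n m \<longleftrightarrow> \<eta> \<in> hom n m"
  using hom_permutes[OF _ swp_permutes[OF assms], of _ m] comp_swp_swp[of \<eta> a b] by metis

lemma sum_hom_swp:
  assumes "a < n" "b < n"
  shows "(\<Sum>\<eta>\<in>hom n m. f (\<eta> \<circ> swp a b)) = (\<Sum>\<eta>\<in>hom n m. f \<eta>)"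
  by (rule sum.reindex_bij_witness[where i = "\<lambda>\<eta>. \<eta> \<circ> swp a b" and j = "\<lambda>\<eta>. \<eta> \<circ> swp a b"])
     (use assms in auto)

lemma hom_0 [simp]: "hom n 0 = {\<lambda>_. 0}"
proof -
  have "\<eta> = (\<lambda>_. 0)" if "\<forall>i\<ge>n. \<eta> i = 0" "\<forall>i<n. \<eta> i = 0" for \<eta> :: "nat \<Rightarrow> nat"
    using that by (meson ext linorder_not_le)
  thus ?thesis
    by (auto simp: hom_def multi_def weight_def)
qed

section \<open>Raising operator on compositions\<close>

definition raise :: "nat \<Rightarrow> (nat \<Rightarrow> nat) \<Rightarrow> nat \<Rightarrow> nat" where
  "raise n \<eta> i = (if Suc i < n then \<eta> (Suc i) else if Suc i = n then Suc (\<eta> 0) else 0)"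

text \<open>Inverse of \<open>raise n\<close> on compositions with positive last entry. The
  truncated subtraction bites only outside that range, which is excluded or tested for wherever the
  result matters.\<close>

definition lower :: "nat \<Rightarrow> (nat \<Rightarrow> nat) \<Rightarrow> nat \<Rightarrow> nat" where
  "lower n \<eta> i = (if i = 0 then \<eta> (n - 1) - 1 else if i < n then \<eta> (i - 1) else 0)"

text \<open>\<open>raise n\<close> moves the entry at position \<open>j\<close> to
  \<open>cyc n j\<close> and then adds 1 to the one that was first. On points, composing with
  \<open>cyc n\<close> is the cyclic shift inside the raising operator.\<close>

definition cyc :: "nat \<Rightarrow> nat \<Rightarrow> nat" where
  "cyc n i = (if i = 0 then n - 1 else if i < n then i - 1 else i)"

lemma cyc_permutes: "0 < n \<Longrightarrow> cyc n permutes {..<n}"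
  by (rule bij_imp_permutes, rule bij_betwI[where g = "\<lambda>i. if Suc i = n then 0 else Suc i"])
     (auto simp: cyc_def split: if_splits)

lemma raise_multi: "0 < n \<Longrightarrow> raise n \<eta> \<in> multi n"
  by (auto simp: multi_def raise_def)

lemma weight_raise: "0 < n \<Longrightarrow> weight n (raise n \<eta>) = Suc (weight n \<eta>)"
proof -
  assume "0 < n"
  then obtain n' where n: "n = Suc n'" by (cases n) auto
  have "(\<Sum>i<n'. raise n \<eta> i) = (\<Sum>i<n'. \<eta> (Suc i))"
    by (intro sum.cong) (auto simp: raise_def n)
  thus ?thesis
    unfolding weight_def n sum.lessThan_Suc[of "raise (Suc n') \<eta>"] sum.lessThan_Suc_shift[of \<eta>]
    by (simp add: raise_def n)
qed

lemma raise_hom: "0 < n \<Longrightarrow> \<eta> \<in> hom n m \<Longrightarrow> raise n \<eta> \<in> hom n (Suc m)"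
  by (simp add: hom_def raise_multi weight_raise)

lemma lower_raise: "0 < n \<Longrightarrow> \<eta> \<in> multi n \<Longrightarrow> lower n (raise n \<eta>) = \<eta>"
  by (auto simp: lower_def raise_def fun_eq_iff multi_def)

lemma raise_lower: "\<eta> \<in> multi n \<Longrightarrow> 0 < \<eta> (n - 1) \<Longrightarrow> raise n (lower n \<eta>) = \<eta>"
proof
  fix i assume "\<eta> \<in> multi n" "0 < \<eta> (n - 1)"
  thus "raise n (lower n \<eta>) i = \<eta> i"
    by (cases "i = n - 1"; cases "i < n") (auto simp: lower_def raise_def multi_def)
qed

lemma lower_multi: "0 < n \<Longrightarrow> lower n \<eta> \<in> multi n"
  by (auto simp: lower_def multi_def)

lemma lower_hom:
  assumes "\<eta> \<in> hom n (Suc m)" "0 < \<eta> (n - 1)" "0 < n"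
  shows "lower n \<eta> \<in> hom n m"
proof -
  have "Suc (weight n (lower n \<eta>)) = Suc m"
    using weight_raise[of n "lower n \<eta>"] raise_lower[of \<eta> n] assms by (simp add: hom_def)
  thus ?thesis using assms lower_multi by (simp add: hom_def)
qed

text \<open>The image of \<open>raise n\<close> in degree \<open>Suc m\<close> consists of the
  compositions with positive last entry, so only terms with last entry 0 have to be disposed
  of.\<close>

lemma sum_hom_raise:
  assumes "0 < n" "\<And>\<eta>. \<eta> \<in> hom n (Suc m) \<Longrightarrow> \<eta> (n - 1) = 0 \<Longrightarrow> f \<eta> = 0"
  shows "(\<Sum>\<eta>\<in>hom n (Suc m). f \<eta>) = (\<Sum>\<eta>\<in>hom n m. f (raise n \<eta>))"
proof -
  have "(\<Sum>\<eta>\<in>hom n (Suc m). f \<eta>) = (\<Sum>\<eta>\<in>{\<eta> \<in> hom n (Suc m). 0 < \<eta> (n - 1)}. f \<eta>)"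
    using assms(2) by (intro sum.mono_neutral_right) auto
  also have "\<dots> = (\<Sum>\<eta>\<in>hom n m. f (raise n \<eta>))"
  proof (rule sum.reindex_bij_witness[where i = "raise n" and j = "lower n"])
    fix \<eta> assume "\<eta> \<in> hom n m"
    then show "raise n \<eta> \<in> {\<eta> \<in> hom n (Suc m). 0 < \<eta> (n - 1)}"
      using raise_hom[OF assms(1)] assms(1) by (auto simp: raise_def)
  qed (use assms lower_hom in \<open>auto simp: raise_lower lower_raise hom_multi\<close>)
  finally show ?thesis .
qed

text \<open>A nonzero composition enters the range of \<open>raise\<close> once its last nonzero
  entry is pushed to the end. Read backwards, each push exchanges an ascent, so the swap case may
  assume one; this later fixes the signs of all constants.\<close>

lemma multi_induct [consumes 1, case_names zero raise swap]:
  assumes "\<eta> \<in> multi n"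
    and zero: "P (\<lambda>_. 0)"
    and raise: "\<And>\<kappa>. 0 < n \<Longrightarrow> \<kappa> \<in> multi n \<Longrightarrow> P \<kappa> \<Longrightarrow> P (raise n \<kappa>)"
    and swap: "\<And>\<kappa> i. \<kappa> \<in> multi n \<Longrightarrow> Suc i < n \<Longrightarrow> \<kappa> i < \<kappa> (Suc i) \<Longrightarrow> P \<kappa> \<Longrightarrow>
                 P (\<kappa> \<circ> swp i (Suc i))"
  shows "P \<eta>"
proof -
  have "\<forall>\<eta>\<in>hom n m. P \<eta>" for m
  proof (induction m)
    case 0
    show ?case using zero by simp
  next
    case (Suc m)
    \<comment> \<open>\<open>d\<close> is the distance from the last nonzero entry, at
      \<open>i\<close>, to the final position; each inner step moves that entry to the right past a
      zero.\<close>
    have *: "P \<eta>" if "\<eta> \<in> hom n (Suc m)" "i < n" "i + d = n - 1" "0 < \<eta> i" "\<forall>j>i. \<eta> j = 0" for \<eta> i d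
      using that
    proof (induction d arbitrary: \<eta> i)
      case 0
      hence "0 < n" "0 < \<eta> (n - 1)" by auto
      hence "lower n \<eta> \<in> hom n m" using lower_hom 0 by blast
      hence "P (raise n (lower n \<eta>))"
        using Suc.IH raise[of "lower n \<eta>"] \<open>0 < n\<close> by (auto simp: hom_def)
      thus ?case using raise_lower 0 \<open>0 < \<eta> (n - 1)\<close> by (simp add: hom_def)
    next
      case (Suc d)
      let ?s = "swp i (Suc i)"
      have i: "Suc i < n" using Suc.prems by auto
      have "P (\<eta> \<circ> ?s)"
      proof (rule Suc.IH[where i = "Suc i"])
        show "\<forall>j>Suc i. (\<eta> \<circ> ?s) j = 0" using Suc.prems by (auto simp: swp_def)
        show "\<eta> \<circ> ?s \<in> hom n (Suc m)" using i Suc.prems(1) by simp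
        show "0 < (\<eta> \<circ> ?s) (Suc i)" using Suc.prems by (simp add: swp_def)
      qed (use i Suc.prems in auto)
      moreover have "(\<eta> \<circ> ?s) i < (\<eta> \<circ> ?s) (Suc i)"
        using Suc.prems by (auto simp: swp_def)
      moreover have "\<eta> \<circ> ?s \<in> multi n"
        using i Suc.prems(1) hom_multi hom_swp_iff[of i n "Suc i"] by (metis Suc_lessD)
      ultimately have "P (\<eta> \<circ> ?s \<circ> ?s)" using swap i by blast
      thus ?case by simp
    qed
    show ?case
    proof
      fix \<eta> assume \<eta>: "\<eta> \<in> hom n (Suc m)"
      define A where "A = {i. 0 < \<eta> i}"
      have A: "A \<subseteq> {..<n}" using \<eta> by (auto simp: A_def hom_def multi_def intro: leI)
      hence fin: "finite A" using finite_subset by blast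
      have "A \<noteq> {}"
      proof
        assume "A = {}"
        hence "weight n \<eta> = 0" by (auto simp: A_def weight_def)
        thus False using \<eta> by (simp add: hom_def)
      qed
      hence "Max A \<in> A" using fin by simp
      have "\<forall>j>Max A. \<eta> j = 0"
        using Max_ge[OF fin] A_def by fastforce
      moreover have "Max A < n" "0 < \<eta> (Max A)"
        using \<open>Max A \<in> A\<close> A by (auto simp: A_def)
      moreover have "Max A + (n - 1 - Max A) = n - 1"
        using \<open>Max A < n\<close> by simp
      ultimately show "P \<eta>"
        using *[OF \<eta>] by blast
    qed
  qed
  thus ?thesis using assms(1) by (auto simp: hom_def)
qed

section \<open>Ranks and the spectrum\<close>

text \<open>\<open>rk n \<eta> j\<close> is the position of \<open>\<eta> j\<close> in the stably sorted decreasing rearrangement of \<open>\<eta>\<close>.\<close>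

definition before :: "(nat \<Rightarrow> nat) \<Rightarrow> nat \<Rightarrow> nat \<Rightarrow> bool" where
  "before \<eta> i j \<longleftrightarrow> \<eta> j < \<eta> i \<or> \<eta> i = \<eta> j \<and> i < j"

definition rk :: "nat \<Rightarrow> (nat \<Rightarrow> nat) \<Rightarrow> nat \<Rightarrow> nat" where
  "rk n \<eta> j = card {i. i < n \<and> before \<eta> i j}"

definition ebar :: "nat \<Rightarrow> real \<Rightarrow> (nat \<Rightarrow> nat) \<Rightarrow> nat \<Rightarrow> real" where
  "ebar n k \<eta> j = real (\<eta> j) - k * real (rk n \<eta> j)"

lemma eta_bar_eq: "j < n \<Longrightarrow> eta_bar n k \<eta> j = of_real (ebar n k \<eta> j)"
proof -
  assume j: "j < n"
  have "{i. i < n \<and> before \<eta> i j} = {i. i < j \<and> \<eta> j \<le> \<eta> i} \<union> {i. j < i \<and> i < n \<and> \<eta> j < \<eta> i}"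
    using j by (auto simp: before_def) (metis linorder_neqE_nat less_irrefl)+
  hence "rk n \<eta> j = card {i. i < j \<and> \<eta> j \<le> \<eta> i} + card {i. j < i \<and> i < n \<and> \<eta> j < \<eta> i}"
    unfolding rk_def by (simp add: card_Un_disjoint disjoint_iff)
  thus ?thesis by (simp add: eta_bar_def ebar_def algebra_simps)
qed

lemma rk_less: "i < n \<Longrightarrow> before \<eta> i j \<Longrightarrow> rk n \<eta> i < rk n \<eta> j"
  unfolding rk_def by (rule psubset_card_mono) (auto simp: before_def)

lemma rk_lt: "j < n \<Longrightarrow> rk n \<eta> j < n"
proof -
  assume "j < n"
  hence "{i. i < n \<and> before \<eta> i j} \<subset> {..<n}" by (auto simp: before_def)
  from psubset_card_mono[OF _ this] show ?thesis by (simp add: rk_def)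
qed

text \<open>Each rank gained costs \<open>k\<close>. For unequal entries the gap \<open>d\<close> is
  thus at least \<open>1 + k\<close>, which keeps the later denominators \<open>d\<close> and
  \<open>d - k\<close> positive.\<close>

lemma ebar_diff:
  assumes "0 \<le> k" "i < n" "before \<eta> i j"
  shows "ebar n k \<eta> i - ebar n k \<eta> j \<ge> real (\<eta> i) - real (\<eta> j) + k"
proof -
  have "real (rk n \<eta> i) + 1 \<le> real (rk n \<eta> j)" using rk_less[OF assms(2,3)] by linarith
  from mult_left_mono[OF this assms(1)] show ?thesis by (simp add: ebar_def algebra_simps)
qed

lemma ebar_diff_less:
  assumes "0 \<le> k" "i < n" "\<eta> j < \<eta> i"
  shows "ebar n k \<eta> i - ebar n k \<eta> j \<ge> 1 + k"
  using ebar_diff[of k i n \<eta> j] assms by (simp add: before_def)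

lemma before_total: "i \<noteq> j \<Longrightarrow> before \<eta> i j \<or> before \<eta> j i"
  by (auto simp: before_def)

text \<open>For positive \<open>k\<close> the eigenvalues are strictly sorted by
  \<open>before\<close>, so the ranks can be read off from them.\<close>

lemma rk_eq_card_ebar:
  assumes "0 < k" "j < n"
  shows "rk n \<eta> j = card {i. i < n \<and> ebar n k \<eta> j < ebar n k \<eta> i}"
proof -
  have gt: "ebar n k \<eta> j < ebar n k \<eta> i" if "before \<eta> i j" "i < n" for i j
    using ebar_diff[of k i n \<eta> j] that assms by (auto simp: before_def)
  have "before \<eta> i j \<longleftrightarrow> ebar n k \<eta> j < ebar n k \<eta> i" if "i < n" for i
    using gt[of i j] gt[of j i] before_total[of i j \<eta>] that assms by force
  hence "{i. i < n \<and> before \<eta> i j} = {i. i < n \<and> ebar n k \<eta> j < ebar n k \<eta> i}" by blast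
  thus ?thesis by (simp add: rk_def)
qed

text \<open>Rank and eigenvalue together return the entry; at \<open>k = 0\<close> the eigenvalue is
  the entry. With \<open>p\<close> the identity this separates the spectra of compositions; an
  adjacent transposition is needed in \<open>JE_swap_eq\<close>.\<close>

lemma ebar_inject:
  assumes "0 \<le> k" "p permutes {..<n}" "\<And>j. j < n \<Longrightarrow> ebar n k \<kappa> j = ebar n k \<eta> (p j)"
    and "\<kappa> \<in> multi n" "\<eta> \<in> multi n"
  shows "\<kappa> = \<eta> \<circ> p"
proof
  fix j
  show "\<kappa> j = (\<eta> \<circ> p) j"
  proof (cases "j < n")
    case True
    hence pj: "p j < n" using permutes_in_image[OF assms(2)] by auto
    show ?thesis
    proof (cases "k = 0")
      case True
      thus ?thesis using assms(3)[OF \<open>j < n\<close>] by (simp add: ebar_def)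
    next
      case False
      hence k: "0 < k" using assms(1) by simp
      have "bij_betw p {i. i < n \<and> ebar n k \<kappa> j < ebar n k \<kappa> i}
               {i. i < n \<and> ebar n k \<eta> (p j) < ebar n k \<eta> i}"
      proof (rule bij_betwI[where g = "inv p"])
        have "p i < n" if "i < n" for i
          using that permutes_in_image[OF assms(2), of i] by auto
        thus "p \<in> {i. i < n \<and> ebar n k \<kappa> j < ebar n k \<kappa> i} \<rightarrow>
               {i. i < n \<and> ebar n k \<eta> (p j) < ebar n k \<eta> i}"
          using assms(3) \<open>j < n\<close> by (intro Pi_I) (metis (mono_tags, lifting) mem_Collect_eq)
        have "inv p i < n \<and> ebar n k \<kappa> (inv p i) = ebar n k \<eta> i" if "i < n" for i
          using that permutes_in_image[OF permutes_inv[OF assms(2)], of i] assms(3)[of "inv p i"]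
          by (simp add: permutes_inverses[OF assms(2)])
        thus "inv p \<in> {i. i < n \<and> ebar n k \<eta> (p j) < ebar n k \<eta> i} \<rightarrow>
               {i. i < n \<and> ebar n k \<kappa> j < ebar n k \<kappa> i}"
          using assms(3)[OF \<open>j < n\<close>] by (intro Pi_I) (metis (mono_tags, lifting) mem_Collect_eq)
      qed (auto simp: permutes_inverses[OF assms(2)])
      hence "rk n \<kappa> j = rk n \<eta> (p j)"
        using rk_eq_card_ebar[OF k] \<open>j < n\<close> pj by (simp add: bij_betw_same_card)
      thus ?thesis using assms(3)[OF \<open>j < n\<close>] by (simp add: ebar_def)
    qed
  next
    case False
    thus ?thesis using assms(2,4,5) by (auto simp: multi_def permutes_not_in)
  qed
qed

lemma rk_permute:
  assumes "p permutes {..<n}" "\<And>i. i < n \<Longrightarrow> before \<kappa> i j \<longleftrightarrow> before \<eta> (p i) (p j)"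
  shows "rk n \<kappa> j = rk n \<eta> (p j)"
proof -
  have "bij_betw p {i. i < n \<and> before \<kappa> i j} {i. i < n \<and> before \<eta> i (p j)}"
  proof (rule bij_betwI[where g = "inv p"])
    show "p \<in> {i. i < n \<and> before \<kappa> i j} \<rightarrow> {i. i < n \<and> before \<eta> i (p j)}"
      using assms permutes_in_image[OF assms(1)] by auto
    have "inv p i < n" if "i < n" for i
      using that permutes_in_image[OF permutes_inv[OF assms(1)]] by auto
    thus "inv p \<in> {i. i < n \<and> before \<eta> i (p j)} \<rightarrow> {i. i < n \<and> before \<kappa> i j}"
      using assms(2) by (auto simp: permutes_inverses[OF assms(1)])
  qed (auto simp: permutes_inverses[OF assms(1)])
  thus ?thesis by (simp add: rk_def bij_betw_same_card)
qed

lemma rk_swp: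
  assumes "Suc i < n" "\<eta> i \<noteq> \<eta> (Suc i)"
  shows "rk n (\<eta> \<circ> swp i (Suc i)) j = rk n \<eta> (swp i (Suc i) j)"
  by (rule rk_permute[OF swp_permutes]) (use assms in \<open>auto simp: before_def swp_def split: if_splits\<close>)

lemma ebar_swp:
  assumes "Suc i < n" "\<eta> i \<noteq> \<eta> (Suc i)"
  shows "ebar n k (\<eta> \<circ> swp i (Suc i)) j = ebar n k \<eta> (swp i (Suc i) j)"
  by (simp add: ebar_def rk_swp[OF assms])

text \<open>Equal neighbours are consecutive in the stable order, so their ranks differ by exactly
  1.\<close>

lemma ebar_Suc_eq:
  assumes "Suc i < n" "\<eta> i = \<eta> (Suc i)"
  shows "ebar n k \<eta> i - ebar n k \<eta> (Suc i) = k"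
proof -
  have "{l. l < n \<and> before \<eta> l (Suc i)} = insert i {l. l < n \<and> before \<eta> l i}"
    using assms by (auto simp: before_def less_Suc_eq)
  moreover have "i \<notin> {l. l < n \<and> before \<eta> l i}" by (simp add: before_def)
  ultimately have "rk n \<eta> (Suc i) = Suc (rk n \<eta> i)" by (simp add: rk_def)
  thus ?thesis using assms by (simp add: ebar_def algebra_simps)
qed

text \<open>The first entry preceded everything it tied with. At the end it would lose these ties,
  but the added 1 wins them back, and entries it newly ties with were already larger.\<close>

lemma rk_raise:
  assumes "0 < n" "j < n"
  shows "rk n (raise n \<eta>) (cyc n j) = rk n \<eta> j"
  by (rule rk_permute[OF cyc_permutes, symmetric])
     (use assms in \<open>auto simp: before_def cyc_def raise_def split: if_splits\<close>)

lemma ebar_raise_last: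
  assumes "0 < n"
  shows "ebar n k (raise n \<eta>) (n - 1) = ebar n k \<eta> 0 + 1"
  using rk_raise[OF assms assms, of \<eta>] assms by (simp add: ebar_def cyc_def raise_def)

lemma ebar_raise:
  assumes "Suc j < n"
  shows "ebar n k (raise n \<eta>) j = ebar n k \<eta> (Suc j)"
  using rk_raise[of n "Suc j" \<eta>] assms by (simp add: ebar_def cyc_def raise_def)

text \<open>All other entries are larger, or equal and further left. Hence \<open>ebar\<close> at
  the last place is \<open>- k * (n - 1)\<close>, which removes the boundary terms in
  \<open>sum_om_ell\<close>.\<close>

lemma rk_last: "0 < n \<Longrightarrow> \<eta> (n - 1) = 0 \<Longrightarrow> rk n \<eta> (n - 1) = n - 1"
proof -
  assume "0 < n" "\<eta> (n - 1) = 0"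
  hence "before \<eta> i (n - 1) \<longleftrightarrow> i < n - 1" if "i < n" for i
    using that by (cases "i = n - 1") (auto simp: before_def)
  hence "{i. i < n \<and> before \<eta> i (n - 1)} = {..<n-1}" using \<open>0 < n\<close> by auto
  thus ?thesis by (simp add: rk_def)
qed

lemma sum_rk: "\<eta> \<in> multi n \<Longrightarrow> (\<Sum>j<n. rk n \<eta> j) = (\<Sum>j<n. j)"
proof (induction rule: multi_induct)
  case zero
  have "{i. i < n \<and> i < j} = {..<j}" if "j < n" for j using that by auto
  thus ?case by (simp add: rk_def before_def)
next
  case (raise \<kappa>)
  have "(\<Sum>j<n. rk n (raise n \<kappa>) j) = (\<Sum>j<n. rk n (raise n \<kappa>) (cyc n j))"
    using sum.permute[OF cyc_permutes[OF raise(1)], of "rk n (raise n \<kappa>)"] by simp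
  thus ?case using raise by (simp add: rk_raise)
next
  case (swap \<kappa> i)
  have "(\<Sum>j<n. rk n \<kappa> (swp i (Suc i) j)) = (\<Sum>j<n. rk n \<kappa> j)"
    using sum.permute[OF swp_permutes[of i n "Suc i"], of "rk n \<kappa>"] swap by simp
  moreover have "(\<Sum>j<n. rk n (\<kappa> \<circ> swp i (Suc i)) j) = (\<Sum>j<n. rk n \<kappa> (swp i (Suc i) j))"
    using swap by (intro sum.cong refl rk_swp) auto
  ultimately show ?case using swap.IH by metis
qed

section \<open>A triangularity order\<close>

text \<open>The transitive closure of the following steps is contained in the order of the definition of
  the Jack polynomials, but its compatibility with raising and with transpositions is elementary.\<close>

inductive stp :: "nat \<Rightarrow> (nat \<Rightarrow> nat) \<Rightarrow> (nat \<Rightarrow> nat) \<Rightarrow> bool" for n where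
  squash: "a < n \<Longrightarrow> b < n \<Longrightarrow> a \<noteq> b \<Longrightarrow> (\<And>i. i \<noteq> a \<Longrightarrow> i \<noteq> b \<Longrightarrow> \<kappa> i = \<eta> i) \<Longrightarrow>
     \<kappa> a + \<kappa> b = \<eta> a + \<eta> b \<Longrightarrow> \<kappa> a < \<eta> a \<Longrightarrow> \<kappa> b < \<eta> a \<Longrightarrow> stp n \<kappa> \<eta>"
| down: "a < b \<Longrightarrow> b < n \<Longrightarrow> \<eta> b < \<eta> a \<Longrightarrow> stp n (\<eta> \<circ> swp a b) \<eta>"

lemma raise_nth: "j < n \<Longrightarrow> raise n \<eta> (cyc n j) = \<eta> j + (if j = 0 then 1 else 0)"
  by (auto simp: raise_def cyc_def)

lemma cyc_inject: "i < n \<Longrightarrow> j < n \<Longrightarrow> cyc n i = cyc n j \<longleftrightarrow> i = j"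
  using permutes_inj[OF cyc_permutes[of n]] by (auto dest: injD)

lemma cyc_surj: "i < n \<Longrightarrow> \<exists>j<n. i = cyc n j"
proof -
  assume i: "i < n"
  have "i \<in> cyc n ` {..<n}" using permutes_image[OF cyc_permutes[of n]] i by auto
  thus ?thesis by auto
qed

lemma cyc_less: "j < n \<Longrightarrow> cyc n j < n"
  by (auto simp: cyc_def)

lemma stp_raise: "stp n \<kappa> \<eta> \<Longrightarrow> stp n (raise n \<kappa>) (raise n \<eta>)"
proof (induction rule: stp.induct)
  case (squash a b \<kappa> \<eta>)
  have off: "raise n \<kappa> i = raise n \<eta> i" if "i \<noteq> cyc n a" "i \<noteq> cyc n b" for i
  proof (cases "i < n")
    case True
    then obtain j where j: "j < n" "i = cyc n j" using cyc_surj by blast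
    hence "j \<noteq> a" "j \<noteq> b" using that by auto
    thus ?thesis using j squash by (simp add: raise_nth)
  qed (auto simp: raise_def)
  have ne: "cyc n a \<noteq> cyc n b" using cyc_inject squash by simp
  show ?case
  proof (cases "b = 0 \<and> Suc (\<kappa> 0) = \<eta> a")
    case False
    show ?thesis
      by (rule stp.squash[where a = "cyc n a" and b = "cyc n b"])
         (use squash off ne False in \<open>auto simp: raise_nth cyc_less\<close>)
  next
    \<comment> \<open>Raising closes the gap here: the raised pair of \<open>\<kappa>\<close> is the
      raised pair of \<open>\<eta>\<close> exchanged, so the squash turns into a \<open>down\<close>
      step.\<close>
    case True
    have a: "0 < a" using True squash by auto
    have ka: "\<kappa> a = Suc (\<eta> 0)" using True squash by auto
    have "raise n \<kappa> i = (raise n \<eta> \<circ> swp (a - 1) (n - 1)) i" for i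
      using off[of i] a True ka squash by (auto simp: swp_def cyc_def raise_def)
    hence "raise n \<kappa> = raise n \<eta> \<circ> swp (a - 1) (n - 1)" by blast
    moreover have "stp n (raise n \<eta> \<circ> swp (a - 1) (n - 1)) (raise n \<eta>)"
      by (rule stp.down) (use a ka squash in \<open>auto simp: raise_def\<close>)
    ultimately show ?thesis by metis
  qed
next
  case (down a b \<eta>)
  show ?case
  \<comment> \<open>If position 0 takes part, the extra 1 falls on \<open>\<eta> 0\<close> in one
    composition and on \<open>\<eta> b\<close> in the other, and the exchange becomes a
    squash.\<close>
  proof (cases "a = 0")
    case True
    show ?thesis
      by (rule stp.squash[where a = "n - 1" and b = "b - 1"])
         (use True down in \<open>auto simp: raise_def swp_def\<close>)
  next
    case False
    have "raise n (\<eta> \<circ> swp a b) = raise n \<eta> \<circ> swp (a - 1) (b - 1)"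
      using down False by (auto simp: raise_def swp_def fun_eq_iff)
    moreover have "stp n (raise n \<eta> \<circ> swp (a - 1) (b - 1)) (raise n \<eta>)"
      by (rule stp.down) (use False down in \<open>auto simp: raise_def\<close>)
    ultimately show ?thesis by metis
  qed
qed

lemma stps_raise: "(stp n)\<^sup>*\<^sup>* \<kappa> \<eta> \<Longrightarrow> (stp n)\<^sup>*\<^sup>* (raise n \<kappa>) (raise n \<eta>)"
  by (induction rule: rtranclp_induct) (auto dest: stp_raise)

text \<open>Conjugation by an adjacent transposition preserves the order \<open>a < b\<close> of the
  two positions, except when the step is that very transposition; this is the second
  alternative.\<close>

lemma stp_swp:
  assumes "stp n \<kappa> \<eta>" "Suc i < n"
  shows "stp n (\<kappa> \<circ> swp i (Suc i)) (\<eta> \<circ> swp i (Suc i)) \<or> \<kappa> \<circ> swp i (Suc i) = \<eta>"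
  using assms
proof (induction rule: stp.induct)
  case (squash a b \<kappa> \<eta>)
  let ?s = "swp i (Suc i)"
  have "(\<kappa> \<circ> ?s) j = (\<eta> \<circ> ?s) j" if "j \<noteq> ?s a" "j \<noteq> ?s b" for j
  proof -
    have "?s j \<noteq> a" "?s j \<noteq> b" using that swp_swp by metis+
    thus ?thesis using squash by simp
  qed
  hence "stp n (\<kappa> \<circ> ?s) (\<eta> \<circ> ?s)"
    by (intro stp.squash[where a = "?s a" and b = "?s b"]) (use squash in simp_all)
  thus ?case ..
next
  case (down a b \<eta>)
  let ?s = "swp i (Suc i)"
  show ?case
  proof (cases "a = i \<and> b = Suc i")
    case True
    thus ?thesis by simp
  next
    case False
    have "?s a < ?s b" using False down by (auto simp: swp_def)
    have eq: "\<eta> \<circ> swp a b \<circ> ?s = \<eta> \<circ> ?s \<circ> swp (?s a) (?s b)"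
      by (auto simp: fun_eq_iff swp_conj[of i "Suc i" "?s a"])
    have "stp n (\<eta> \<circ> ?s \<circ> swp (?s a) (?s b)) (\<eta> \<circ> ?s)"
      by (rule stp.down) (use down \<open>?s a < ?s b\<close> in simp_all)
    thus ?thesis using eq by metis
  qed
qed

text \<open>The counterpart of the lifting property of the Bruhat order.\<close>

lemma stps_swp:
  assumes "(stp n)\<^sup>*\<^sup>* \<kappa> \<eta>" "Suc i < n"
  defines "\<theta> \<equiv> if \<eta> i < \<eta> (Suc i) then \<eta> \<circ> swp i (Suc i) else \<eta>"
  shows "(stp n)\<^sup>*\<^sup>* \<kappa> \<theta> \<and> (stp n)\<^sup>*\<^sup>* (\<kappa> \<circ> swp i (Suc i)) \<theta>"
  using assms(1)
proof (induction rule: converse_rtranclp_induct)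
  case base
  consider "\<eta> i < \<eta> (Suc i)" | "\<eta> (Suc i) < \<eta> i" | "\<eta> i = \<eta> (Suc i)" by linarith
  thus ?case
  proof cases
    case 1
    have "stp n (\<eta> \<circ> swp i (Suc i) \<circ> swp i (Suc i)) (\<eta> \<circ> swp i (Suc i))"
      by (rule stp.down) (use 1 assms in \<open>auto simp: swp_def\<close>)
    hence "stp n \<eta> \<theta>" "\<eta> \<circ> swp i (Suc i) = \<theta>" using 1 unfolding \<theta>_def comp_swp_swp by simp_all
    thus ?thesis by (metis r_into_rtranclp rtranclp.rtrancl_refl)
  next
    case 2
    have "stp n (\<eta> \<circ> swp i (Suc i)) \<eta>"
      by (rule stp.down) (use 2 assms in \<open>auto simp: swp_def\<close>)
    moreover have "\<theta> = \<eta>" using 2 by (simp add: \<theta>_def)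
    ultimately show ?thesis by (metis r_into_rtranclp rtranclp.rtrancl_refl)
  next
    case 3
    hence "\<eta> \<circ> swp i (Suc i) = \<eta>" by (auto simp: swp_def)
    thus ?thesis using 3 by (simp add: \<theta>_def)
  qed
next
  case (step \<kappa>' \<kappa>)
  thus ?case using stp_swp[OF step(1) assms(2)]
    by (metis converse_rtranclp_into_rtranclp)
qed

section \<open>A measure that drops along the steps\<close>

lemma sum_split2:
  fixes f :: "nat \<Rightarrow> 'a::comm_monoid_add"
  assumes "finite A" "a \<in> A" "b \<in> A" "a \<noteq> b"
  shows "sum f A = f a + f b + sum f (A - {a, b})"
proof -
  have "sum f A = f a + sum f (A - {a})" using assms by (simp add: sum.remove)
  also have "sum f (A - {a}) = f b + sum f (A - {a} - {b})" using assms by (simp add: sum.remove)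
  also have "A - {a} - {b} = A - {a, b}" by blast
  finally show ?thesis by (simp add: add.assoc)
qed

text \<open>A lexicographic order packed into one number: the squares first, then the position sum,
  reversed. In degree \<open>m\<close> the position sum is at most \<open>n * m\<close>, so the
  factor \<open>n * m + 1\<close> lets the squares dominate.\<close>

definition msr :: "nat \<Rightarrow> nat \<Rightarrow> (nat \<Rightarrow> nat) \<Rightarrow> nat" where
  "msr n m \<kappa> = (\<Sum>i<n. (\<kappa> i)\<^sup>2) * (n * m + 1) + (n * m - (\<Sum>i<n. i * \<kappa> i))"

text \<open>Convexity: with t = u - x the two sides differ by 2 t (x - v).\<close>

lemma squash_squares:
  fixes x y u v :: nat
  assumes "x + y = u + v" "x < u" "y < u"
  shows "x\<^sup>2 + y\<^sup>2 < u\<^sup>2 + v\<^sup>2"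
proof -
  define t where "t = u - x"
  have u: "u = x + t" "y = v + t" "0 < t" "v < x" using assms by (auto simp: t_def)
  have "v * t < x * t" using u by simp
  hence "t * v + t * v < t * x + t * x" by (simp add: mult.commute add_strict_mono del: mult_less_cancel1 mult_less_cancel2)
  thus ?thesis unfolding u(1,2) by (simp add: power2_eq_square algebra_simps)
qed

lemma squash_sum_squares:
  assumes "a < n" "b < n" "a \<noteq> b" "\<And>i. i \<noteq> a \<Longrightarrow> i \<noteq> b \<Longrightarrow> \<kappa> i = \<eta> i"
    "\<kappa> a + \<kappa> b = \<eta> a + \<eta> b" "\<kappa> a < \<eta> a" "\<kappa> b < \<eta> a"
  shows "(\<Sum>i<n. (\<kappa> i)\<^sup>2) < (\<Sum>i<(n::nat). (\<eta> i :: nat)\<^sup>2)"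
proof -
  have "(\<Sum>i\<in>{..<n} - {a, b}. (\<kappa> i)\<^sup>2) = (\<Sum>i\<in>{..<n} - {a, b}. (\<eta> i)\<^sup>2)"
    using assms by (intro sum.cong) auto
  thus ?thesis
    using sum_split2[of "{..<n}" a b "\<lambda>i. (\<kappa> i)\<^sup>2"] sum_split2[of "{..<n}" a b "\<lambda>i. (\<eta> i)\<^sup>2"]
      squash_squares[OF assms(5-7)] assms by simp
qed

lemma sum_squares_permutes:
  "p permutes {..<n} \<Longrightarrow> (\<Sum>i<n. ((\<eta> \<circ> p) i)\<^sup>2) = (\<Sum>i<n. (\<eta> i :: nat)\<^sup>2)"
  using sum.permute[of p "{..<n}" "\<lambda>i. (\<eta> i)\<^sup>2"] by (simp add: comp_def)

lemma stp_hom_msr: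
  assumes "stp n \<kappa> \<eta>" "\<eta> \<in> hom n m"
  shows "\<kappa> \<in> hom n m \<and> msr n m \<kappa> < msr n m \<eta>"
  using assms
proof (induction rule: stp.induct)
  case (squash a b \<kappa> \<eta>)
  have "(\<Sum>i\<in>{..<n} - {a, b}. \<kappa> i) = (\<Sum>i\<in>{..<n} - {a, b}. \<eta> i)"
    using squash by (intro sum.cong) auto
  hence "weight n \<kappa> = weight n \<eta>"
    using sum_split2[of "{..<n}" a b \<kappa>] sum_split2[of "{..<n}" a b \<eta>] squash
    by (simp add: weight_def)
  moreover have "\<kappa> \<in> multi n"
    using squash by (auto simp: hom_def multi_def)
  ultimately have hom: "\<kappa> \<in> hom n m" using squash by (simp add: hom_def)
  have "(\<Sum>i<n. (\<kappa> i)\<^sup>2) + 1 \<le> (\<Sum>i<n. (\<eta> i)\<^sup>2)"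
    using squash_sum_squares[of a n b \<kappa> \<eta>] squash by simp
  hence "((\<Sum>i<n. (\<kappa> i)\<^sup>2) + 1) * (n * m + 1) \<le> (\<Sum>i<n. (\<eta> i)\<^sup>2) * (n * m + 1)"
    by (rule mult_le_mono1)
  hence "msr n m \<kappa> < msr n m \<eta>" unfolding msr_def by (simp add: algebra_simps)
  thus ?case using hom by simp
next
  case (down a b \<eta>)
  let ?\<kappa> = "\<eta> \<circ> swp a b"
  have sq: "(\<Sum>i<n. (?\<kappa> i)\<^sup>2) = (\<Sum>i<n. (\<eta> i)\<^sup>2)"
    using sum_squares_permutes[OF swp_permutes] down by simp
  have hom: "?\<kappa> \<in> hom n m" using down by simp
  have "(\<Sum>i\<in>{..<n} - {a, b}. i * ?\<kappa> i) = (\<Sum>i\<in>{..<n} - {a, b}. i * \<eta> i)"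
    by (intro sum.cong) (auto simp: swp_def)
  moreover have "a * \<eta> a + b * \<eta> b < a * \<eta> b + b * \<eta> a"
  proof -
    obtain t where t: "b = a + t" "0 < t" using down by (metis less_imp_add_positive)
    have "t * \<eta> b < t * \<eta> a" using t down by simp
    thus ?thesis unfolding t by (simp add: algebra_simps)
  qed
  ultimately have lt: "(\<Sum>i<n. i * \<eta> i) < (\<Sum>i<n. i * ?\<kappa> i)"
    using sum_split2[of "{..<n}" a b "\<lambda>i. i * ?\<kappa> i"] sum_split2[of "{..<n}" a b "\<lambda>i. i * \<eta> i"] down
    by (simp add: swp_def)
  have "(\<Sum>i<n. i * ?\<kappa> i) \<le> (\<Sum>i<n. n * ?\<kappa> i)"
    by (intro sum_mono mult_le_mono1) auto
  also have "\<dots> = n * m" using hom by (simp add: hom_def weight_def flip: sum_distrib_left)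
  finally have "msr n m ?\<kappa> < msr n m \<eta>" using lt unfolding msr_def sq by linarith
  thus ?case using hom by blast
qed

lemma stps_hom_msr:
  assumes "(stp n)\<^sup>*\<^sup>* \<kappa> \<eta>" "\<eta> \<in> hom n m"
  shows "\<kappa> \<in> hom n m \<and> (\<kappa> = \<eta> \<or> msr n m \<kappa> < msr n m \<eta>)"
  using assms(1)
  by (induction rule: converse_rtranclp_induct) (use assms(2) stp_hom_msr in \<open>force+\<close>)

section \<open>The steps decrease the order of the definition\<close>

lemma plus_part_permutes:
  assumes "\<eta> \<in> multi n"
  obtains w where "w permutes {..<n}" "plus_part n \<eta> = \<eta> \<circ> w"
proof -
  have "mset (rev (sort (map \<eta> [0..<n]))) = mset (map \<eta> [0..<n])" by simp
  from mset_eq_permutation[OF this] obtain p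
    where p: "p permutes {..<n}" "permute_list p (map \<eta> [0..<n]) = rev (sort (map \<eta> [0..<n]))"
    by auto
  have "plus_part n \<eta> i = (\<eta> \<circ> p) i" for i
  proof (cases "i < n")
    case True
    have "p i < n" using p(1) True permutes_in_image by fastforce
    thus ?thesis
      using True p(1) by (simp add: plus_part_def p(2)[symmetric] permute_list_nth)
  next
    case False
    thus ?thesis using assms p(1) by (simp add: plus_part_def multi_def permutes_not_in)
  qed
  thus ?thesis using that[OF p(1)] by blast
qed

lemma plus_part_decreasing: "i \<le> j \<Longrightarrow> j < n \<Longrightarrow> plus_part n \<eta> j \<le> plus_part n \<eta> i"
  unfolding plus_part_def by (simp add: rev_nth sorted_nth_mono)

lemma plus_part_multi: "plus_part n \<eta> \<in> multi n"
  by (simp add: plus_part_def multi_def)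

lemma weight_plus_part: "\<eta> \<in> multi n \<Longrightarrow> weight n (plus_part n \<eta>) = weight n \<eta>"
  by (metis plus_part_permutes weight_permutes)

lemma plus_part_swp:
  assumes "a < n" "b < n"
  shows "plus_part n (\<eta> \<circ> swp a b) = plus_part n \<eta>"
proof -
  have "mset (map (\<eta> \<circ> swp a b) [0..<n]) = image_mset \<eta> (image_mset (swp a b) (mset_set {..<n}))"
    by (simp add: multiset.map_comp lessThan_atLeast0)
  also have "image_mset (swp a b) (mset_set {..<n}) = mset_set {..<n}"
    using swp_permutes[OF assms] by (rule permutes_image_mset)
  also have "image_mset \<eta> \<dots> = mset (map \<eta> [0..<n])" by (simp add: lessThan_atLeast0)
  finally have "sort (map (\<eta> \<circ> swp a b) [0..<n]) = sort (map \<eta> [0..<n])"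
    by (metis mset_sort properties_for_sort sorted_sort)
  thus ?thesis unfolding plus_part_def by metis
qed

section \<open>Squashing and the dominance order\<close>

lemma sum_le_initial_sum:
  fixes f :: "nat \<Rightarrow> nat"
  assumes "\<And>i j. i \<le> j \<Longrightarrow> j < n \<Longrightarrow> f j \<le> f i" "T \<subseteq> {..<n}"
  shows "sum f T \<le> (\<Sum>i<card T. f i)"
  using assms(2)
proof (induction "card T" arbitrary: T)
  case 0
  thus ?case using finite_subset[of T "{..<n}"] by simp
next
  case (Suc m)
  have fin: "finite T" using Suc(3) finite_subset by blast
  have ne: "T \<noteq> {}" using Suc(2) by auto
  define M where "M = Max T"
  have M: "M \<in> T" using fin ne by (simp add: M_def)
  have "T \<subseteq> {..M}" using fin by (auto simp: M_def)
  from card_mono[OF _ this] have "m \<le> M" using Suc(2) by simp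
  moreover have "M < n" using M Suc(3) by auto
  ultimately have "f M \<le> f m" using assms(1) by simp
  moreover have "sum f (T - {M}) \<le> (\<Sum>i<card (T - {M}). f i)"
    by (rule Suc(1)) (use Suc(2,3) M fin in auto)
  moreover have "card (T - {M}) = m" using Suc(2) M fin by simp
  moreover have "sum f T = f M + sum f (T - {M})" using fin M by (simp add: sum.remove)
  ultimately show ?case using Suc(2)[symmetric] by simp
qed

lemma sum_le_plus_part:
  assumes "\<eta> \<in> multi n" "S \<subseteq> {..<n}"
  shows "sum \<eta> S \<le> (\<Sum>i<card S. plus_part n \<eta> i)"
proof -
  obtain w where w: "w permutes {..<n}" "plus_part n \<eta> = \<eta> \<circ> w" using plus_part_permutes assms by blast
  have inj: "inj (inv w)" using w(1) permutes_inj permutes_inv by blast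
  have "sum \<eta> S = sum (plus_part n \<eta>) (inv w ` S)"
    using inj by (simp add: sum.reindex inj_on_subset w(2) permutes_inverses[OF w(1)] comp_def)
  also have "\<dots> \<le> (\<Sum>i<card (inv w ` S). plus_part n \<eta> i)"
  proof (rule sum_le_initial_sum)
    show "inv w ` S \<subseteq> {..<n}"
      using assms(2) permutes_in_image[OF permutes_inv[OF w(1)]] by blast
  qed (rule plus_part_decreasing)
  also have "card (inv w ` S) = card S" using inj by (simp add: card_image inj_on_subset)
  finally show ?thesis .
qed

text \<open>The \<open>r\<close> largest parts of \<open>\<kappa>\<close> occupy a set
  \<open>S\<close> of positions. The same positions in \<open>\<eta>\<close>, with \<open>b\<close>
  traded for \<open>a\<close> if only \<open>b\<close> was used, carry at least as much, and this is
  at most the sum of the \<open>r\<close> largest parts of \<open>\<eta>\<close>. Strictness is seen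
  on the sum of squares, a permutation invariant that the squash lowers.\<close>

lemma squash_dominance:
  assumes "a < n" "b < n" "a \<noteq> b" "\<And>i. i \<noteq> a \<Longrightarrow> i \<noteq> b \<Longrightarrow> \<kappa> i = \<eta> i"
    "\<kappa> a + \<kappa> b = \<eta> a + \<eta> b" "\<kappa> a < \<eta> a" "\<kappa> b < \<eta> a" "\<eta> \<in> hom n m"
  shows "dom_le n (plus_part n \<kappa>) (plus_part n \<eta>) \<and> plus_part n \<kappa> \<noteq> plus_part n \<eta>"
proof
  have \<kappa>: "\<kappa> \<in> hom n m" using stp_hom_msr[OF stp.squash[OF assms(1-7)]] assms(8) by blast
  obtain w where w: "w permutes {..<n}" "plus_part n \<kappa> = \<kappa> \<circ> w" using plus_part_permutes \<kappa> hom_multi by blast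
  obtain v where v: "v permutes {..<n}" "plus_part n \<eta> = \<eta> \<circ> v" using plus_part_permutes assms(8) hom_multi by blast
  have "(\<Sum>i<r. plus_part n \<kappa> i) \<le> (\<Sum>i<r. plus_part n \<eta> i)" if r: "r \<le> n" for r
  proof -
    define S where "S = w ` {..<r}"
    have inj: "inj_on w {..<r}" using permutes_inj[OF w(1)] inj_on_subset by blast
    have "w i < n" if "i < n" for i using permutes_in_image[OF w(1), of i] that by simp
    hence S: "S \<subseteq> {..<n}" using r by (auto simp: S_def)
    have S2: "finite S" "card S = r" using inj by (simp_all add: S_def card_image)
    define S' where "S' = (if b \<in> S \<and> a \<notin> S then insert a (S - {b}) else S)"
    have S': "S' \<subseteq> {..<n}" "card S' = r"
      using S S2 assms(1) card_Suc_Diff1[of S b] by (auto simp: S'_def)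
    have off: "sum \<kappa> T = sum \<eta> T" if "a \<notin> T" "b \<notin> T" for T
      using that by (intro sum.cong refl assms(4)) auto
    have "(\<Sum>i<r. plus_part n \<kappa> i) = sum \<kappa> S"
      using inj by (simp add: S_def sum.reindex w(2))
    also have "\<dots> \<le> sum \<eta> S'"
    proof -
      consider "a \<in> S" "b \<in> S" | "a \<in> S" "b \<notin> S" | "a \<notin> S" "b \<in> S" | "a \<notin> S" "b \<notin> S" by blast
      thus ?thesis
      proof cases
        case 1
        thus ?thesis using off[of "S - {a, b}"] S2 assms(3,5)
            sum_split2[of S a b \<kappa>] sum_split2[of S a b \<eta>] by (simp add: S'_def)
      next
        case 2
        thus ?thesis using off[of "S - {a}"] S2 assms(6) by (simp add: S'_def sum.remove[of S a])
      next
        case 3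
        hence "sum \<kappa> S = \<kappa> b + sum \<eta> (S - {b})" using off[of "S - {b}"] S2 by (simp add: sum.remove[of S b])
        also have "\<dots> \<le> sum \<eta> S'" using 3 S2 assms(7) by (simp add: S'_def)
        finally show ?thesis .
      next
        case 4
        thus ?thesis using off[of S] by (simp add: S'_def)
      qed
    qed
    also have "\<dots> \<le> (\<Sum>i<r. plus_part n \<eta> i)"
      using sum_le_plus_part[OF hom_multi[OF assms(8)] S'(1)] S'(2) by simp
    finally show ?thesis .
  qed
  moreover have "weight n (plus_part n \<kappa>) = weight n (plus_part n \<eta>)"
    using \<kappa> assms(8) by (simp add: weight_plus_part hom_def)
  ultimately show "dom_le n (plus_part n \<kappa>) (plus_part n \<eta>)" by (simp add: dom_le_def)
  have "(\<Sum>i<n. (plus_part n \<kappa> i)\<^sup>2) < (\<Sum>i<n. (plus_part n \<eta> i)\<^sup>2)"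
    unfolding w(2) v(2) sum_squares_permutes[OF w(1)] sum_squares_permutes[OF v(1)]
    by (rule squash_sum_squares[OF assms(1-7)])
  thus "plus_part n \<kappa> \<noteq> plus_part n \<eta>" by auto
qed

section \<open>Shortest sorting permutations and the Bruhat order\<close>

lemma perm_len_less:
  assumes u: "u permutes {..<n}" and "i < j" "j < n" "u i < u j"
  shows "perm_len n u < perm_len n (u \<circ> swp i j)"
proof -
  define I where "I v = {(x, y). x < y \<and> y < n \<and> v y < (v x :: nat)}" for v
  let ?t = "swp i j"
  let ?v = "u \<circ> ?t"
  have fin: "finite (I v)" for v
    by (rule finite_subset[of _ "{..<n} \<times> {..<n}"]) (auto simp: I_def)
  \<comment> \<open>An inversion of \<open>u\<close> becomes one of \<open>u \<circ> ?t\<close> by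
    renaming both positions if that keeps their order, and by staying put otherwise. The new
    inversion at \<open>i\<close>, \<open>j\<close> is never hit.\<close>
  define f where "f = (\<lambda>(x, y). if ?t x < ?t y then (?t x, ?t y) else (x, y))"
  have 1: "f ` I u \<subseteq> I ?v - {(i, j)}"
  proof (clarsimp simp: I_def f_def, intro conjI impI)
    fix x y assume xy: "x < y" "y < n" "u y < u x"
    show "?t y < n" if "?t x < ?t y" using that xy assms by simp
    show "?t x = i \<Longrightarrow> ?t y \<noteq> j" if "?t x < ?t y" using that xy assms by (auto simp: swp_def split: if_splits)
    show "u (?t y) < u (?t x)" if "\<not> ?t x < ?t y" using that xy assms by (auto simp: swp_def split: if_splits)
    show "x = i \<Longrightarrow> y \<noteq> j" using xy assms by auto
  qed
  have 2: "inj_on f (I u)"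
  proof (rule inj_onI)
    fix z z' assume "z \<in> I u" "z' \<in> I u" "f z = f z'"
    moreover obtain x y x' y' where "z = (x, y)" "z' = (x', y')" by (cases z; cases z')
    ultimately show "z = z'"
      by (auto simp: f_def I_def split: if_splits)
  qed
  have "card (I u) = card (f ` I u)" using 2 by (simp add: card_image)
  also have "\<dots> \<le> card (I ?v - {(i, j)})" using 1 fin by (intro card_mono) auto
  also have "\<dots> < card (I ?v)"
  proof (rule psubset_card_mono)
    have "(i, j) \<in> I ?v" using assms by (simp add: I_def swp_def)
    thus "I ?v - {(i, j)} \<subset> I ?v" by blast
  qed (rule fin)
  finally show ?thesis by (simp add: perm_len_def I_def)
qed

definition sorts :: "nat \<Rightarrow> (nat \<Rightarrow> nat) \<Rightarrow> (nat \<Rightarrow> nat) \<Rightarrow> bool" where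
  "sorts n \<eta> w \<longleftrightarrow> w permutes {..<n} \<and> plus_part n \<eta> = \<eta> \<circ> w"

text \<open>Increasing on blocks of equal parts: this singles out the shortest element among the
  permutations that sort \<open>\<eta>\<close>.\<close>

definition binc :: "nat \<Rightarrow> (nat \<Rightarrow> nat) \<Rightarrow> (nat \<Rightarrow> nat) \<Rightarrow> bool" where
  "binc n \<eta> w \<longleftrightarrow> (\<forall>i j. i < j \<longrightarrow> j < n \<longrightarrow> \<eta> (w i) = \<eta> (w j) \<longrightarrow> w i < w j)"

lemma sorts_iff: "sorts n \<eta> w \<longleftrightarrow> w permutes {..<n} \<and> act w (plus_part n \<eta>) = \<eta>"
proof -
  have "act w (plus_part n \<eta>) = \<eta> \<longleftrightarrow> plus_part n \<eta> = \<eta> \<circ> w" if w: "w permutes {..<n}"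
    unfolding act_def using permutes_inv_o[OF w] by (metis comp_assoc comp_id)
  thus ?thesis by (auto simp: sorts_def)
qed

text \<open>Both permutations produce the same sequence of parts. At the first disagreement, say
  \<open>w i < v i\<close>, the value \<open>w i\<close> is taken by \<open>v\<close> later on in
  the same block, against monotonicity.\<close>

lemma binc_unique:
  assumes "sorts n \<eta> w" "binc n \<eta> w" "sorts n \<eta> v" "binc n \<eta> v"
  shows "w = v"
proof (rule ccontr)
  assume "w \<noteq> v"
  hence ex: "\<exists>i. w i \<noteq> v i" by auto
  define i where "i = (LEAST i. w i \<noteq> v i)"
  have i: "w i \<noteq> v i" unfolding i_def using ex by (rule LeastI_ex)
  have below: "w j = v j" if "j < i" for j using that not_less_Least unfolding i_def by blast
  have n: "i < n" using i assms by (auto simp: sorts_def permutes_not_in intro: ccontr)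
  have *: False
    if "sorts n \<eta> w" "sorts n \<eta> v" "binc n \<eta> v" "w i < v i" "\<And>j. j < i \<Longrightarrow> w j = v j" for w v
  proof -
    have w: "w permutes {..<n}" "v permutes {..<n}" "\<eta> \<circ> w = \<eta> \<circ> v" using that by (auto simp: sorts_def)
    obtain j where j: "w i = v j" using permutes_surj[OF w(2)] by (metis surjD)
    have "w i < n" using permutes_in_image[OF w(1), of i] n by simp
    hence "j < n" using permutes_in_image[OF w(2), of j] j by simp
    have "j \<noteq> i" using j that by auto
    moreover have "\<not> j < i"
    proof
      assume ji: "j < i"
      hence "w j = w i" using that(5) j by simp
      thus False using permutes_inj[OF w(1)] ji by (auto dest: injD)
    qed
    ultimately have "i < j" by simp
    moreover have "\<eta> (v i) = \<eta> (v j)" using w(3) j by (metis comp_apply)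
    ultimately show False using \<open>j < n\<close> that(3,4) j by (fastforce simp: binc_def)
  qed
  show False
    using *[of w v] *[of v w] assms i below by (metis linorder_neqE_nat)
qed

text \<open>A sorting permutation of minimal length is increasing on blocks, because exchanging a
  bad pair would shorten it. By uniqueness the definite description in \<open>w_of\<close>
  denotes.\<close>

lemma w_of:
  assumes "\<eta> \<in> multi n"
  shows w_of_sorts: "sorts n \<eta> (w_of n \<eta>)" and w_of_binc: "binc n \<eta> (w_of n \<eta>)"
proof -
  define mn where "mn w \<longleftrightarrow> sorts n \<eta> w \<and> (\<forall>v. sorts n \<eta> v \<longrightarrow> perm_len n w \<le> perm_len n v)" for w
  have binc: "binc n \<eta> w" if "mn w" for w
    unfolding binc_def
  proof (intro allI impI, rule ccontr)
    fix i j assume ij: "i < j" "j < n" "\<eta> (w i) = \<eta> (w j)" "\<not> w i < w j"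
    let ?u = "w \<circ> swp i j"
    have w: "w permutes {..<n}" "plus_part n \<eta> = \<eta> \<circ> w" using that by (auto simp: mn_def sorts_def)
    have "w i \<noteq> w j" using permutes_inj[OF w(1)] ij by (auto dest: injD)
    have u: "?u permutes {..<n}" using ij by (intro permutes_compose swp_permutes w(1)) auto
    have "(\<eta> \<circ> ?u) x = (\<eta> \<circ> w) x" for x using ij by (auto simp: swp_def)
    hence "\<eta> \<circ> ?u = \<eta> \<circ> w" by blast
    hence "sorts n \<eta> ?u" using u w(2) by (simp add: sorts_def)
    hence "perm_len n w \<le> perm_len n ?u" using that by (auto simp: mn_def)
    moreover have "perm_len n ?u < perm_len n (?u \<circ> swp i j)"
      by (rule perm_len_less[OF u]) (use ij \<open>w i \<noteq> w j\<close> in \<open>auto simp: swp_def\<close>)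
    ultimately show False by simp
  qed
  obtain w0 where "sorts n \<eta> w0" using plus_part_permutes[OF assms] by (auto simp: sorts_def)
  then obtain w where w: "mn w" using ex_has_least_nat[of "sorts n \<eta>" w0 "perm_len n"] by (auto simp: mn_def)
  have "w_of n \<eta> = w"
    unfolding w_of_def
  proof (rule the_equality)
    show "w permutes {..<n} \<and> act w (plus_part n \<eta>) = \<eta> \<and>
      (\<forall>v. v permutes {..<n} \<and> act v (plus_part n \<eta>) = \<eta> \<longrightarrow> perm_len n w \<le> perm_len n v)"
      using w by (auto simp: mn_def sorts_iff)
  next
    fix v assume "v permutes {..<n} \<and> act v (plus_part n \<eta>) = \<eta> \<and>
      (\<forall>u. u permutes {..<n} \<and> act u (plus_part n \<eta>) = \<eta> \<longrightarrow> perm_len n v \<le> perm_len n u)"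
    hence "mn v" by (auto simp: mn_def sorts_iff)
    thus "v = w" using w binc binc_unique by (metis mn_def)
  qed
  thus "sorts n \<eta> (w_of n \<eta>)" "binc n \<eta> (w_of n \<eta>)" using w binc by (auto simp: mn_def)
qed

lemma w_of_eq:
  assumes "\<eta> \<in> multi n" "sorts n \<eta> w" "binc n \<eta> w"
  shows "w_of n \<eta> = w"
  using binc_unique w_of_sorts[OF assms(1)] w_of_binc[OF assms(1)] assms(2,3) by blast

lemma multi_swp: "a < n \<Longrightarrow> b < n \<Longrightarrow> \<eta> \<in> multi n \<Longrightarrow> \<eta> \<circ> swp a b \<in> multi n"
  by (simp add: multi_permutes swp_permutes)

text \<open>If an entry strictly between the two positions equals one of the exchanged entries, the
  exchange splits into two shorter ones. Otherwise \<open>swp a b \<circ> w_of n \<eta>\<close> is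
  still increasing on blocks, hence is the shortest sorting permutation of the result, one
  reflection away and longer.\<close>

lemma down_bruhat:
  assumes "\<eta> \<in> multi n" "a < b" "b < n" "\<eta> b < \<eta> a"
  shows "bruhat_less n (w_of n \<eta>) (w_of n (\<eta> \<circ> swp a b))"
  using assms
proof (induction "b - a" arbitrary: a b \<eta> rule: less_induct)
  case less
  show ?case
  proof (cases "\<exists>c. a < c \<and> c < b \<and> (\<eta> c = \<eta> a \<or> \<eta> c = \<eta> b)")
    case True
    then obtain c where c: "a < c" "c < b" and val: "\<eta> c = \<eta> a \<or> \<eta> c = \<eta> b" by blast
    from val show ?thesis
    proof
      assume v: "\<eta> c = \<eta> a"
      let ?\<theta> = "\<eta> \<circ> swp c b"
      have "bruhat_less n (w_of n \<eta>) (w_of n ?\<theta>)"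
        by (rule less(1)) (use less(2-) c v in auto)
      moreover have "bruhat_less n (w_of n ?\<theta>) (w_of n (?\<theta> \<circ> swp a c))"
        by (rule less(1)) (use less(2-) c v multi_swp in \<open>auto simp: swp_def[THEN fun_cong]\<close>)
      moreover have "?\<theta> \<circ> swp a c = \<eta> \<circ> swp a b"
        using c v by (auto simp: swp_def fun_eq_iff)
      ultimately show ?thesis unfolding bruhat_less_def by (metis trancl_trans)
    next
      assume v: "\<eta> c = \<eta> b"
      let ?\<theta> = "\<eta> \<circ> swp a c"
      have "bruhat_less n (w_of n \<eta>) (w_of n ?\<theta>)"
        by (rule less(1)) (use less(2-) c v in auto)
      moreover have "bruhat_less n (w_of n ?\<theta>) (w_of n (?\<theta> \<circ> swp c b))"
        by (rule less(1)) (use less(2-) c v multi_swp in \<open>auto simp: swp_def[THEN fun_cong]\<close>)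
      moreover have "?\<theta> \<circ> swp c b = \<eta> \<circ> swp a b"
        using c v by (auto simp: swp_def fun_eq_iff)
      ultimately show ?thesis unfolding bruhat_less_def by (metis trancl_trans)
    qed
  next
    case False
    let ?w = "w_of n \<eta>"
    let ?v = "swp a b \<circ> ?w"
    have ab: "a < n" "b < n" using less by auto
    have w: "?w permutes {..<n}" "plus_part n \<eta> = \<eta> \<circ> ?w"
      using w_of_sorts[OF less(2)] by (auto simp: sorts_def)
    have v: "?v permutes {..<n}" by (intro permutes_compose swp_permutes w(1) ab)
    have "plus_part n (\<eta> \<circ> swp a b) = \<eta> \<circ> swp a b \<circ> ?v"
      unfolding plus_part_swp[OF ab] w(2) by (auto simp: fun_eq_iff)
    hence "sorts n (\<eta> \<circ> swp a b) ?v" using v by (simp add: sorts_def)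
    moreover have "binc n (\<eta> \<circ> swp a b) ?v"
      unfolding binc_def
    proof (intro allI impI)
      fix i j assume ij: "i < j" "j < n" "(\<eta> \<circ> swp a b) (?v i) = (\<eta> \<circ> swp a b) (?v j)"
      hence eq: "\<eta> (?w i) = \<eta> (?w j)" by simp
      hence lt: "?w i < ?w j" using w_of_binc[OF less(2)] ij by (auto simp: binc_def)
      have "?w i \<noteq> a \<or> ?w j \<noteq> b" using eq less by auto
      moreover have "?w j > b" if "?w i = a"
        using that lt eq False less(5) by (metis linorder_neqE_nat less_irrefl)
      moreover have "?w i < a" if "?w j = b"
        using that lt eq False less(5) by (metis linorder_neqE_nat less_irrefl)
      ultimately show "?v i < ?v j" using lt less(3) by (auto simp: swp_def)
    qed
    ultimately have wof: "w_of n (\<eta> \<circ> swp a b) = ?v"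
      using w_of_eq multi_swp[OF ab less(2)] by blast
    obtain i where i: "?w i = a" using permutes_surj[OF w(1)] by (metis surjD)
    obtain j where j: "?w j = b" using permutes_surj[OF w(1)] by (metis surjD)
    have ijn: "i < n" "j < n"
      using permutes_in_image[OF w(1), of i] permutes_in_image[OF w(1), of j] i j ab by auto
    have "i < j"
    proof (rule ccontr)
      assume "\<not> i < j"
      hence "plus_part n \<eta> i \<le> plus_part n \<eta> j" using plus_part_decreasing ijn by simp
      thus False using less(5) i j by (simp add: w(2))
    qed
    \<comment> \<open>Multiplying by the transposition of the values \<open>a\<close>,
      \<open>b\<close> on the left is exchanging their positions \<open>i < j\<close> on the right,
      the form in which lengths are compared.\<close>
    have "?v x = (?w \<circ> swp i j) x" for x
      using i j permutes_inj[OF w(1)] by (auto simp: swp_def dest: injD)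
    hence "?v = ?w \<circ> swp i j" by blast
    moreover have "perm_len n ?w < perm_len n (?w \<circ> swp i j)"
      by (rule perm_len_less[OF w(1) \<open>i < j\<close> ijn(2)]) (use i j less in simp)
    ultimately have "perm_len n ?w < perm_len n ?v" by metis
    hence "(?w, ?v) \<in> bruhat_step n"
      unfolding bruhat_step_def using w(1) less(3,4) by blast
    thus ?thesis unfolding bruhat_less_def wof by blast
  qed
qed

lemma stp_prec:
  assumes "stp n \<kappa> \<eta>" "\<eta> \<in> hom n m"
  shows "prec n \<kappa> \<eta>"
  using assms
proof (induction rule: stp.induct)
  case (squash a b \<kappa> \<eta>)
  thus ?case using squash_dominance[of a n b \<kappa> \<eta> m] unfolding prec_def by blast
next
  case (down a b \<eta>)
  have "a < n" using down by simp
  hence "plus_part n (\<eta> \<circ> swp a b) = plus_part n \<eta>" using plus_part_swp down by blast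
  moreover have "bruhat_less n (w_of n \<eta>) (w_of n (\<eta> \<circ> swp a b))"
    by (rule down_bruhat) (use down hom_multi in auto)
  ultimately show ?case unfolding prec_def by blast
qed

lemma dom_le_trans: "dom_le n a b \<Longrightarrow> dom_le n b c \<Longrightarrow> dom_le n a c"
  unfolding dom_le_def by (metis le_trans)

lemma dom_le_antisym:
  assumes "dom_le n a b" "dom_le n b a" "a \<in> multi n" "b \<in> multi n"
  shows "a = b"
proof
  fix i
  show "a i = b i"
  proof (cases "i < n")
    case True
    have "(\<Sum>j<i. a j) = (\<Sum>j<i. b j)" "(\<Sum>j<Suc i. a j) = (\<Sum>j<Suc i. b j)"
      using assms(1,2) True unfolding dom_le_def by (meson Suc_leI le_antisym less_imp_le)+
    thus ?thesis by simp
  qed (use assms in \<open>auto simp: multi_def\<close>)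
qed

lemma prec_trans:
  assumes "prec n a b" "prec n b c"
  shows "prec n a c"
proof (cases "plus_part n a = plus_part n b \<and> plus_part n b = plus_part n c")
  case True
  hence "bruhat_less n (w_of n b) (w_of n a)" "bruhat_less n (w_of n c) (w_of n b)"
    using assms unfolding prec_def by auto
  hence "bruhat_less n (w_of n c) (w_of n a)"
    unfolding bruhat_less_def by (rule trancl_trans[rotated])
  thus ?thesis using True by (simp add: prec_def)
next
  case False
  have refl: "dom_le n \<theta> \<theta>" for \<theta> by (simp add: dom_le_def)
  have "dom_le n (plus_part n a) (plus_part n b)" "dom_le n (plus_part n b) (plus_part n c)"
    using assms refl unfolding prec_def by auto
  moreover from this have "plus_part n a \<noteq> plus_part n c"
    using False dom_le_antisym[OF _ _ plus_part_multi plus_part_multi] by metis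
  ultimately show ?thesis using dom_le_trans unfolding prec_def by blast
qed

lemma bruhat_less_perm_len: "bruhat_less n u v \<Longrightarrow> perm_len n u < perm_len n v"
  unfolding bruhat_less_def
proof (induction rule: trancl_induct)
  case (step v w)
  from step(2) have "perm_len n v < perm_len n w" by (auto simp: bruhat_step_def)
  with step(3) show ?case by simp
qed (auto simp: bruhat_step_def)

lemma prec_irrefl: "\<not> prec n a a"
  using bruhat_less_perm_len by (auto simp: prec_def)

lemma prec_weight: "prec n \<kappa> \<eta> \<Longrightarrow> \<kappa> \<in> multi n \<Longrightarrow> \<eta> \<in> multi n \<Longrightarrow> weight n \<kappa> = weight n \<eta>"
  unfolding prec_def dom_le_def by (metis weight_plus_part)

lemma stps_prec:
  assumes "(stp n)\<^sup>*\<^sup>* \<kappa> \<eta>" "\<eta> \<in> hom n m"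
  shows "\<kappa> = \<eta> \<or> prec n \<kappa> \<eta>"
  using assms(1)
proof (induction rule: converse_rtranclp_induct)
  case (step \<kappa>' \<kappa>)
  have "\<kappa> \<in> hom n m" using stps_hom_msr[OF step(2) assms(2)] by blast
  hence "prec n \<kappa>' \<kappa>" using stp_prec step(1) by blast
  thus ?case using step.IH prec_trans by blast
qed simp

section \<open>Homogeneous polynomials\<close>

abbreviation "mon \<equiv> Defs.mono"

text \<open>Polynomials are represented by coefficient functions whose values off
  \<open>hom n m\<close> are irrelevant; coefficients can therefore be compared only on
  \<open>hom n m\<close>.\<close>

definition pol :: "nat \<Rightarrow> nat \<Rightarrow> ((nat \<Rightarrow> nat) \<Rightarrow> complex) \<Rightarrow> (nat \<Rightarrow> complex) \<Rightarrow> complex" where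
  "pol n m a x = (\<Sum>\<kappa>\<in>hom n m. a \<kappa> * mon n \<kappa> x)"

lemma mon_swp:
  assumes "a < n" "b < n"
  shows "mon n \<kappa> (x \<circ> swp a b) = mon n (\<kappa> \<circ> swp a b) x"
  using prod.permute[OF swp_permutes[OF assms], of "\<lambda>i. x i ^ \<kappa> (swp a b i)"]
  by (simp add: Defs.mono_def comp_def)

lemma pol_swp:
  assumes "a < n" "b < n"
  shows "pol n m c (x \<circ> swp a b) = pol n m (\<lambda>\<kappa>. c (\<kappa> \<circ> swp a b)) x"
  using sum_hom_swp[OF assms, of "\<lambda>\<kappa>. c (\<kappa> \<circ> swp a b) * mon n \<kappa> x" m]
  by (simp add: pol_def mon_swp[OF assms])

lemma mon_raise: "0 < n \<Longrightarrow> mon n (raise n \<kappa>) x = x (n - 1) * mon n \<kappa> (x \<circ> cyc n)"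
proof -
  assume "0 < n"
  then obtain N where n: "n = Suc N" by (cases n) auto
  have "(\<Prod>i<N. x i ^ raise (Suc N) \<kappa> i) = (\<Prod>i<N. x i ^ \<kappa> (Suc i))"
    by (intro prod.cong) (auto simp: raise_def)
  moreover have "(\<Prod>i<N. x (cyc (Suc N) (Suc i)) ^ \<kappa> (Suc i)) = (\<Prod>i<N. x i ^ \<kappa> (Suc i))"
    by (intro prod.cong) (auto simp: cyc_def)
  moreover have "raise (Suc N) \<kappa> N = Suc (\<kappa> 0)" "cyc (Suc N) 0 = N"
    by (auto simp: raise_def cyc_def)
  ultimately show ?thesis
    unfolding n Defs.mono_def prod.lessThan_Suc[of "\<lambda>i. x i ^ raise (Suc N) \<kappa> i"]
      prod.lessThan_Suc_shift[of "\<lambda>i. (x \<circ> cyc (Suc N)) i ^ \<kappa> i"] by simp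
qed

lemma pol_raise:
  assumes "0 < n"
  shows "x (n - 1) * pol n m c (x \<circ> cyc n) =
    pol n (Suc m) (\<lambda>\<eta>. if \<eta> (n - 1) = 0 then 0 else c (lower n \<eta>)) x"
proof -
  let ?c = "\<lambda>\<eta>. if \<eta> (n - 1) = 0 then 0 else c (lower n \<eta>)"
  have "pol n (Suc m) ?c x = (\<Sum>\<kappa>\<in>hom n m. ?c (raise n \<kappa>) * mon n (raise n \<kappa>) x)"
    unfolding pol_def by (rule sum_hom_raise[OF assms]) simp
  also have "\<dots> = (\<Sum>\<kappa>\<in>hom n m. c \<kappa> * (x (n - 1) * mon n \<kappa> (x \<circ> cyc n)))"
  proof (rule sum.cong[OF refl])
    fix \<kappa> assume "\<kappa> \<in> hom n m"
    hence "lower n (raise n \<kappa>) = \<kappa>" using lower_raise assms hom_multi by blast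
    moreover have "raise n \<kappa> (n - 1) \<noteq> 0" using assms by (simp add: raise_def)
    ultimately show "?c (raise n \<kappa>) * mon n (raise n \<kappa>) x = c \<kappa> * (x (n - 1) * mon n \<kappa> (x \<circ> cyc n))"
      using mon_raise[OF assms] by simp
  qed
  finally show ?thesis by (simp add: pol_def sum_distrib_left mult_ac)
qed

lemma pol_add: "pol n m a x + pol n m b x = pol n m (\<lambda>\<kappa>. a \<kappa> + b \<kappa>) x"
  by (simp add: pol_def sum.distrib algebra_simps)

lemma pol_cmult: "c * pol n m a x = pol n m (\<lambda>\<kappa>. c * a \<kappa>) x"
  by (simp add: pol_def sum_distrib_left mult_ac)

lemma pol_diff: "pol n m a x - pol n m b x = pol n m (\<lambda>\<kappa>. a \<kappa> - b \<kappa>) x"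
  by (simp add: pol_def sum_subtractf algebra_simps)

lemma pol_sum: "(\<Sum>i\<in>I. c i * pol n m (a i) x) = pol n m (\<lambda>\<kappa>. \<Sum>i\<in>I. c i * a i \<kappa>) x"
proof -
  have "(\<Sum>i\<in>I. c i * pol n m (a i) x) = (\<Sum>i\<in>I. \<Sum>\<kappa>\<in>hom n m. c i * a i \<kappa> * mon n \<kappa> x)"
    by (simp add: pol_def sum_distrib_left mult_ac)
  also have "\<dots> = (\<Sum>\<kappa>\<in>hom n m. \<Sum>i\<in>I. c i * a i \<kappa> * mon n \<kappa> x)" by (rule sum.swap)
  finally show ?thesis by (simp add: pol_def sum_distrib_right)
qed

lemma mon_upd: "j < n \<Longrightarrow> x j * mon n \<kappa> x = mon n (\<kappa>(j := Suc (\<kappa> j))) x"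
proof -
  assume j: "j < n"
  have "(\<Prod>i\<in>{..<n} - {j}. x i ^ (\<kappa>(j := Suc (\<kappa> j))) i) = (\<Prod>i\<in>{..<n} - {j}. x i ^ \<kappa> i)"
    by (intro prod.cong) auto
  thus ?thesis using j by (simp add: Defs.mono_def prod.remove[of "{..<n}" j])
qed

lemma hom_upd: "j < n \<Longrightarrow> \<kappa> \<in> hom n m \<Longrightarrow> \<kappa>(j := Suc (\<kappa> j)) \<in> hom n (Suc m)"
proof -
  assume j: "j < n" "\<kappa> \<in> hom n m"
  have "(\<Sum>i\<in>{..<n} - {j}. (\<kappa>(j := Suc (\<kappa> j))) i) = (\<Sum>i\<in>{..<n} - {j}. \<kappa> i)"
    by (intro sum.cong) auto
  thus ?thesis using j by (auto simp: hom_def multi_def weight_def sum.remove[of "{..<n}" j])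
qed

lemma mon_eq_pol: "\<kappa> \<in> hom n m \<Longrightarrow> mon n \<kappa> x = pol n m (\<lambda>\<eta>. if \<eta> = \<kappa> then 1 else 0) x"
  by (simp add: pol_def if_distrib[of "\<lambda>c. c * _"] cong: if_cong)

lemma power_sum_pol: "\<exists>a. \<forall>x. (\<Sum>i<n. x i) ^ m = pol n m a x"
proof (induction m)
  case 0
  have "(\<Sum>i<n. x i) ^ 0 = pol n 0 (\<lambda>_. 1) x" for x by (simp add: pol_def Defs.mono_def)
  thus ?case by blast
next
  case (Suc m)
  then obtain a where a: "\<And>x. (\<Sum>i<n. x i) ^ m = pol n m a x" by blast
  let ?u = "\<lambda>j \<kappa>. \<kappa>(j := Suc (\<kappa> j)) :: nat \<Rightarrow> nat"
  let ?b = "\<lambda>\<eta>. \<Sum>(j, \<kappa>)\<in>{..<n} \<times> hom n m. a \<kappa> * (if \<eta> = ?u j \<kappa> then 1 else 0)"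
  have "(\<Sum>i<n. x i) ^ Suc m = pol n (Suc m) ?b x" for x
  proof -
    have "(\<Sum>i<n. x i) ^ Suc m = (\<Sum>j<n. x j * pol n m a x)"
      by (simp add: sum_distrib_right[symmetric] a)
    also have "\<dots> = (\<Sum>j<n. \<Sum>\<kappa>\<in>hom n m. a \<kappa> * (x j * mon n \<kappa> x))"
      by (simp add: pol_def sum_distrib_left mult_ac)
    also have "\<dots> = (\<Sum>(j, \<kappa>)\<in>{..<n} \<times> hom n m. a \<kappa> * (x j * mon n \<kappa> x))"
      by (simp add: sum.cartesian_product)
    also have "\<dots> = (\<Sum>(j, \<kappa>)\<in>{..<n} \<times> hom n m. a \<kappa> * pol n (Suc m) (\<lambda>\<eta>. if \<eta> = ?u j \<kappa> then 1 else 0) x)"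
      by (intro sum.cong refl) (auto simp: mon_upd mon_eq_pol[OF hom_upd])
    also have "\<dots> = pol n (Suc m) ?b x"
      using pol_sum[of "\<lambda>z. a (snd z)" n "Suc m" "\<lambda>z \<eta>. if \<eta> = ?u (fst z) (snd z) then 1 else 0" x
          "{..<n} \<times> hom n m"]
      by (simp add: case_prod_unfold)
    finally show ?thesis .
  qed
  thus ?case by blast
qed

text \<open>Uniqueness of base \<open>B\<close> expansions: reduce modulo \<open>B\<close>, then
  divide by \<open>B\<close>.\<close>

lemma digits_inject:
  fixes \<kappa> \<eta> :: "nat \<Rightarrow> nat"
  assumes "(\<Sum>i<n. \<kappa> i * B ^ i) = (\<Sum>i<n. \<eta> i * B ^ i)" "\<And>i. \<kappa> i < B" "\<And>i. \<eta> i < B" "i < n"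
  shows "\<kappa> i = \<eta> i"
  using assms
proof (induction n arbitrary: \<kappa> \<eta> i)
  case (Suc n)
  have eq: "(\<Sum>i<Suc n. \<theta> i * B ^ i) = \<theta> 0 + B * (\<Sum>i<n. \<theta> (Suc i) * B ^ i)" for \<theta> :: "nat \<Rightarrow> nat"
    unfolding sum.lessThan_Suc_shift by (simp add: sum_distrib_left mult_ac)
  from Suc.prems(1) have e: "\<kappa> 0 + B * (\<Sum>i<n. \<kappa> (Suc i) * B ^ i) = \<eta> 0 + B * (\<Sum>i<n. \<eta> (Suc i) * B ^ i)"
    unfolding eq .
  have B: "0 < B" using Suc.prems(2)[of 0] by simp
  have "(\<kappa> 0 + B * (\<Sum>i<n. \<kappa> (Suc i) * B ^ i)) mod B = \<kappa> 0"
    "(\<eta> 0 + B * (\<Sum>i<n. \<eta> (Suc i) * B ^ i)) mod B = \<eta> 0"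
    using Suc.prems by simp_all
  hence 0: "\<kappa> 0 = \<eta> 0" using e by simp
  hence "(\<Sum>i<n. \<kappa> (Suc i) * B ^ i) = (\<Sum>i<n. \<eta> (Suc i) * B ^ i)" using e B by simp
  hence "\<kappa> (Suc i) = \<eta> (Suc i)" if "i < n" for i
    using Suc.IH[of "\<lambda>i. \<kappa> (Suc i)" "\<lambda>i. \<eta> (Suc i)"] that Suc.prems by blast
  thus ?case using 0 Suc.prems(4) by (cases i) auto
qed simp

text \<open>Kronecker substitution \<open>x\<^sub>i = t ^ (B ^ i)\<close> reduces to polynomials in one variable.\<close>

lemma pol_indep:
  assumes "\<And>x. x \<in> generic n \<Longrightarrow> pol n m a x = 0" "\<kappa> \<in> hom n m"
  shows "a \<kappa> = 0"
proof -
  \<comment> \<open>\<open>B\<close> exceeds all exponents in degree \<open>m\<close>, so different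
    monomials become different powers of t; being at least 2, it also makes the substituted
    coordinates distinct, that is, the points generic.\<close>
  define B where "B = m + 2"
  define e where "e \<eta> = (\<Sum>i<n. \<eta> i * B ^ i)" for \<eta> :: "nat \<Rightarrow> nat"
  have lt: "\<eta> i < B" if "\<eta> \<in> hom n m" for \<eta> i using hom_le[OF that, of i] by (simp add: B_def)
  have inj: "inj_on e (hom n m)"
  proof (rule inj_onI)
    fix \<eta> \<theta> assume h: "\<eta> \<in> hom n m" "\<theta> \<in> hom n m" "e \<eta> = e \<theta>"
    hence "\<eta> i = \<theta> i" if "i < n" for i
      using digits_inject[of \<eta> B n \<theta> i] lt that by (simp add: e_def)
    moreover have "\<eta> i = \<theta> i" if "i \<ge> n" for i using that h by (auto simp: hom_def multi_def)
    ultimately show "\<eta> = \<theta>" by (meson ext linorder_not_le)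
  qed
  define P where "P = (\<Sum>\<eta>\<in>hom n m. Polynomial.monom (a \<eta>) (e \<eta>))"
  have "poly P (of_nat (t + 2)) = 0" for t :: nat
  proof -
    define x :: "nat \<Rightarrow> complex" where "x i = (if i < n then of_nat (t + 2) ^ (B ^ i) else 0)" for i
    have "x i \<noteq> x j" if "i < n" "j < n" "i \<noteq> j" for i j
    proof -
      have "(t + 2) ^ (B ^ i) \<noteq> (t + 2) ^ (B ^ j)"
        using that by (simp add: power_inject_exp B_def)
      hence "(of_nat ((t + 2) ^ (B ^ i)) :: complex) \<noteq> of_nat ((t + 2) ^ (B ^ j))"
        by (metis of_nat_eq_iff)
      thus ?thesis using that by (simp add: x_def)
    qed
    hence "x \<in> generic n" by (simp add: generic_def cvec_def x_def)
    hence "pol n m a x = 0" by (rule assms(1))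
    moreover have "mon n \<eta> x = of_nat (t + 2) ^ e \<eta>" for \<eta>
    proof -
      have "mon n \<eta> x = (\<Prod>i<n. of_nat (t + 2) ^ (\<eta> i * B ^ i))"
        unfolding Defs.mono_def by (intro prod.cong) (auto simp: x_def mult.commute simp flip: power_mult)
      thus ?thesis by (simp add: e_def power_sum)
    qed
    ultimately show ?thesis by (simp add: P_def poly_sum poly_monom pol_def)
  qed
  hence "range (\<lambda>t::nat. of_nat (t + 2)) \<subseteq> {z. poly P z = 0}" by auto
  moreover have "infinite (range (\<lambda>t::nat. of_nat (t + 2) :: complex))"
    by (rule range_inj_infinite) (auto simp: inj_on_def simp del: of_nat_add)
  ultimately have "P = 0" using poly_roots_finite finite_subset by blast
  hence "0 = coeff P (e \<kappa>)" by simp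
  also have "\<dots> = (\<Sum>\<eta>\<in>hom n m. if \<eta> = \<kappa> then a \<eta> else 0)"
    unfolding P_def coeff_sum using inj assms(2) by (intro sum.cong) (auto simp: inj_on_eq_iff)
  also have "\<dots> = a \<kappa>" using assms(2) by simp
  finally show ?thesis by simp
qed

section \<open>Separate holomorphy of polynomials\<close>

definition sephol :: "((nat \<Rightarrow> complex) \<Rightarrow> complex) \<Rightarrow> bool" where
  "sephol f \<longleftrightarrow> (\<forall>x j. (\<lambda>t. f (x(j := t))) holomorphic_on UNIV)"

lemma sephol_coord: "sephol (\<lambda>x. x i)"
proof -
  have "(\<lambda>t. if i = j then t else x i) holomorphic_on UNIV" for x j
    by (cases "i = j") (auto intro!: holomorphic_intros)
  thus ?thesis by (simp add: sephol_def fun_upd_def)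
qed

lemma sephol_const: "sephol (\<lambda>x. c)"
  by (simp add: sephol_def)

lemma sephol_add: "sephol f \<Longrightarrow> sephol g \<Longrightarrow> sephol (\<lambda>x. f x + g x)"
  unfolding sephol_def by (auto intro!: holomorphic_intros)

lemma sephol_mult: "sephol f \<Longrightarrow> sephol g \<Longrightarrow> sephol (\<lambda>x. f x * g x)"
  unfolding sephol_def by (auto intro!: holomorphic_intros)

lemma sephol_power: "sephol f \<Longrightarrow> sephol (\<lambda>x. f x ^ m)"
  unfolding sephol_def by (auto intro!: holomorphic_intros)

lemma sephol_sum: "(\<And>i. i \<in> I \<Longrightarrow> sephol (f i)) \<Longrightarrow> sephol (\<lambda>x. \<Sum>i\<in>I. f i x)"
  unfolding sephol_def by (auto intro!: holomorphic_intros)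

lemma sephol_prod: "(\<And>i. i \<in> I \<Longrightarrow> sephol (f i)) \<Longrightarrow> sephol (\<lambda>x. \<Prod>i\<in>I. f i x)"
  unfolding sephol_def by (auto intro!: holomorphic_intros)

lemma sephol_pol: "sephol (pol n m a)"
  unfolding pol_def[abs_def] Defs.mono_def
  by (intro sephol_sum sephol_mult sephol_const sephol_prod sephol_power sephol_coord)

lemma sephol_pol_swp: "a < n \<Longrightarrow> b < n \<Longrightarrow> sephol (\<lambda>x. pol n m c (x \<circ> swp a b))"
  by (simp add: pol_swp sephol_pol)

section \<open>Cherednik operators\<close>

definition pd :: "nat \<Rightarrow> ((nat \<Rightarrow> complex) \<Rightarrow> complex) \<Rightarrow> (nat \<Rightarrow> complex) \<Rightarrow> complex" where
  "pd j f x = deriv (\<lambda>t. f (x(j := t))) (x j)"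

text \<open>The summand at \<open>l = j\<close> is 0 / 0 = 0. Keeping it gives a full index range,
  on which transpositions act by reindexing.\<close>

definition dq :: "nat \<Rightarrow> nat \<Rightarrow> ((nat \<Rightarrow> complex) \<Rightarrow> complex) \<Rightarrow> (nat \<Rightarrow> complex) \<Rightarrow> complex" where
  "dq n j f x = (\<Sum>l<n. (f x - f (x \<circ> swp j l)) / (x j - x l))"

text \<open>In direction e_j only pairs containing \<open>j\<close> survive. The quotient together
  with its sign is symmetric in the two indices, so the pairs below and above \<open>j\<close> merge
  into a single sum.\<close>

lemma cherD_eq:
  assumes j: "j < n"
  shows "cherD n k j f x = x j * (pd j f x + of_real k * dq n j f x) + of_real (k * (1 - real n)) * f x
      + of_real k * (\<Sum>i\<in>{j<..<n}. f (x \<circ> swp i j))"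
proof -
  define g where "g i l = (f x - f (x \<circ> swp i l)) / (x i - x l)" for i l
  have g: "g i l = - g l i" for i l
  proof -
    have "x l - x i = - (x i - x l)" by simp
    thus ?thesis unfolding g_def swp_commute[of l i] by (metis divide_minus_right minus_minus)
  qed
  have "(\<lambda>i. x i + t * unit_vec j i) = x(j := x j + t)" for t
    by (auto simp: unit_vec_def)
  hence d: "deriv (\<lambda>t. f (\<lambda>i. x i + t * unit_vec j i)) 0 = pd j f x"
    unfolding pd_def deriv_shift_0[of _ "x j"] by (simp add: comp_def)
  have "(\<Sum>i<n. \<Sum>l<n. if i < l then (unit_vec j i - unit_vec j l) * (f x - f (x \<circ> swp i l)) / (x i - x l) else 0)
      = (\<Sum>i<n. \<Sum>l<n. (if i = j then (if j < l then g j l else 0) else 0) +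
            (if l = j then (if i < j then g j i else 0) else 0))"
  proof (intro sum.cong refl)
    fix i l
    show "(if i < l then (unit_vec j i - unit_vec j l) * (f x - f (x \<circ> swp i l)) / (x i - x l) else 0) =
      (if i = j then (if j < l then g j l else 0) else 0) + (if l = j then (if i < j then g j i else 0) else 0)"
      using g[of j i]
      by (cases "i < l") (auto simp: unit_vec_def g_def, metis minus_diff_eq minus_divide_left)
  qed
  also have "\<dots> = (\<Sum>i<n. \<Sum>l<n. if i = j then (if j < l then g j l else 0) else 0) +
      (\<Sum>i<n. \<Sum>l<n. if l = j then (if i < j then g j i else 0) else 0)"
    by (simp add: sum.distrib)
  also have "(\<Sum>i<n. \<Sum>l<n. if i = j then (if j < l then g j l else 0) else 0) = (\<Sum>l<n. if j < l then g j l else 0)"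
    by (subst sum.swap) (simp add: j)
  also have "(\<Sum>i<n. \<Sum>l<n. if l = j then (if i < j then g j i else 0) else 0) = (\<Sum>l<n. if l < j then g j l else 0)"
    by (simp add: j)
  also have "(\<Sum>l<n. if j < l then g j l else 0) + (\<Sum>l<n. if l < j then g j l else 0) = (\<Sum>l<n. g j l)"
    unfolding sum.distrib[symmetric]
  proof (intro sum.cong refl)
    fix l
    have "g j j = 0" by (simp add: g_def)
    thus "(if j < l then g j l else 0) + (if l < j then g j l else 0) = g j l"
      by (cases l j rule: linorder_cases) auto
  qed
  finally show ?thesis
    unfolding cherD_def dunkl_def d by (simp add: dq_def g_def)
qed

lemma sephol_deriv: "sephol f \<Longrightarrow> ((\<lambda>t. f (x(j := t))) has_field_derivative pd j f x) (at (x j))"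
  unfolding sephol_def pd_def
  by (metis UNIV_I holomorphic_derivI open_UNIV)

lemma pd_add: "sephol f \<Longrightarrow> sephol g \<Longrightarrow> pd j (\<lambda>x. f x + g x) x = pd j f x + pd j g x"
  unfolding pd_def[of j "\<lambda>x. f x + g x"]
  by (intro DERIV_imp_deriv DERIV_add sephol_deriv)

lemma pd_cmult: "sephol f \<Longrightarrow> pd j (\<lambda>x. c * f x) x = c * pd j f x"
  unfolding pd_def[of j "\<lambda>x. c * f x"]
  by (intro DERIV_imp_deriv DERIV_cmult sephol_deriv)

lemma cherD_add:
  assumes "j < n" "sephol f" "sephol g"
  shows "cherD n k j (\<lambda>x. f x + g x) x = cherD n k j f x + cherD n k j g x"
proof -
  have "dq n j (\<lambda>x. f x + g x) x = dq n j f x + dq n j g x"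
    unfolding dq_def sum.distrib[symmetric] by (intro sum.cong refl) (simp add: add_divide_distrib[symmetric])
  thus ?thesis using assms by (simp add: cherD_eq pd_add sum.distrib algebra_simps)
qed

lemma cherD_cmult:
  assumes "j < n" "sephol f"
  shows "cherD n k j (\<lambda>x. c * f x) x = c * cherD n k j f x"
proof -
  have "dq n j (\<lambda>x. c * f x) x = c * dq n j f x"
    unfolding dq_def sum_distrib_left by (intro sum.cong refl) (simp add: right_diff_distrib[symmetric])
  thus ?thesis using assms by (simp add: cherD_eq pd_cmult sum_distrib_left algebra_simps)
qed

lemma cherD_sum:
  assumes "j < n" "finite I" "\<And>i. i \<in> I \<Longrightarrow> sephol (f i)"
  shows "cherD n k j (\<lambda>x. \<Sum>i\<in>I. c i * f i x) x = (\<Sum>i\<in>I. c i * cherD n k j (f i) x)"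
  using assms(2,3)
proof (induction I rule: finite_induct)
  case empty
  have "cherD n k j (\<lambda>x. 0 * (0::complex)) x = 0 * cherD n k j (\<lambda>x. 0) x"
    by (rule cherD_cmult[OF assms(1) sephol_const])
  thus ?case by simp
next
  case (insert i I)
  have "cherD n k j (\<lambda>x. c i * f i x + (\<Sum>i\<in>I. c i * f i x)) x =
      cherD n k j (\<lambda>x. c i * f i x) x + cherD n k j (\<lambda>x. \<Sum>i\<in>I. c i * f i x) x"
    using insert by (intro cherD_add assms(1) sephol_mult sephol_const sephol_sum) auto
  thus ?case using insert by (simp add: cherD_cmult assms(1))
qed

section \<open>Commutation with transpositions\<close>

lemma upd_comp_swp: "(x(j := t)) \<circ> swp a b = (x \<circ> swp a b)(swp a b j := t)"
  by (auto simp: fun_eq_iff swp_def)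

lemma comp_swp_conj: "x \<circ> swp c d \<circ> swp a b = x \<circ> swp a b \<circ> swp (swp a b c) (swp a b d)"
  by (auto simp: fun_eq_iff swp_conj[of a b "swp a b c"])

lemma pd_swp: "pd j (\<lambda>x. f (x \<circ> swp a b)) x = pd (swp a b j) f (x \<circ> swp a b)"
  by (simp add: pd_def upd_comp_swp)

lemma dq_swp:
  assumes "a < n" "b < n"
  shows "dq n j (\<lambda>x. f (x \<circ> swp a b)) x = dq n (swp a b j) f (x \<circ> swp a b)"
proof -
  have "dq n (swp a b j) f (x \<circ> swp a b) = (\<Sum>l<n. (f (x \<circ> swp a b) - f (x \<circ> swp a b \<circ> swp (swp a b j) (swp a b l))) /
     (x j - x l))"
    unfolding dq_def using sum.permute[OF swp_permutes[OF assms], of "\<lambda>l. (f (x \<circ> swp a b) -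
      f (x \<circ> swp a b \<circ> swp (swp a b j) l)) / (x j - x (swp a b l))"]
    by (simp add: comp_def)
  thus ?thesis unfolding dq_def comp_swp_conj[of x _ _ a b] by simp
qed

text \<open>Derivative and difference quotients are equivariant. Only the sum over
  \<open>i > j\<close> depends on the order of the coordinates, so the whole commutator comes from
  it.\<close>

lemma cherD_swp:
  assumes "a < n" "b < n" "j < n"
  shows "cherD n k j (\<lambda>x. f (x \<circ> swp a b)) x = cherD n k (swp a b j) f (x \<circ> swp a b)
    + of_real k * ((\<Sum>i\<in>{j<..<n}. f (x \<circ> swp a b \<circ> swp (swp a b i) (swp a b j))) -
        (\<Sum>i\<in>{swp a b j<..<n}. f (x \<circ> swp a b \<circ> swp i (swp a b j))))"
  using assms
  by (simp add: cherD_eq pd_swp dq_swp comp_swp_conj[of x _ _ a b] algebra_simps)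

lemma cherD_swp_other:
  assumes "Suc i < n" "j < n" "j \<noteq> i" "j \<noteq> Suc i"
  shows "cherD n k j (\<lambda>x. f (x \<circ> swp i (Suc i))) x = cherD n k j f (x \<circ> swp i (Suc i))"
proof -
  let ?s = "swp i (Suc i)"
  have sj: "?s j = j" using assms by (simp add: swp_def)
  have "(\<Sum>l\<in>{j<..<n}. f (x \<circ> ?s \<circ> swp (?s l) j)) = (\<Sum>l\<in>{j<..<n}. f (x \<circ> ?s \<circ> swp l j))"
    by (rule sum.reindex_bij_witness[where i = ?s and j = ?s])
       (use assms in \<open>auto simp: swp_def split: if_splits\<close>)
  thus ?thesis using cherD_swp[of i n "Suc i" j k f x] assms sj by simp
qed

text \<open>The relation D_i s_i = s_i D_{i+1} + k of the degenerate affine Hecke algebra. The sum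
  for \<open>i\<close> has one transposition more than the sum for \<open>Suc i\<close>, and that
  one undoes s_i.\<close>

lemma cherD_swp_this:
  assumes "Suc i < n"
  shows "cherD n k i (\<lambda>x. f (x \<circ> swp i (Suc i))) x = cherD n k (Suc i) f (x \<circ> swp i (Suc i)) + of_real k * f x"
proof -
  let ?s = "swp i (Suc i)"
  have s: "?s i = Suc i" "?s (Suc i) = i" by (simp_all add: swp_def)
  have "{i<..<n} = insert (Suc i) {Suc i<..<n}" using assms by auto
  hence "(\<Sum>l\<in>{i<..<n}. f (x \<circ> ?s \<circ> swp (?s l) (Suc i))) =
      f (x \<circ> ?s \<circ> ?s) + (\<Sum>l\<in>{Suc i<..<n}. f (x \<circ> ?s \<circ> swp (?s l) (Suc i)))"
    using s by simp
  also have "(\<Sum>l\<in>{Suc i<..<n}. f (x \<circ> ?s \<circ> swp (?s l) (Suc i))) = (\<Sum>l\<in>{Suc i<..<n}. f (x \<circ> ?s \<circ> swp l (Suc i)))"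
    by (intro sum.cong refl) (auto simp: swp_def[of i "Suc i", THEN fun_cong])
  finally have S: "(\<Sum>l\<in>{i<..<n}. f (x \<circ> ?s \<circ> swp (?s l) (Suc i))) =
      f x + (\<Sum>l\<in>{Suc i<..<n}. f (x \<circ> ?s \<circ> swp l (Suc i)))" unfolding comp_swp_swp .
  have "i < n" using assms by simp
  from cherD_swp[OF this assms this, of k f x] show ?thesis unfolding s S by simp
qed

lemma cherD_swp_next:
  assumes "Suc i < n"
  shows "cherD n k (Suc i) (\<lambda>x. f (x \<circ> swp i (Suc i))) x = cherD n k i f (x \<circ> swp i (Suc i)) - of_real k * f x"
  using cherD_swp_this[OF assms, of k "\<lambda>x. f (x \<circ> swp i (Suc i))" "x \<circ> swp i (Suc i)"] by simp

section \<open>Commutation with the raising operator\<close>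

lemma upd_comp_cyc: "Suc j < n \<Longrightarrow> (x(j := t)) \<circ> cyc n = (x \<circ> cyc n)(Suc j := t)"
  by (auto simp: fun_eq_iff cyc_def)

lemma upd_comp_cyc_last: "0 < n \<Longrightarrow> (x(n - 1 := t)) \<circ> cyc n = (x \<circ> cyc n)(0 := t)"
  by (auto simp: fun_eq_iff cyc_def)

lemma swp_comp_cyc: "j < N \<Longrightarrow> l < N \<Longrightarrow> x \<circ> swp j l \<circ> cyc (Suc N) = x \<circ> cyc (Suc N) \<circ> swp (Suc j) (Suc l)"
  by (auto simp: fun_eq_iff cyc_def swp_def)

lemma swp_comp_cyc_last: "j < N \<Longrightarrow> x \<circ> swp j N \<circ> cyc (Suc N) = x \<circ> cyc (Suc N) \<circ> swp (Suc j) 0"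
  by (auto simp: fun_eq_iff cyc_def swp_def)

text \<open>The difference quotient with the last coordinate also acts on the prefactor and leaves
  the correction \<open>- f (y \<circ> swp (Suc j) 0)\<close>. Multiplied by k x_j it cancels the
  extra transposition in the sum for \<open>j\<close>. Distinct coordinates are needed to split this
  quotient.\<close>

lemma cherD_raise:
  assumes "sephol f" "x \<in> generic n" "Suc j < n"
  shows "cherD n k j (\<lambda>x. x (n - 1) * f (x \<circ> cyc n)) x = x (n - 1) * cherD n k (Suc j) f (x \<circ> cyc n)"
proof -
  obtain N where n: "n = Suc N" using assms(3) by (cases n) auto
  have j: "j < N" using assms(3) n by simp
  define h where "h = (\<lambda>x. x N * f (x \<circ> cyc (Suc N)))"
  define y where "y = x \<circ> cyc (Suc N)"
  have y: "y 0 = x N" "y (Suc l) = x l" if "l < N" for l using that by (auto simp: y_def cyc_def)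
  have ne: "x j \<noteq> x N" using assms(2) j by (simp add: generic_def n)
  have pd: "pd j h x = x N * pd (Suc j) f y"
  proof -
    have "((\<lambda>t. x N * f (y(Suc j := t))) has_field_derivative x N * pd (Suc j) f y) (at (y (Suc j)))"
      by (intro DERIV_cmult sephol_deriv assms(1))
    moreover have "(\<lambda>t. h (x(j := t))) = (\<lambda>t. x N * f (y(Suc j := t)))"
      using j by (simp add: h_def y_def upd_comp_cyc)
    ultimately show ?thesis using y(2)[OF j] unfolding pd_def[of j h] by (metis DERIV_imp_deriv)
  qed
  have hl: "h (x \<circ> swp j l) = x N * f (y \<circ> swp (Suc j) (Suc l))" if "l < N" for l
    using that j swp_comp_cyc[OF j that, of x] by (simp add: h_def y_def swp_def[THEN fun_cong])
  have hN: "h (x \<circ> swp j N) = x j * f (y \<circ> swp (Suc j) 0)"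
    using j swp_comp_cyc_last[OF j, of x] by (simp add: h_def y_def swp_def[THEN fun_cong])
  have "dq n j h x = (\<Sum>l<N. (x N * f y - x N * f (y \<circ> swp (Suc j) (Suc l))) / (x j - x l)) +
      (x N * f y - x j * f (y \<circ> swp (Suc j) 0)) / (x j - x N)"
    unfolding dq_def n sum.lessThan_Suc using hl hN by (simp add: h_def[THEN fun_cong, of x] y_def)
  also have "(\<Sum>l<N. (x N * f y - x N * f (y \<circ> swp (Suc j) (Suc l))) / (x j - x l)) =
      x N * (\<Sum>l<N. (f y - f (y \<circ> swp (Suc j) (Suc l))) / (x j - x l))"
    by (simp add: sum_distrib_left right_diff_distrib)
  also have "(x N * f y - x j * f (y \<circ> swp (Suc j) 0)) / (x j - x N) =
      x N * ((f y - f (y \<circ> swp (Suc j) 0)) / (x j - x N)) - f (y \<circ> swp (Suc j) 0)"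
    using ne by (simp add: field_simps)
  also have "x N * (\<Sum>l<N. (f y - f (y \<circ> swp (Suc j) (Suc l))) / (x j - x l)) +
      (x N * ((f y - f (y \<circ> swp (Suc j) 0)) / (x j - x N)) - f (y \<circ> swp (Suc j) 0)) =
      x N * dq n (Suc j) f y - f (y \<circ> swp (Suc j) 0)"
    unfolding dq_def n sum.lessThan_Suc_shift using y j by (simp add: distrib_left)
  finally have dq: "dq n j h x = x N * dq n (Suc j) f y - f (y \<circ> swp (Suc j) 0)" .
  have "{j<..<n} = insert N {j<..<N}" using j by (auto simp: n)
  hence "(\<Sum>l\<in>{j<..<n}. h (x \<circ> swp l j)) = x j * f (y \<circ> swp (Suc j) 0) + (\<Sum>l\<in>{j<..<N}. h (x \<circ> swp l j))"
    using hN by (simp add: swp_commute[of _ j])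
  also have "(\<Sum>l\<in>{j<..<N}. h (x \<circ> swp l j)) = (\<Sum>l\<in>{j<..<N}. x N * f (y \<circ> swp (Suc l) (Suc j)))"
    using hl by (intro sum.cong refl) (simp add: swp_commute[of _ j] swp_commute[of _ "Suc j"])
  also have "\<dots> = (\<Sum>l\<in>{Suc j<..<n}. x N * f (y \<circ> swp l (Suc j)))"
    by (rule sum.reindex_bij_witness[where i = "\<lambda>l. l - 1" and j = Suc]) (auto simp: n)
  finally have last: "(\<Sum>l\<in>{j<..<n}. h (x \<circ> swp l j)) = x j * f (y \<circ> swp (Suc j) 0) +
      x N * (\<Sum>l\<in>{Suc j<..<n}. f (y \<circ> swp l (Suc j)))"
    unfolding sum_distrib_left .
  have "h x = x N * f y" by (simp add: h_def y_def)
  hence "cherD n k j h x = x N * cherD n k (Suc j) f y"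
    using assms(3) y(2)[OF j] by (simp add: cherD_eq pd dq last algebra_simps)
  thus ?thesis by (simp add: h_def y_def n)
qed

text \<open>The summand \<open>f (x \<circ> cyc n)\<close> is the derivative of the prefactor. The
  corrections from the difference quotients supply the sum of transpositions, which is empty for the
  last index but full for index 0.\<close>

lemma cherD_raise_last:
  assumes "sephol f" "x \<in> generic n" "0 < n"
  shows "cherD n k (n - 1) (\<lambda>x. x (n - 1) * f (x \<circ> cyc n)) x =
    x (n - 1) * (cherD n k 0 f (x \<circ> cyc n) + f (x \<circ> cyc n))"
proof -
  obtain N where n: "n = Suc N" using assms(3) by (cases n) auto
  define h where "h = (\<lambda>x. x N * f (x \<circ> cyc (Suc N)))"
  define y where "y = x \<circ> cyc (Suc N)"
  have y0: "y 0 = x N" by (auto simp: y_def cyc_def)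
  have y: "y (Suc l) = x l" if "l < N" for l using that by (auto simp: y_def cyc_def)
  have ne: "x N \<noteq> x l" if "l < N" for l using assms(2) that by (simp add: generic_def n)
  have pd: "pd N h x = f y + x N * pd 0 f y"
  proof -
    have "((\<lambda>t. t * f (y(0 := t))) has_field_derivative 1 * f (y(0 := y 0)) + pd 0 f y * y 0) (at (y 0))"
      by (intro DERIV_mult DERIV_ident sephol_deriv assms(1))
    moreover have "(\<lambda>t. h (x(N := t))) = (\<lambda>t. t * f (y(0 := t)))"
      using upd_comp_cyc_last[of n x] by (simp add: h_def y_def n)
    ultimately have "pd N h x = 1 * f (y(0 := y 0)) + pd 0 f y * y 0"
      using y0 unfolding pd_def[of N h] by (metis DERIV_imp_deriv)
    thus ?thesis unfolding fun_upd_triv by (simp add: y0 mult.commute)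
  qed
  have hl: "h (x \<circ> swp N l) = x l * f (y \<circ> swp 0 (Suc l))" if "l < N" for l
    using that swp_comp_cyc_last[OF that, of x] swp_commute[of N l] swp_commute[of 0 "Suc l"]
    by (simp add: h_def y_def swp_def[THEN fun_cong])
  have "dq n N h x = (\<Sum>l<N. (x N * f y - x l * f (y \<circ> swp 0 (Suc l))) / (x N - x l))"
    unfolding dq_def n sum.lessThan_Suc using hl by (simp add: h_def[THEN fun_cong, of x] y_def)
  also have "\<dots> = (\<Sum>l<N. x N * ((f y - f (y \<circ> swp 0 (Suc l))) / (x N - x l)) + f (y \<circ> swp 0 (Suc l)))"
  proof (intro sum.cong refl)
    fix l assume "l \<in> {..<N}"
    hence "x N - x l \<noteq> 0" using ne by simp
    thus "(x N * f y - x l * f (y \<circ> swp 0 (Suc l))) / (x N - x l) =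
        x N * ((f y - f (y \<circ> swp 0 (Suc l))) / (x N - x l)) + f (y \<circ> swp 0 (Suc l))"
      by (simp add: divide_simps) (simp add: algebra_simps)
  qed
  also have "\<dots> = x N * (\<Sum>l<N. (f y - f (y \<circ> swp 0 (Suc l))) / (x N - x l)) + (\<Sum>l<N. f (y \<circ> swp 0 (Suc l)))"
    by (simp add: sum.distrib sum_distrib_left)
  also have "(\<Sum>l<N. (f y - f (y \<circ> swp 0 (Suc l))) / (x N - x l)) = dq n 0 f y"
    unfolding dq_def n sum.lessThan_Suc_shift using y y0 by simp
  also have "(\<Sum>l<N. f (y \<circ> swp 0 (Suc l))) = (\<Sum>l\<in>{0<..<n}. f (y \<circ> swp l 0))"
    by (rule sum.reindex_bij_witness[where i = "\<lambda>l. l - 1" and j = Suc]) (auto simp: n swp_commute)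
  finally have dq: "dq n N h x = x N * dq n 0 f y + (\<Sum>l\<in>{0<..<n}. f (y \<circ> swp l 0))" .
  have "{N<..<n} = {}" by (auto simp: n)
  moreover have "N < n" by (simp add: n)
  moreover have "h x = x N * f y" by (simp add: h_def y_def)
  ultimately have "cherD n k N h x = x N * (cherD n k 0 f y + f y)"
    using y0 assms(3) by (simp add: cherD_eq pd dq algebra_simps)
  thus ?thesis by (simp add: h_def y_def n)
qed

text \<open>Symmetry kills the difference quotients and the last index has no transpositions, so
  only the derivative and the scalar term remain.\<close>

lemma cherD_power_sum:
  assumes "0 < n"
  shows "cherD n k (n - 1) (\<lambda>x. (\<Sum>i<n. x i) ^ Suc m) x =
    of_nat (Suc m) * (x (n - 1) * (\<Sum>i<n. x i) ^ m) + of_real (k * (1 - real n)) * (\<Sum>i<n. x i) ^ Suc m"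
proof -
  let ?e = "\<lambda>x. (\<Sum>i<n. x i) ^ Suc m :: complex"
  have "(\<Sum>i<n. (x \<circ> swp (n - 1) l) i) = (\<Sum>i<n. x i)" if "l < n" for l
    using sum.permute[OF swp_permutes[of "n - 1" n l], of x] that by simp
  hence "dq n (n - 1) ?e x = 0" by (simp add: dq_def)
  moreover have "pd (n - 1) ?e x = of_nat (Suc m) * (\<Sum>i<n. x i) ^ m"
  proof -
    define r where "r = (\<Sum>i\<in>{..<n} - {n - 1}. x i)"
    have "(\<Sum>i<n. (x(n - 1 := t)) i) = t + r" for t
    proof -
      have "(\<Sum>i\<in>{..<n} - {n - 1}. (x(n - 1 := t)) i) = r"
        unfolding r_def by (intro sum.cong) auto
      thus ?thesis using assms by (simp add: sum.remove[of "{..<n}" "n - 1"])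
    qed
    note e = this
    have "((\<lambda>t. (t + r) ^ Suc m) has_field_derivative of_nat (Suc m) * (x (n - 1) + r) ^ m) (at (x (n - 1)))"
      by (auto intro!: derivative_eq_intros simp del: power_Suc)
    hence "pd (n - 1) ?e x = of_nat (Suc m) * (x (n - 1) + r) ^ m"
      unfolding pd_def e by (rule DERIV_imp_deriv)
    moreover have "x (n - 1) + r = (\<Sum>i<n. x i)" using e[of "x (n - 1)"] by simp
    ultimately show ?thesis by simp
  qed
  moreover have "{n - 1<..<n} = {}" by auto
  ultimately show ?thesis using assms by (simp add: cherD_eq del: power_Suc)
qed

section \<open>Nonsymmetric Jack polynomials\<close>

definition eig :: "nat \<Rightarrow> real \<Rightarrow> (nat \<Rightarrow> real) \<Rightarrow> ((nat \<Rightarrow> complex) \<Rightarrow> complex) \<Rightarrow> bool" where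
  "eig n k \<theta> f \<longleftrightarrow> (\<forall>j<n. \<forall>x\<in>generic n. cherD n k j f x = of_real (\<theta> j) * f x)"

text \<open>Stated for coefficients instead of functions, so that nonnegativity and support travel
  through the same induction as the eigenvalue equations.\<close>

definition isJ :: "nat \<Rightarrow> real \<Rightarrow> (nat \<Rightarrow> nat) \<Rightarrow> ((nat \<Rightarrow> nat) \<Rightarrow> complex) \<Rightarrow> bool" where
  "isJ n k \<eta> a \<longleftrightarrow> (\<forall>\<kappa>\<in>hom n (weight n \<eta>). a \<kappa> \<in> \<real>\<^sub>\<ge>\<^sub>0) \<and> a \<eta> = 1 \<and>
     (\<forall>\<kappa>\<in>hom n (weight n \<eta>). a \<kappa> \<noteq> 0 \<longrightarrow> (stp n)\<^sup>*\<^sup>* \<kappa> \<eta>) \<and>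
     eig n k (ebar n k \<eta>) (pol n (weight n \<eta>) a)"

lemma generic_permutes: "x \<in> generic n \<Longrightarrow> p permutes {..<n} \<Longrightarrow> x \<circ> p \<in> generic n"
proof -
  assume x: "x \<in> generic n" and p: "p permutes {..<n}"
  have "p i < n" if "i < n" for i using that permutes_in_image[OF p, of i] by simp
  moreover have "p i \<noteq> p j" if "i \<noteq> j" for i j using that permutes_inj[OF p] by (auto dest: injD)
  ultimately show ?thesis using x p by (auto simp: generic_def cvec_def permutes_not_in)
qed

lemma generic_swp: "x \<in> generic n \<Longrightarrow> a < n \<Longrightarrow> b < n \<Longrightarrow> x \<circ> swp a b \<in> generic n"
  by (simp add: generic_permutes swp_permutes)

lemma multi_hom: "\<eta> \<in> multi n \<Longrightarrow> \<eta> \<in> hom n (weight n \<eta>)"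
  by (simp add: hom_def)

lemma rk_zero: "j < n \<Longrightarrow> rk n (\<lambda>_. 0) j = j"
proof -
  assume "j < n"
  hence "{i. i < n \<and> i < j} = {..<j}" by auto
  thus ?thesis by (simp add: rk_def before_def)
qed

lemma isJ_zero: "isJ n k (\<lambda>_. 0) (\<lambda>_. 1)"
proof -
  have p: "pol n 0 (\<lambda>_. 1) = (\<lambda>x. 1)" by (simp add: fun_eq_iff pol_def Defs.mono_def)
  have "cherD n k j (\<lambda>x. 1) x = of_real (ebar n k (\<lambda>_. 0) j)" if "j < n" for j x
  proof -
    \<comment> \<open>On constants D_j is k (1 - n) + k (n - 1 - j) = - k j, and position
      \<open>j\<close> of the zero composition has rank \<open>j\<close>.\<close>
    have "real (n - Suc j) = real n - 1 - real j" using that by simp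
    thus ?thesis using that
      by (simp add: cherD_eq pd_def dq_def ebar_def rk_zero algebra_simps)
  qed
  moreover have "weight n (\<lambda>_. 0) = 0" by (simp add: weight_def)
  ultimately show ?thesis by (simp add: isJ_def eig_def p)
qed

lemma isJ_raise:
  assumes "isJ n k \<kappa> a" "0 < n" "\<kappa> \<in> multi n"
  shows "isJ n k (raise n \<kappa>) (\<lambda>\<eta>. if \<eta> (n - 1) = 0 then 0 else a (lower n \<eta>))"
proof -
  define m where "m = weight n \<kappa>"
  let ?a = "\<lambda>\<eta>. if \<eta> (n - 1) = 0 then 0 else a (lower n \<eta>)"
  have m: "weight n (raise n \<kappa>) = Suc m" using assms(2) by (simp add: weight_raise m_def)
  have low: "lower n \<eta> \<in> hom n m" if "\<eta> \<in> hom n (Suc m)" "\<eta> (n - 1) \<noteq> 0" for \<eta>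
    using that lower_hom assms(2) by blast
  have E: "cherD n k j (pol n m a) x = of_real (ebar n k \<kappa> j) * pol n m a x" if "j < n" "x \<in> generic n" for j x
    using assms(1) that by (simp add: isJ_def eig_def m_def)
  have p: "pol n (Suc m) ?a = (\<lambda>x. x (n - 1) * pol n m a (x \<circ> cyc n))"
    using pol_raise[OF assms(2)] by (simp add: fun_eq_iff)
  have "eig n k (ebar n k (raise n \<kappa>)) (\<lambda>x. x (n - 1) * pol n m a (x \<circ> cyc n))"
    unfolding eig_def
  proof (intro allI impI ballI)
    fix j x assume j: "j < n" and x: "x \<in> generic n"
    have y: "x \<circ> cyc n \<in> generic n" using x generic_permutes cyc_permutes assms(2) by blast
    show "cherD n k j (\<lambda>x. x (n - 1) * pol n m a (x \<circ> cyc n)) x =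
      of_real (ebar n k (raise n \<kappa>) j) * (x (n - 1) * pol n m a (x \<circ> cyc n))"
    proof (cases "Suc j < n")
      case True
      thus ?thesis using E[OF True y] cherD_raise[OF sephol_pol x True] by (simp add: ebar_raise)
    next
      case False
      hence jn: "j = n - 1" using j by simp
      show ?thesis unfolding jn
        using E[OF assms(2) y] cherD_raise_last[OF sephol_pol x assms(2)] ebar_raise_last[OF assms(2)]
        by (simp add: algebra_simps)
    qed
  qed
  moreover have "?a (raise n \<kappa>) = 1"
  proof -
    have "raise n \<kappa> (n - 1) \<noteq> 0" using assms(2) by (simp add: raise_def)
    thus ?thesis using assms lower_raise[of n \<kappa>] by (simp add: isJ_def)
  qed
  moreover have "?a \<eta> \<in> \<real>\<^sub>\<ge>\<^sub>0" if "\<eta> \<in> hom n (Suc m)" for \<eta>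
    using low[OF that] assms(1) by (simp add: isJ_def m_def)
  moreover have "(stp n)\<^sup>*\<^sup>* \<eta> (raise n \<kappa>)" if "\<eta> \<in> hom n (Suc m)" "?a \<eta> \<noteq> 0" for \<eta>
  proof -
    have ne: "\<eta> (n - 1) \<noteq> 0" "a (lower n \<eta>) \<noteq> 0" using that(2) by (auto split: if_splits)
    hence "(stp n)\<^sup>*\<^sup>* (lower n \<eta>) \<kappa>" using low[OF that(1)] assms(1) by (simp add: isJ_def m_def)
    hence "(stp n)\<^sup>*\<^sup>* (raise n (lower n \<eta>)) (raise n \<kappa>)" by (rule stps_raise)
    thus ?thesis using raise_lower ne that(1) hom_multi by (metis neq0_conv)
  qed
  ultimately show ?thesis unfolding isJ_def m p by blast
qed

text \<open>By the Hecke relation D_i and D_{i+1} act triangularly on E and s_i E. The added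
  multiple of E is the one that diagonalises them, with the two eigenvalues exchanged.\<close>

lemma eig_swap:
  assumes "eig n k \<theta> (pol n m a)" "Suc i < n" "\<theta> i \<noteq> \<theta> (Suc i)"
  shows "eig n k (\<theta> \<circ> swp i (Suc i))
    (\<lambda>x. pol n m a (x \<circ> swp i (Suc i)) + of_real (k / (\<theta> (Suc i) - \<theta> i)) * pol n m a x)"
  unfolding eig_def
proof (intro allI impI ballI)
  fix j x assume j: "j < n" and x: "x \<in> generic n"
  let ?s = "swp i (Suc i)"
  have s: "?s i = Suc i" "?s (Suc i) = i" by (simp_all add: swp_def)
  define c where "c = k / (\<theta> (Suc i) - \<theta> i)"
  have c: "c * (\<theta> (Suc i) - \<theta> i) = k" using assms(3) by (simp add: c_def)
  have i: "i < n" using assms(2) by simp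
  let ?f = "pol n m a"
  have E: "cherD n k j ?f x = of_real (\<theta> j) * ?f x" if "j < n" "x \<in> generic n" for j x
    using assms(1) that by (simp add: eig_def)
  have y: "x \<circ> ?s \<in> generic n" using generic_swp x i assms(2) by blast
  have D: "cherD n k j (\<lambda>x. ?f (x \<circ> ?s) + of_real c * ?f x) x =
      cherD n k j (\<lambda>x. ?f (x \<circ> ?s)) x + of_real c * (of_real (\<theta> j) * ?f x)"
    using i assms(2) j E[OF j x]
    by (simp add: cherD_add cherD_cmult sephol_pol sephol_pol_swp sephol_mult sephol_const)
  consider "j = i" | "j = Suc i" | "j \<noteq> i" "j \<noteq> Suc i" by blast
  hence "cherD n k j (\<lambda>x. ?f (x \<circ> ?s) + of_real c * ?f x) x =
      of_real (\<theta> (?s j)) * (?f (x \<circ> ?s) + of_real c * ?f x)"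
  proof cases
    case 1
    have "of_real k = (of_real c * (of_real (\<theta> (Suc i)) - of_real (\<theta> i)) :: complex)"
      using c by (metis of_real_diff of_real_mult)
    note kk = this
    show ?thesis unfolding D unfolding 1 cherD_swp_this[OF assms(2)] E[OF assms(2) y] s kk
      by (simp add: algebra_simps)
  next
    case 2
    have "of_real k = (of_real c * (of_real (\<theta> (Suc i)) - of_real (\<theta> i)) :: complex)"
      using c by (metis of_real_diff of_real_mult)
    note kk = this
    show ?thesis unfolding D unfolding 2 cherD_swp_next[OF assms(2)] E[OF i y] s kk
      by (simp add: algebra_simps)
  next
    case 3
    hence "?s j = j" by (simp add: swp_def)
    thus ?thesis unfolding D
      using E[OF j y] cherD_swp_other[OF assms(2) j 3, of k ?f x] by (simp add: algebra_simps)
  qed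
  thus "cherD n k j (\<lambda>x. ?f (x \<circ> ?s) + of_real (k / (\<theta> (Suc i) - \<theta> i)) * ?f x) x =
      of_real ((\<theta> \<circ> ?s) j) * (?f (x \<circ> ?s) + of_real (k / (\<theta> (Suc i) - \<theta> i)) * ?f x)"
    by (simp add: c_def)
qed

lemma isJ_swap:
  assumes "isJ n k \<eta> a" "0 \<le> k" "\<eta> \<in> multi n" "Suc i < n" "\<eta> i < \<eta> (Suc i)"
  shows "isJ n k (\<eta> \<circ> swp i (Suc i))
    (\<lambda>\<kappa>. a (\<kappa> \<circ> swp i (Suc i)) + of_real (k / (ebar n k \<eta> (Suc i) - ebar n k \<eta> i)) * a \<kappa>)"
proof -
  let ?s = "swp i (Suc i)"
  define c where "c = k / (ebar n k \<eta> (Suc i) - ebar n k \<eta> i)"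
  define m where "m = weight n \<eta>"
  have i: "i < n" using assms(4) by simp
  have gap: "1 + k \<le> ebar n k \<eta> (Suc i) - ebar n k \<eta> i" using ebar_diff_less assms by blast
  hence c0: "0 \<le> c" using assms(2) by (simp add: c_def)
  have m: "weight n (\<eta> \<circ> ?s) = m" using weight_permutes swp_permutes i assms(4) by (simp add: m_def)
  have \<eta>: "\<eta> \<in> hom n m" using assms(3) by (simp add: m_def hom_def)
  have st: "(stp n)\<^sup>*\<^sup>* \<kappa> (\<eta> \<circ> ?s) \<and> (stp n)\<^sup>*\<^sup>* (\<kappa> \<circ> ?s) (\<eta> \<circ> ?s)" if "\<kappa> \<in> hom n m" "a \<kappa> \<noteq> 0" for \<kappa>
    using stps_swp[of n \<kappa> \<eta> i] assms that by (auto simp: isJ_def m_def)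
  have nn: "a (\<kappa> \<circ> ?s) + of_real c * a \<kappa> \<in> \<real>\<^sub>\<ge>\<^sub>0" if "\<kappa> \<in> hom n m" for \<kappa>
  proof -
    have "\<kappa> \<circ> ?s \<in> hom n m" using that i assms(4) by simp
    thus ?thesis using that assms(1) c0
      by (intro nonneg_Reals_add_I nonneg_Reals_mult_I) (auto simp: isJ_def m_def)
  qed
  have supp: "(stp n)\<^sup>*\<^sup>* \<kappa> (\<eta> \<circ> ?s)" if "\<kappa> \<in> hom n m" "a (\<kappa> \<circ> ?s) + of_real c * a \<kappa> \<noteq> 0" for \<kappa>
  proof (cases "a \<kappa> = 0")
    case True
    hence "a (\<kappa> \<circ> ?s) \<noteq> 0" using that by simp
    moreover have "\<kappa> \<circ> ?s \<in> hom n m" using that i assms(4) by simp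
    ultimately show ?thesis using st[of "\<kappa> \<circ> ?s"] unfolding comp_swp_swp by blast
  qed (use st that in blast)
  \<comment> \<open>The new leading monomial lies above \<open>\<eta>\<close> in the measure, hence
    is absent from the old polynomial; its coefficient 1 comes from the transposed polynomial
    alone.\<close>
  have lead: "a (\<eta> \<circ> ?s \<circ> ?s) + of_real c * a (\<eta> \<circ> ?s) = 1"
  proof -
    have "a (\<eta> \<circ> ?s) = 0"
    proof (rule ccontr)
      assume a: "a (\<eta> \<circ> ?s) \<noteq> 0"
      have h: "\<eta> \<circ> ?s \<in> hom n m" using \<eta> i assms(4) by simp
      hence "(stp n)\<^sup>*\<^sup>* (\<eta> \<circ> ?s) \<eta>" using a assms(1) by (simp add: isJ_def m_def)
      hence 1: "\<eta> \<circ> ?s = \<eta> \<or> msr n m (\<eta> \<circ> ?s) < msr n m \<eta>" using stps_hom_msr \<eta> by blast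
      have "stp n (\<eta> \<circ> ?s \<circ> ?s) (\<eta> \<circ> ?s)"
        by (rule stp.down) (use assms in \<open>auto simp: swp_def\<close>)
      hence "msr n m \<eta> < msr n m (\<eta> \<circ> ?s)" using stp_hom_msr h unfolding comp_swp_swp by blast
      thus False using 1 by auto
    qed
    moreover have "a \<eta> = 1" using assms(1) by (simp add: isJ_def)
    ultimately show ?thesis unfolding comp_swp_swp by simp
  qed
  have p: "pol n m (\<lambda>\<kappa>. a (\<kappa> \<circ> ?s) + of_real c * a \<kappa>) = (\<lambda>x. pol n m a (x \<circ> ?s) + of_real c * pol n m a x)"
    using i assms(4) by (simp add: fun_eq_iff pol_swp pol_cmult pol_add)
  have "eig n k (ebar n k \<eta> \<circ> ?s) (pol n m (\<lambda>\<kappa>. a (\<kappa> \<circ> ?s) + of_real c * a \<kappa>))"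
    unfolding p unfolding c_def by (rule eig_swap) (use assms gap in \<open>auto simp: isJ_def m_def\<close>)
  moreover have "ebar n k \<eta> \<circ> ?s = ebar n k (\<eta> \<circ> ?s)"
    using ebar_swp[OF assms(4), of \<eta> k] assms(5) by (simp add: fun_eq_iff)
  ultimately show ?thesis unfolding isJ_def m c_def[symmetric] using nn supp lead by metis
qed

lemma isJ_exists: "0 \<le> k \<Longrightarrow> \<eta> \<in> multi n \<Longrightarrow> \<exists>a. isJ n k \<eta> a"
proof -
  assume k: "0 \<le> k"
  assume "\<eta> \<in> multi n"
  thus ?thesis
  proof (induction rule: multi_induct)
    case zero
    thus ?case using isJ_zero by blast
  next
    case (raise \<kappa>)
    thus ?case using isJ_raise by blast
  next
    case (swap \<kappa> i)
    thus ?case using isJ_swap[OF _ k] by blast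
  qed
qed

definition jc :: "nat \<Rightarrow> real \<Rightarrow> (nat \<Rightarrow> nat) \<Rightarrow> (nat \<Rightarrow> nat) \<Rightarrow> complex" where
  "jc n k \<eta> = (SOME a. isJ n k \<eta> a)"

definition JE :: "nat \<Rightarrow> real \<Rightarrow> (nat \<Rightarrow> nat) \<Rightarrow> (nat \<Rightarrow> complex) \<Rightarrow> complex" where
  "JE n k \<eta> = pol n (weight n \<eta>) (jc n k \<eta>)"

context
  fixes n :: nat and k :: real
  assumes k: "0 \<le> k"
begin

section \<open>Basis property and spectral uniqueness\<close>

lemma isJ_jc: "\<eta> \<in> multi n \<Longrightarrow> isJ n k \<eta> (jc n k \<eta>)"
  unfolding jc_def by (rule someI_ex[of "isJ n k \<eta>"]) (rule isJ_exists[OF k])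

lemma JE_hom: "\<eta> \<in> hom n m \<Longrightarrow> JE n k \<eta> = pol n m (jc n k \<eta>)"
  by (simp add: JE_def hom_def)

lemma jc_self: "\<eta> \<in> hom n m \<Longrightarrow> jc n k \<eta> \<eta> = 1"
  using isJ_jc[OF hom_multi] by (simp add: isJ_def)

lemma jc_nonneg: "\<eta> \<in> hom n m \<Longrightarrow> \<kappa> \<in> hom n m \<Longrightarrow> jc n k \<eta> \<kappa> \<in> \<real>\<^sub>\<ge>\<^sub>0"
  using isJ_jc[OF hom_multi, of \<eta> m] by (simp add: isJ_def hom_def)

lemma jc_stps: "\<eta> \<in> hom n m \<Longrightarrow> \<kappa> \<in> hom n m \<Longrightarrow> jc n k \<eta> \<kappa> \<noteq> 0 \<Longrightarrow> (stp n)\<^sup>*\<^sup>* \<kappa> \<eta>"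
  using isJ_jc[OF hom_multi, of \<eta> m] by (simp add: isJ_def hom_def)

lemma jc_msr: "\<eta> \<in> hom n m \<Longrightarrow> \<kappa> \<in> hom n m \<Longrightarrow> jc n k \<eta> \<kappa> \<noteq> 0 \<Longrightarrow> \<kappa> = \<eta> \<or> msr n m \<kappa> < msr n m \<eta>"
  using jc_stps stps_hom_msr by blast

lemma JE_eig: "\<eta> \<in> multi n \<Longrightarrow> eig n k (ebar n k \<eta>) (JE n k \<eta>)"
  using isJ_jc by (simp add: isJ_def JE_def)

text \<open>Back substitution: E_\<kappa> is the monomial of \<open>\<kappa>\<close> plus monomials
  of smaller measure, which are already expressed.\<close>

lemma mon_span: "\<kappa> \<in> hom n m \<Longrightarrow> \<exists>b. \<forall>x. mon n \<kappa> x = (\<Sum>\<eta>\<in>hom n m. b \<eta> * JE n k \<eta> x)"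
proof (induction "msr n m \<kappa>" arbitrary: \<kappa> rule: less_induct)
  case less
  have "\<exists>b. \<forall>x. jc n k \<kappa> \<theta> * mon n \<theta> x = (\<Sum>\<eta>\<in>hom n m. b \<eta> * JE n k \<eta> x)"
    if "\<theta> \<in> hom n m - {\<kappa>}" for \<theta>
  proof (cases "jc n k \<kappa> \<theta> = 0")
    case True
    thus ?thesis by (intro exI[of _ "\<lambda>_. 0"]) simp
  next
    case False
    hence "msr n m \<theta> < msr n m \<kappa>" using jc_msr less(2) that by blast
    moreover have "\<theta> \<in> hom n m" using that by blast
    ultimately obtain b where "\<And>x. mon n \<theta> x = (\<Sum>\<eta>\<in>hom n m. b \<eta> * JE n k \<eta> x)" using less(1) by blast
    thus ?thesis by (intro exI[of _ "\<lambda>\<eta>. jc n k \<kappa> \<theta> * b \<eta>"]) (simp add: sum_distrib_left mult_ac)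
  qed
  then obtain b where b: "\<And>\<theta> x. \<theta> \<in> hom n m - {\<kappa>} \<Longrightarrow>
      jc n k \<kappa> \<theta> * mon n \<theta> x = (\<Sum>\<eta>\<in>hom n m. b \<theta> \<eta> * JE n k \<eta> x)" by metis
  define c where "c \<eta> = (if \<eta> = \<kappa> then 1 else 0) - (\<Sum>\<theta>\<in>hom n m - {\<kappa>}. b \<theta> \<eta>)" for \<eta>
  have "mon n \<kappa> x = (\<Sum>\<eta>\<in>hom n m. c \<eta> * JE n k \<eta> x)" for x
  proof -
    have "JE n k \<kappa> x = mon n \<kappa> x + (\<Sum>\<theta>\<in>hom n m - {\<kappa>}. jc n k \<kappa> \<theta> * mon n \<theta> x)"
      unfolding JE_hom[OF less(2)] pol_def by (simp add: sum.remove[OF _ less(2)] jc_self[OF less(2)])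
    also have "(\<Sum>\<theta>\<in>hom n m - {\<kappa>}. jc n k \<kappa> \<theta> * mon n \<theta> x) =
        (\<Sum>\<theta>\<in>hom n m - {\<kappa>}. \<Sum>\<eta>\<in>hom n m. b \<theta> \<eta> * JE n k \<eta> x)"
      by (intro sum.cong refl b)
    also have "\<dots> = (\<Sum>\<eta>\<in>hom n m. (\<Sum>\<theta>\<in>hom n m - {\<kappa>}. b \<theta> \<eta>) * JE n k \<eta> x)"
      by (subst sum.swap) (simp add: sum_distrib_right)
    finally have "mon n \<kappa> x = JE n k \<kappa> x - (\<Sum>\<eta>\<in>hom n m. (\<Sum>\<theta>\<in>hom n m - {\<kappa>}. b \<theta> \<eta>) * JE n k \<eta> x)"
      by simp
    also have "JE n k \<kappa> x = (\<Sum>\<eta>\<in>hom n m. (if \<eta> = \<kappa> then 1 else 0) * JE n k \<eta> x)"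
      using less(2) by (simp add: if_distrib[of "\<lambda>c. c * _"] cong: if_cong)
    finally show ?thesis by (simp add: c_def left_diff_distrib sum_subtractf)
  qed
  thus ?case by blast
qed

lemma pol_span: "\<exists>b. \<forall>x. pol n m a x = (\<Sum>\<eta>\<in>hom n m. b \<eta> * JE n k \<eta> x)"
proof -
  have "\<forall>\<kappa>\<in>hom n m. \<exists>b. \<forall>x. mon n \<kappa> x = (\<Sum>\<eta>\<in>hom n m. b \<eta> * JE n k \<eta> x)" using mon_span by blast
  then obtain b where b: "\<And>\<kappa> x. \<kappa> \<in> hom n m \<Longrightarrow> mon n \<kappa> x = (\<Sum>\<eta>\<in>hom n m. b \<kappa> \<eta> * JE n k \<eta> x)"
    by metis
  have "pol n m a x = (\<Sum>\<eta>\<in>hom n m. (\<Sum>\<kappa>\<in>hom n m. a \<kappa> * b \<kappa> \<eta>) * JE n k \<eta> x)" for x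
  proof -
    have "pol n m a x = (\<Sum>\<kappa>\<in>hom n m. \<Sum>\<eta>\<in>hom n m. a \<kappa> * b \<kappa> \<eta> * JE n k \<eta> x)"
      unfolding pol_def by (intro sum.cong refl) (simp add: b sum_distrib_left mult_ac)
    also have "\<dots> = (\<Sum>\<eta>\<in>hom n m. (\<Sum>\<kappa>\<in>hom n m. a \<kappa> * b \<kappa> \<eta>) * JE n k \<eta> x)"
      by (subst sum.swap) (simp add: sum_distrib_right)
    finally show ?thesis .
  qed
  thus ?thesis by (intro exI allI)
qed

text \<open>Take an index \<open>\<kappa>\<close> of maximal measure with nonzero coefficient. No
  other E in the combination contains the monomial of \<open>\<kappa>\<close>, so that coefficient
  must vanish.\<close>

lemma JE_indep:
  assumes "\<And>x. x \<in> generic n \<Longrightarrow> (\<Sum>\<eta>\<in>hom n m. b \<eta> * JE n k \<eta> x) = 0" "\<eta> \<in> hom n m"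
  shows "b \<eta> = 0"
proof (rule ccontr)
  assume "b \<eta> \<noteq> 0"
  define S where "S = {\<eta> \<in> hom n m. b \<eta> \<noteq> 0}"
  have S: "finite S" "S \<noteq> {}" using \<open>b \<eta> \<noteq> 0\<close> assms(2) by (auto simp: S_def)
  have "Max (msr n m ` S) \<in> msr n m ` S" using S by (intro Max_in) auto
  then obtain \<kappa> where \<kappa>: "\<kappa> \<in> S" and eq: "Max (msr n m ` S) = msr n m \<kappa>" by blast
  have max: "msr n m \<theta> \<le> msr n m \<kappa>" if "\<theta> \<in> S" for \<theta>
    unfolding eq[symmetric] using S that by (intro Max_ge) auto
  have hom: "\<kappa> \<in> hom n m" using \<kappa> by (simp add: S_def)
  have "pol n m (\<lambda>\<kappa>. \<Sum>\<eta>\<in>hom n m. b \<eta> * jc n k \<eta> \<kappa>) x = 0" if "x \<in> generic n" for x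
    using assms(1)[OF that] by (simp add: JE_hom flip: pol_sum cong: sum.cong)
  from pol_indep[OF this hom] have "0 = (\<Sum>\<eta>\<in>hom n m. b \<eta> * jc n k \<eta> \<kappa>)" by simp
  also have "\<dots> = (\<Sum>\<eta>\<in>hom n m. if \<eta> = \<kappa> then b \<kappa> else 0)"
  proof (intro sum.cong refl)
    fix \<theta> assume \<theta>: "\<theta> \<in> hom n m"
    show "b \<theta> * jc n k \<theta> \<kappa> = (if \<theta> = \<kappa> then b \<kappa> else 0)"
    proof (cases "\<theta> = \<kappa>")
      case True
      thus ?thesis using jc_self hom by simp
    next
      case False
      have "\<not> (b \<theta> \<noteq> 0 \<and> jc n k \<theta> \<kappa> \<noteq> 0)"
        using jc_msr[OF \<theta> hom] False max[of \<theta>] \<theta> by (auto simp: S_def)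
      thus ?thesis using False by auto
    qed
  qed
  also have "\<dots> = b \<kappa>" using hom by simp
  finally show False using \<kappa> by (simp add: S_def)
qed

lemma sephol_JE: "sephol (JE n k \<eta>)"
  by (simp add: JE_def sephol_pol)

lemma cherD_JE_sum:
  assumes "j < n" "x \<in> generic n"
  shows "cherD n k j (\<lambda>x. \<Sum>\<eta>\<in>hom n m. b \<eta> * JE n k \<eta> x) x =
    (\<Sum>\<eta>\<in>hom n m. b \<eta> * of_real (ebar n k \<eta> j) * JE n k \<eta> x)"
proof -
  have "cherD n k j (JE n k \<eta>) x = of_real (ebar n k \<eta> j) * JE n k \<eta> x" if "\<eta> \<in> hom n m" for \<eta>
    using JE_eig[OF hom_multi[OF that]] assms by (simp add: eig_def)
  thus ?thesis using assms(1) by (simp add: cherD_sum sephol_JE mult_ac cong: sum.cong)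
qed

text \<open>In the basis of the E, applying D_j multiplies coefficients by eigenvalues, so only
  compositions with spectrum \<open>\<theta>\<close> can occur. The last hypothesis admits
  \<open>\<eta>\<close> as the sole candidate without asserting that its spectrum is
  \<open>\<theta>\<close>; \<open>JE_swap_eq\<close> relies on this latitude.\<close>

lemma eig_unique:
  assumes "eig n k \<theta> (pol n m a)" "\<eta> \<in> hom n m"
    and "\<And>\<kappa>. \<kappa> \<in> hom n m \<Longrightarrow> (\<And>j. j < n \<Longrightarrow> ebar n k \<kappa> j = \<theta> j) \<Longrightarrow> \<kappa> = \<eta>"
  shows "pol n m a = (\<lambda>x. a \<eta> * JE n k \<eta> x)"
proof -
  obtain b where b: "\<And>x. pol n m a x = (\<Sum>\<eta>\<in>hom n m. b \<eta> * JE n k \<eta> x)" using pol_span by blast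
  hence eq: "pol n m a = (\<lambda>x. \<Sum>\<eta>\<in>hom n m. b \<eta> * JE n k \<eta> x)" by blast
  have 0: "b \<kappa> = 0" if "\<kappa> \<in> hom n m" "\<kappa> \<noteq> \<eta>" for \<kappa>
  proof -
    have "\<exists>j<n. ebar n k \<kappa> j \<noteq> \<theta> j" using assms(3)[OF that(1)] that(2) by blast
    then obtain j where j: "j < n" "ebar n k \<kappa> j \<noteq> \<theta> j" by blast
    have "(\<Sum>\<eta>\<in>hom n m. (b \<eta> * of_real (ebar n k \<eta> j - \<theta> j)) * JE n k \<eta> x) = 0" if x: "x \<in> generic n" for x
    proof -
      have "(\<Sum>\<eta>\<in>hom n m. b \<eta> * of_real (ebar n k \<eta> j) * JE n k \<eta> x) = of_real (\<theta> j) * pol n m a x"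
        using cherD_JE_sum[OF j(1) x, of b m] assms(1) j(1) x by (simp add: eq eig_def)
      also have "\<dots> = (\<Sum>\<eta>\<in>hom n m. b \<eta> * of_real (\<theta> j) * JE n k \<eta> x)"
        by (simp add: b sum_distrib_left mult_ac)
      finally show ?thesis by (simp add: algebra_simps sum_subtractf)
    qed
    from JE_indep[OF this that(1)] show ?thesis using j(2) by simp
  qed
  have c: "pol n m a x = b \<eta> * JE n k \<eta> x" for x
  proof -
    have "pol n m a x = b \<eta> * JE n k \<eta> x + (\<Sum>\<kappa>\<in>hom n m - {\<eta>}. b \<kappa> * JE n k \<kappa> x)"
      unfolding b by (rule sum.remove) (use assms(2) in auto)
    also have "(\<Sum>\<kappa>\<in>hom n m - {\<eta>}. b \<kappa> * JE n k \<kappa> x) = 0" by (intro sum.neutral) (simp add: 0)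
    finally show ?thesis by simp
  qed
  have "pol n m (\<lambda>\<kappa>. a \<kappa> - b \<eta> * jc n k \<eta> \<kappa>) x = 0" for x
    using c[of x] by (simp add: JE_hom[OF assms(2)] pol_cmult flip: pol_diff)
  hence "a \<eta> - b \<eta> * jc n k \<eta> \<eta> = 0" using pol_indep[of n m "\<lambda>\<kappa>. a \<kappa> - b \<eta> * jc n k \<eta> \<kappa>" \<eta>] assms(2) by blast
  hence "a \<eta> = b \<eta>" using jc_self[OF assms(2)] by simp
  thus ?thesis using c by auto
qed

lemma eig_unique_ebar:
  assumes "eig n k (ebar n k \<eta>) (pol n m a)" "\<eta> \<in> hom n m"
  shows "pol n m a = (\<lambda>x. a \<eta> * JE n k \<eta> x)"
proof (rule eig_unique[OF assms])
  fix \<kappa> assume "\<kappa> \<in> hom n m" "\<And>j. j < n \<Longrightarrow> ebar n k \<kappa> j = ebar n k \<eta> j"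
  thus "\<kappa> = \<eta>" using ebar_inject[OF k permutes_id, of n \<kappa> \<eta>] assms(2) hom_multi by auto
qed

text \<open>\<open>prec\<close> preserves the degree, so the index set is a finite part of
  \<open>hom n m\<close>, and irreflexivity keeps the leading coefficient apart.\<close>

lemma triangular_pol:
  assumes "\<eta> \<in> hom n m"
  shows "mon n \<eta> x + (\<Sum>\<kappa>\<in>{\<kappa> \<in> multi n. prec n \<kappa> \<eta>}. c \<kappa> * mon n \<kappa> x) =
    pol n m (\<lambda>\<kappa>. if \<kappa> = \<eta> then 1 else if prec n \<kappa> \<eta> then c \<kappa> else 0) x"
proof -
  let ?a = "\<lambda>\<kappa>. if \<kappa> = \<eta> then 1 else if prec n \<kappa> \<eta> then c \<kappa> else 0"
  have "pol n m ?a x = mon n \<eta> x + (\<Sum>\<kappa>\<in>hom n m - {\<eta>}. ?a \<kappa> * mon n \<kappa> x)"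
    unfolding pol_def by (simp add: sum.remove[OF _ assms])
  also have "(\<Sum>\<kappa>\<in>hom n m - {\<eta>}. ?a \<kappa> * mon n \<kappa> x) = (\<Sum>\<kappa>\<in>{\<kappa> \<in> multi n. prec n \<kappa> \<eta>}. ?a \<kappa> * mon n \<kappa> x)"
  proof (rule sum.mono_neutral_right)
    show "{\<kappa> \<in> multi n. prec n \<kappa> \<eta>} \<subseteq> hom n m - {\<eta>}"
    proof
      fix \<kappa> assume "\<kappa> \<in> {\<kappa> \<in> multi n. prec n \<kappa> \<eta>}"
      hence "\<kappa> \<in> multi n" "prec n \<kappa> \<eta>" by auto
      moreover from this have "weight n \<kappa> = m" using prec_weight[of n \<kappa> \<eta>] assms by (simp add: hom_def)
      ultimately show "\<kappa> \<in> hom n m - {\<eta>}" using prec_irrefl by (auto simp: hom_def)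
    qed
    show "\<forall>i\<in>hom n m - {\<eta>} - {\<kappa> \<in> multi n. prec n \<kappa> \<eta>}. ?a i * mon n i x = 0"
      by (auto simp: hom_def)
  qed simp
  also have "\<dots> = (\<Sum>\<kappa>\<in>{\<kappa> \<in> multi n. prec n \<kappa> \<eta>}. c \<kappa> * mon n \<kappa> x)"
    using prec_irrefl by (intro sum.cong) auto
  finally show ?thesis by simp
qed

text \<open>Existence: the support consists of chains of \<open>stp\<close>, hence lies below
  \<open>\<eta>\<close> in \<open>prec\<close>. Uniqueness: a competitor has the same spectrum and
  leading coefficient 1.\<close>

lemma jackE_eq_JE:
  assumes "\<eta> \<in> multi n"
  shows "jackE n k \<eta> = JE n k \<eta>"
  unfolding jackE_def
proof (rule the_equality)
  define m where "m = weight n \<eta>"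
  have \<eta>: "\<eta> \<in> hom n m" using assms by (simp add: m_def hom_def)
  have "pol n m (\<lambda>\<kappa>. if \<kappa> = \<eta> then 1 else if prec n \<kappa> \<eta> then jc n k \<eta> \<kappa> else 0) x = JE n k \<eta> x" for x
    unfolding JE_hom[OF \<eta>] pol_def
  proof (intro sum.cong refl)
    fix \<kappa> assume "\<kappa> \<in> hom n m"
    thus "(if \<kappa> = \<eta> then 1 else if prec n \<kappa> \<eta> then jc n k \<eta> \<kappa> else 0) * mon n \<kappa> x = jc n k \<eta> \<kappa> * mon n \<kappa> x"
      using jc_self[OF \<eta>] jc_stps[OF \<eta>] stps_prec[OF _ \<eta>] by auto
  qed
  hence "JE n k \<eta> = (\<lambda>x. mon n \<eta> x + (\<Sum>\<kappa>\<in>{\<kappa> \<in> multi n. prec n \<kappa> \<eta>}. jc n k \<eta> \<kappa> * mon n \<kappa> x))"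
    unfolding triangular_pol[OF \<eta>] by presburger
  thus "(\<exists>c. JE n k \<eta> = (\<lambda>x. mon n \<eta> x + (\<Sum>\<kappa>\<in>{\<kappa> \<in> multi n. prec n \<kappa> \<eta>}. c \<kappa> * mon n \<kappa> x))) \<and>
      (\<forall>j<n. \<forall>x\<in>generic n. cherD n k j (JE n k \<eta>) x = eta_bar n k \<eta> j * JE n k \<eta> x)"
    using JE_eig[OF assms] by (auto simp: eig_def eta_bar_eq)
next
  fix f assume f: "(\<exists>c. f = (\<lambda>x. mon n \<eta> x + (\<Sum>\<kappa>\<in>{\<kappa> \<in> multi n. prec n \<kappa> \<eta>}. c \<kappa> * mon n \<kappa> x))) \<and>
      (\<forall>j<n. \<forall>x\<in>generic n. cherD n k j f x = eta_bar n k \<eta> j * f x)"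
  define m where "m = weight n \<eta>"
  have \<eta>: "\<eta> \<in> hom n m" using assms by (simp add: m_def hom_def)
  from f obtain c where c: "f = (\<lambda>x. mon n \<eta> x + (\<Sum>\<kappa>\<in>{\<kappa> \<in> multi n. prec n \<kappa> \<eta>}. c \<kappa> * mon n \<kappa> x))" by blast
  define a where "a = (\<lambda>\<kappa>. if \<kappa> = \<eta> then 1 else if prec n \<kappa> \<eta> then c \<kappa> else 0)"
  have fa: "f = pol n m a" unfolding c triangular_pol[OF \<eta>] a_def ..
  have "eig n k (ebar n k \<eta>) (pol n m a)" using f by (simp add: eig_def fa eta_bar_eq)
  from eig_unique_ebar[OF this \<eta>] show "f = JE n k \<eta>" unfolding fa by (simp add: a_def)
qed

lemma isJ_unique:
  assumes "isJ n k \<eta> a" "\<eta> \<in> multi n"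
  shows "pol n (weight n \<eta>) a = JE n k \<eta>"
  using eig_unique_ebar[of \<eta> "weight n \<eta>" a] assms by (simp add: isJ_def hom_def)

section \<open>Raising and adjacent transpositions on the basis\<close>

lemma JE_zero: "JE n k (\<lambda>_. 0) x = 1"
proof -
  have "JE n k (\<lambda>_. 0) = pol n 0 (\<lambda>_. 1)"
    using isJ_unique[OF isJ_zero] by (simp add: multi_def weight_def)
  thus ?thesis by (simp add: pol_def Defs.mono_def)
qed

lemma JE_raise:
  assumes "0 < n" "\<kappa> \<in> multi n"
  shows "JE n k (raise n \<kappa>) x = x (n - 1) * JE n k \<kappa> (x \<circ> cyc n)"
  unfolding isJ_unique[OF isJ_raise[OF isJ_jc[OF assms(2)] assms] raise_multi[OF assms(1)], symmetric]
    JE_def[of n k \<kappa>] weight_raise[OF assms(1)] pol_raise[OF assms(1)] ..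

lemma JE_swap:
  assumes "\<eta> \<in> multi n" "Suc i < n" "\<eta> i < \<eta> (Suc i)"
  shows "JE n k (\<eta> \<circ> swp i (Suc i)) x = JE n k \<eta> (x \<circ> swp i (Suc i)) +
    of_real (k / (ebar n k \<eta> (Suc i) - ebar n k \<eta> i)) * JE n k \<eta> x"
proof -
  have i: "i < n" using assms by simp
  have m: "\<eta> \<circ> swp i (Suc i) \<in> multi n" using multi_swp i assms by blast
  have w: "weight n (\<eta> \<circ> swp i (Suc i)) = weight n \<eta>"
    using weight_permutes swp_permutes i assms by blast
  show ?thesis
    unfolding isJ_unique[OF isJ_swap[OF isJ_jc[OF assms(1)] k assms] m, symmetric] w JE_def[of n k \<eta>]
    by (simp only: pol_swp[OF i assms(2)] pol_cmult pol_add)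
qed

text \<open>Here the two eigenvalues differ by \<open>k\<close>, so by the Hecke relation s_i E - E
  is an eigenfunction with these eigenvalues exchanged. A composition with that spectrum could only
  be \<open>\<eta>\<close> itself, so the difference is \<open>g \<eta>\<close> times E, and
  \<open>g \<eta>\<close> is 0. This covers \<open>k = 0\<close>, where the exchange is trivial,
  together with \<open>k > 0\<close>.\<close>

lemma JE_swap_eq:
  assumes "\<eta> \<in> multi n" "Suc i < n" "\<eta> i = \<eta> (Suc i)"
  shows "JE n k \<eta> (x \<circ> swp i (Suc i)) = JE n k \<eta> x"
proof -
  let ?s = "swp i (Suc i)"
  define m where "m = weight n \<eta>"
  have i: "i < n" using assms by simp
  have \<eta>: "\<eta> \<in> hom n m" using assms by (simp add: m_def hom_def)
  have s: "?s i = Suc i" "?s (Suc i) = i" by (simp_all add: swp_def)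
  have \<eta>s: "\<eta> \<circ> ?s = \<eta>" using assms(3) by (auto simp: swp_def)
  let ?a = "jc n k \<eta>" and ?f = "JE n k \<eta>" and ?\<theta> = "ebar n k \<eta>"
  define g where "g = (\<lambda>\<kappa>. ?a (\<kappa> \<circ> ?s) - ?a \<kappa>)"
  have g: "pol n m g = (\<lambda>x. ?f (x \<circ> ?s) + (- 1) * ?f x)"
    unfolding JE_hom[OF \<eta>] g_def pol_swp[OF i assms(2)] by (simp add: fun_eq_iff flip: pol_diff)
  have E: "cherD n k j ?f x = of_real (?\<theta> j) * ?f x" if "j < n" "x \<in> generic n" for j x
    using JE_eig[OF assms(1)] that by (simp add: eig_def)
  have kk: "of_real k = (of_real (?\<theta> i) - of_real (?\<theta> (Suc i)) :: complex)"
    using ebar_Suc_eq[OF assms(2,3), of k] by (metis of_real_diff)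
  have "eig n k (?\<theta> \<circ> ?s) (pol n m g)"
    unfolding eig_def
  proof (intro allI impI ballI)
    fix j x assume j: "j < n" and x: "x \<in> generic n"
    have y: "x \<circ> ?s \<in> generic n" using generic_swp x i assms(2) by blast
    have sf: "sephol (\<lambda>x. ?f (x \<circ> ?s))" unfolding JE_def using sephol_pol_swp i assms(2) by blast
    have D: "cherD n k j (pol n m g) x = cherD n k j (\<lambda>x. ?f (x \<circ> ?s)) x - of_real (?\<theta> j) * ?f x"
      unfolding g using j E[OF j x] cherD_add[OF j sf sephol_mult[OF sephol_const sephol_JE], of k "-1" \<eta> x]
        cherD_cmult[OF j sephol_JE, of k "-1" \<eta> x] by simp
    consider "j = i" | "j = Suc i" | "j \<noteq> i" "j \<noteq> Suc i" by blast
    thus "cherD n k j (pol n m g) x = of_real ((?\<theta> \<circ> ?s) j) * pol n m g x"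
    proof cases
      case 1
      show ?thesis unfolding D unfolding 1 g cherD_swp_this[OF assms(2)] E[OF assms(2) y] kk
        by (simp add: s algebra_simps)
    next
      case 2
      show ?thesis unfolding D unfolding 2 g cherD_swp_next[OF assms(2)] E[OF i y] kk
        by (simp add: s algebra_simps)
    next
      case 3
      hence "?s j = j" by (simp add: swp_def)
      thus ?thesis unfolding D unfolding g
        using E[OF j y] cherD_swp_other[OF assms(2) j 3, of k ?f x] by (simp add: algebra_simps)
    qed
  qed
  hence "pol n m g = (\<lambda>x. g \<eta> * ?f x)"
  proof (rule eig_unique[OF _ \<eta>])
    fix \<kappa> assume "\<kappa> \<in> hom n m" "\<And>j. j < n \<Longrightarrow> ebar n k \<kappa> j = (?\<theta> \<circ> ?s) j"
    hence "\<kappa> = \<eta> \<circ> ?s" using ebar_inject[OF k swp_permutes[OF i assms(2)], of \<kappa> \<eta>] \<eta> hom_multi by auto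
    thus "\<kappa> = \<eta>" using \<eta>s by metis
  qed
  moreover have "g \<eta> = 0" unfolding g_def \<eta>s by simp
  ultimately have "pol n m g x = 0" by simp
  thus ?thesis unfolding g by simp
qed

end

section \<open>Expansion of the powers of the coordinate sum\<close>

text \<open>The numbers L_\<eta>(1) of the estimate. For compositions nothing is lost by the real
  part, see \<open>jackL_one\<close>.\<close>

definition ell :: "nat \<Rightarrow> real \<Rightarrow> (nat \<Rightarrow> nat) \<Rightarrow> real" where
  "ell n k \<eta> = Re (jackL n k \<eta> (one_vec n))"

text \<open>\<open>om n k \<mu> \<eta>\<close> is the symbol \<open>[\<mu>]\<close> of the decreasing rearrangement of \<open>\<eta>\<close>, with each factor
  attached to the position in \<open>\<eta>\<close> that it comes from.\<close>

definition om :: "nat \<Rightarrow> real \<Rightarrow> real \<Rightarrow> (nat \<Rightarrow> nat) \<Rightarrow> real" where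
  "om n k \<mu> \<eta> = (\<Prod>j<n. pochhammer (\<mu> - k * real (rk n \<eta> j)) (\<eta> j))"

lemma om_swap:
  assumes "Suc i < n"
  shows "om n k \<mu> (\<eta> \<circ> swp i (Suc i)) = om n k \<mu> \<eta>"
proof (cases "\<eta> i = \<eta> (Suc i)")
  case True
  hence "\<eta> \<circ> swp i (Suc i) = \<eta>" by (auto simp: swp_def)
  thus ?thesis by metis
next
  case False
  let ?s = "swp i (Suc i)"
  have "i < n" using assms by simp
  have "om n k \<mu> (\<eta> \<circ> ?s) = (\<Prod>j<n. pochhammer (\<mu> - k * real (rk n \<eta> (?s j))) (\<eta> (?s j)))"
    unfolding om_def using rk_swp[of i n \<eta>] assms False by (intro prod.cong) auto
  also have "\<dots> = om n k \<mu> \<eta>"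
    unfolding om_def using prod.permute[OF swp_permutes[OF \<open>i < n\<close> assms],
        of "\<lambda>j. pochhammer (\<mu> - k * real (rk n \<eta> j)) (\<eta> j)"] by simp
  finally show ?thesis .
qed

text \<open>The first entry keeps its rank and grows by 1, so its Pochhammer symbol gains one factor
  at the upper end.\<close>

lemma om_raise:
  assumes "0 < n"
  shows "om n k \<mu> (raise n \<kappa>) = om n k \<mu> \<kappa> * (\<mu> + ebar n k \<kappa> 0)"
proof -
  let ?f = "\<lambda>j. pochhammer (\<mu> - k * real (rk n \<kappa> j)) (\<kappa> j)"
  have "om n k \<mu> (raise n \<kappa>) = (\<Prod>j<n. pochhammer (\<mu> - k * real (rk n (raise n \<kappa>) (cyc n j))) (raise n \<kappa> (cyc n j)))"
    unfolding om_def using prod.permute[OF cyc_permutes[OF assms],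
        of "\<lambda>j. pochhammer (\<mu> - k * real (rk n (raise n \<kappa>) j)) (raise n \<kappa> j)"] by simp
  also have "\<dots> = (\<Prod>j<n. ?f j * (if j = 0 then \<mu> + ebar n k \<kappa> 0 else 1))"
    using assms by (intro prod.cong refl) (auto simp: rk_raise raise_nth pochhammer_Suc ebar_def)
  also have "\<dots> = om n k \<mu> \<kappa> * (\<mu> + ebar n k \<kappa> 0)"
    using assms by (simp add: prod.distrib om_def)
  finally show ?thesis .
qed

lemma supnorm_ge: "i < n \<Longrightarrow> cmod (z i) \<le> supnorm n z"
  unfolding supnorm_def by (intro Max_ge) auto

lemma supnorm_nonneg: "0 \<le> supnorm n z"
  unfolding supnorm_def by (intro Max_ge) auto

lemma norm_mon_le: "\<kappa> \<in> hom n m \<Longrightarrow> cmod (mon n \<kappa> z) \<le> supnorm n z ^ m"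
proof -
  assume h: "\<kappa> \<in> hom n m"
  have "cmod (mon n \<kappa> z) = (\<Prod>i<n. cmod (z i) ^ \<kappa> i)"
    by (simp add: Defs.mono_def norm_power flip: prod_norm)
  also have "\<dots> \<le> (\<Prod>i<n. supnorm n z ^ \<kappa> i)"
    by (intro prod_mono) (auto intro!: power_mono supnorm_ge)
  also have "\<dots> = supnorm n z ^ m" using h by (simp add: hom_def weight_def flip: power_sum)
  finally show ?thesis .
qed

context
  fixes n :: nat and k :: real
  assumes k: "0 \<le> k"
begin

lemma cjack_ex1:
  "\<exists>!c. (\<forall>\<eta>. \<eta> \<notin> multi n \<longrightarrow> c \<eta> = 0) \<and>
      (\<forall>m z. (\<Sum>i<n. z i) ^ m = (\<Sum>\<eta>\<in>hom n m. c \<eta> * JE n k \<eta> z))"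
proof (rule ex_ex1I)
  have "\<exists>b. \<forall>z. (\<Sum>i<n. z i) ^ m = (\<Sum>\<eta>\<in>hom n m. b \<eta> * JE n k \<eta> z)" for m
  proof -
    obtain a where "\<And>z. (\<Sum>i<n. z i) ^ m = pol n m a z" using power_sum_pol by blast
    thus ?thesis using pol_span[OF k] by presburger
  qed
  then obtain b where b: "\<And>m z. (\<Sum>i<n. z i) ^ m = (\<Sum>\<eta>\<in>hom n m. b m \<eta> * JE n k \<eta> z)" by metis
  define c where "c \<eta> = (if \<eta> \<in> multi n then b (weight n \<eta>) \<eta> else 0)" for \<eta>
  have "(\<Sum>i<n. z i) ^ m = (\<Sum>\<eta>\<in>hom n m. c \<eta> * JE n k \<eta> z)" for m z
    unfolding b by (intro sum.cong) (auto simp: c_def hom_def)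
  thus "\<exists>c. (\<forall>\<eta>. \<eta> \<notin> multi n \<longrightarrow> c \<eta> = 0) \<and>
      (\<forall>m z. (\<Sum>i<n. z i) ^ m = (\<Sum>\<eta>\<in>hom n m. c \<eta> * JE n k \<eta> z))"
    by (intro exI[of _ c]) (simp add: c_def)
next
  fix b c
  assume b: "(\<forall>\<eta>. \<eta> \<notin> multi n \<longrightarrow> b \<eta> = 0) \<and> (\<forall>m z. (\<Sum>i<n. z i) ^ m = (\<Sum>\<eta>\<in>hom n m. b \<eta> * JE n k \<eta> z))"
    and c: "(\<forall>\<eta>. \<eta> \<notin> multi n \<longrightarrow> c \<eta> = 0) \<and> (\<forall>m z. (\<Sum>i<n. z i) ^ m = (\<Sum>\<eta>\<in>hom n m. c \<eta> * JE n k \<eta> z))"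
  show "b = c"
  proof
    fix \<eta>
    show "b \<eta> = c \<eta>"
    proof (cases "\<eta> \<in> multi n")
      case True
      have "(\<Sum>\<eta>'\<in>hom n (weight n \<eta>). (b \<eta>' - c \<eta>') * JE n k \<eta>' x) = 0" for x
        using b c by (simp add: left_diff_distrib sum_subtractf)
      from JE_indep[OF k this multi_hom[OF True]] show ?thesis by simp
    qed (use b c in auto)
  qed
qed

lemma cjack_expand: "(\<Sum>i<n. z i) ^ m = (\<Sum>\<eta>\<in>hom n m. cjack n k \<eta> * JE n k \<eta> z)"
proof -
  have "(\<Sum>\<eta>\<in>{\<eta> \<in> multi n. weight n \<eta> = m}. c \<eta> * jackE n k \<eta> z) = (\<Sum>\<eta>\<in>hom n m. c \<eta> * JE n k \<eta> z)" for c m z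
    by (intro sum.cong) (auto simp: hom_def jackE_eq_JE[OF k])
  hence "cjack n k = (THE c. (\<forall>\<eta>. \<eta> \<notin> multi n \<longrightarrow> c \<eta> = 0) \<and>
      (\<forall>m z. (\<Sum>i<n. z i) ^ m = (\<Sum>\<eta>\<in>hom n m. c \<eta> * JE n k \<eta> z)))"
    unfolding cjack_def by presburger
  thus ?thesis using theI'[OF cjack_ex1] by metis
qed

text \<open>For an ascent this is \<open>JE_swap\<close> solved for the transposed polynomial. For a
  descent apply \<open>JE_swap\<close> to the exchanged composition, where \<open>\<gamma>\<close>
  changes sign, and eliminate; this causes the factor \<open>1 - \<gamma>\<^sup>2\<close>.\<close>

lemma JE_comp_swp:
  assumes "\<theta> \<in> multi n" "Suc i < n"
  defines "\<gamma> \<equiv> of_real (k / (ebar n k \<theta> (Suc i) - ebar n k \<theta> i)) :: complex"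
  shows "JE n k \<theta> (x \<circ> swp i (Suc i)) =
      (if \<theta> i = \<theta> (Suc i) then 1 else - \<gamma>) * JE n k \<theta> x +
      (if \<theta> i = \<theta> (Suc i) then 0 else if \<theta> i < \<theta> (Suc i) then 1 else 1 - \<gamma>\<^sup>2) * JE n k (\<theta> \<circ> swp i (Suc i)) x"
proof -
  let ?s = "swp i (Suc i)"
  have s: "?s i = Suc i" "?s (Suc i) = i" by (simp_all add: swp_def)
  consider "\<theta> i = \<theta> (Suc i)" | "\<theta> i < \<theta> (Suc i)" | "\<theta> (Suc i) < \<theta> i" by linarith
  thus ?thesis
  proof cases
    case 1
    thus ?thesis using JE_swap_eq[OF k assms(1,2)] by simp
  next
    case 2
    thus ?thesis using JE_swap[OF k assms(1,2), of x] by (simp add: \<gamma>_def)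
  next
    case 3
    let ?\<kappa> = "\<theta> \<circ> ?s"
    have \<kappa>: "?\<kappa> \<in> multi n" "?\<kappa> i < ?\<kappa> (Suc i)" using 3 assms multi_swp[of i n "Suc i" \<theta>] by (auto simp: s)
    have "ebar n k ?\<kappa> (Suc i) - ebar n k ?\<kappa> i = - (ebar n k \<theta> (Suc i) - ebar n k \<theta> i)"
      using ebar_swp[OF assms(2), of \<theta> k] 3 by (simp add: s)
    hence \<gamma>: "of_real (k / (ebar n k ?\<kappa> (Suc i) - ebar n k ?\<kappa> i)) = - \<gamma>"
      unfolding \<gamma>_def by (simp only: divide_minus_right of_real_minus)
    have A: "JE n k \<theta> y = JE n k ?\<kappa> (y \<circ> ?s) - \<gamma> * JE n k ?\<kappa> y" for y
      using JE_swap[OF k \<kappa>(1) assms(2) \<kappa>(2), of y] unfolding \<gamma> comp_swp_swp mult_minus_left add_uminus_conv_diff .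
    have "JE n k \<theta> (x \<circ> ?s) = JE n k ?\<kappa> x - \<gamma> * JE n k ?\<kappa> (x \<circ> ?s)"
      using A[of "x \<circ> ?s"] unfolding comp_swp_swp .
    moreover have "JE n k ?\<kappa> (x \<circ> ?s) = JE n k \<theta> x + \<gamma> * JE n k ?\<kappa> x" unfolding A[of x] by simp
    ultimately have "JE n k \<theta> (x \<circ> ?s) = - \<gamma> * JE n k \<theta> x + (1 - \<gamma>\<^sup>2) * JE n k ?\<kappa> x"
      by (simp only:) (simp add: algebra_simps power2_eq_square)
    thus ?thesis using 3 by simp
  qed
qed

text \<open>Compare the coefficients of E at the exchanged composition in the invariance of the
  power sum: it receives \<open>\<gamma>\<close> times its own coefficient and 1 times that of
  \<open>\<eta>\<close>.\<close>

lemma cjack_swap: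
  assumes "\<eta> \<in> multi n" "Suc i < n" "\<eta> i < \<eta> (Suc i)"
  shows "cjack n k \<eta> = of_real (1 - k / (ebar n k \<eta> (Suc i) - ebar n k \<eta> i)) * cjack n k (\<eta> \<circ> swp i (Suc i))"
proof -
  let ?s = "swp i (Suc i)"
  have s: "?s i = Suc i" "?s (Suc i) = i" by (simp_all add: swp_def)
  define m where "m = weight n \<eta>"
  have i: "i < n" using assms by simp
  have \<eta>: "\<eta> \<in> hom n m" using assms by (simp add: m_def hom_def)
  define \<gamma> where "\<gamma> \<theta> = (of_real (k / (ebar n k \<theta> (Suc i) - ebar n k \<theta> i)) :: complex)" for \<theta>
  define u where "u \<theta> = (if \<theta> i = \<theta> (Suc i) then 1 else - \<gamma> \<theta>)" for \<theta> :: "nat \<Rightarrow> nat"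
  define v where "v \<theta> = (if \<theta> i = \<theta> (Suc i) then 0 else if \<theta> i < \<theta> (Suc i) then 1 else 1 - (\<gamma> \<theta>)\<^sup>2)" for \<theta> :: "nat \<Rightarrow> nat"
  let ?c = "cjack n k"
  have eq: "JE n k \<theta> (x \<circ> ?s) = u \<theta> * JE n k \<theta> x + v \<theta> * JE n k (\<theta> \<circ> ?s) x" if "\<theta> \<in> hom n m" for \<theta> x
    using JE_comp_swp[OF hom_multi[OF that] assms(2), of x] by (simp add: u_def v_def \<gamma>_def)
  have "(\<Sum>\<theta>\<in>hom n m. (?c \<theta> * u \<theta> + ?c (\<theta> \<circ> ?s) * v (\<theta> \<circ> ?s) - ?c \<theta>) * JE n k \<theta> x) = 0" for x
  proof -
    have "(\<Sum>l<n. (x \<circ> ?s) l) = (\<Sum>l<n. x l)"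
      using sum.permute[OF swp_permutes[OF i assms(2)], of x] by simp
    hence "(\<Sum>\<theta>\<in>hom n m. ?c \<theta> * JE n k \<theta> x) = (\<Sum>\<theta>\<in>hom n m. ?c \<theta> * JE n k \<theta> (x \<circ> ?s))"
      using cjack_expand by metis
    also have "\<dots> = (\<Sum>\<theta>\<in>hom n m. ?c \<theta> * u \<theta> * JE n k \<theta> x) + (\<Sum>\<theta>\<in>hom n m. ?c \<theta> * v \<theta> * JE n k (\<theta> \<circ> ?s) x)"
      unfolding sum.distrib[symmetric] by (intro sum.cong refl) (simp add: eq algebra_simps)
    also have "(\<Sum>\<theta>\<in>hom n m. ?c \<theta> * v \<theta> * JE n k (\<theta> \<circ> ?s) x) =
        (\<Sum>\<theta>\<in>hom n m. ?c (\<theta> \<circ> ?s) * v (\<theta> \<circ> ?s) * JE n k \<theta> x)"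
      using sum_hom_swp[OF i assms(2), of "\<lambda>\<theta>. ?c \<theta> * v \<theta> * JE n k (\<theta> \<circ> ?s) x" m]
      unfolding comp_swp_swp by simp
    finally show ?thesis by (simp add: algebra_simps sum.distrib sum_subtractf)
  qed
  moreover have \<eta>s: "\<eta> \<circ> ?s \<in> hom n m" using \<eta> i assms(2) by simp
  ultimately have "?c (\<eta> \<circ> ?s) * u (\<eta> \<circ> ?s) + ?c (\<eta> \<circ> ?s \<circ> ?s) * v (\<eta> \<circ> ?s \<circ> ?s) - ?c (\<eta> \<circ> ?s) = 0"
    using JE_indep[OF k, where b = "\<lambda>\<theta>. ?c \<theta> * u \<theta> + ?c (\<theta> \<circ> ?s) * v (\<theta> \<circ> ?s) - ?c \<theta>"] by blast
  moreover have "u (\<eta> \<circ> ?s) = \<gamma> \<eta>"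
  proof -
    have "ebar n k (\<eta> \<circ> ?s) (Suc i) - ebar n k (\<eta> \<circ> ?s) i = - (ebar n k \<eta> (Suc i) - ebar n k \<eta> i)"
      using ebar_swp[OF assms(2), of \<eta> k] assms(3) by (simp add: s)
    hence "\<gamma> (\<eta> \<circ> ?s) = - \<gamma> \<eta>" unfolding \<gamma>_def by (simp only: divide_minus_right of_real_minus)
    thus ?thesis using assms(3) by (simp add: u_def s)
  qed
  moreover have "v \<eta> = 1" using assms(3) by (simp add: v_def)
  ultimately have "?c (\<eta> \<circ> ?s) * \<gamma> \<eta> + ?c \<eta> - ?c (\<eta> \<circ> ?s) = 0" unfolding comp_swp_swp by simp
  thus ?thesis by (simp add: \<gamma>_def algebra_simps)
qed

text \<open>The last operator is applied to the power \<open>Suc m\<close> of the coordinate sum,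
  once diagonally in the basis and once by \<open>cherD_power_sum\<close>. There x_n e^m is the
  raising operator applied to e^m, as e is symmetric. The coefficients of E at
  \<open>raise n \<kappa>\<close> are compared.\<close>

lemma cjack_raise:
  assumes "0 < n" "\<kappa> \<in> hom n m"
  shows "cjack n k (raise n \<kappa>) * of_real (ebar n k \<kappa> 0 + 1 + k * (real n - 1)) = of_nat (Suc m) * cjack n k \<kappa>"
proof -
  let ?c = "cjack n k"
  define b where "b \<eta> = (if \<eta> (n - 1) = 0 then 0 else ?c (lower n \<eta>))" for \<eta>
  have br: "b (raise n \<theta>) = ?c \<theta>" if "\<theta> \<in> hom n m" for \<theta>
  proof -
    have "raise n \<theta> (n - 1) \<noteq> 0" using assms(1) by (simp add: raise_def)
    thus ?thesis using lower_raise[OF assms(1) hom_multi[OF that]] by (simp add: b_def)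
  qed
  have "(\<Sum>\<eta>\<in>hom n (Suc m). (?c \<eta> * of_real (ebar n k \<eta> (n - 1) + k * (real n - 1)) - of_nat (Suc m) * b \<eta>) * JE n k \<eta> x) = 0"
    if x: "x \<in> generic n" for x
  proof -
    have e: "(\<lambda>x. (\<Sum>i<n. x i) ^ Suc m) = (\<lambda>x. \<Sum>\<eta>\<in>hom n (Suc m). ?c \<eta> * JE n k \<eta> x)"
      using cjack_expand by blast
    have "(\<Sum>i<n. (x \<circ> cyc n) i) = (\<Sum>i<n. x i)"
      using sum.permute[OF cyc_permutes[OF assms(1)], of x] by simp
    hence "x (n - 1) * (\<Sum>i<n. x i) ^ m = x (n - 1) * (\<Sum>\<theta>\<in>hom n m. ?c \<theta> * JE n k \<theta> (x \<circ> cyc n))"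
      using cjack_expand by metis
    also have "\<dots> = (\<Sum>\<theta>\<in>hom n m. b (raise n \<theta>) * JE n k (raise n \<theta>) x)"
      unfolding sum_distrib_left
      by (intro sum.cong refl) (simp add: br JE_raise[OF k assms(1)] hom_multi)
    also have "\<dots> = (\<Sum>\<eta>\<in>hom n (Suc m). b \<eta> * JE n k \<eta> x)"
      by (rule sum_hom_raise[OF assms(1), symmetric]) (simp add: b_def)
    finally have r: "x (n - 1) * (\<Sum>i<n. x i) ^ m = (\<Sum>\<eta>\<in>hom n (Suc m). b \<eta> * JE n k \<eta> x)" .
    have "n - 1 < n" using assms(1) by simp
    from cherD_JE_sum[OF k this x, of ?c "Suc m"]
    have "(\<Sum>\<eta>\<in>hom n (Suc m). ?c \<eta> * of_real (ebar n k \<eta> (n - 1)) * JE n k \<eta> x) =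
        of_nat (Suc m) * (x (n - 1) * (\<Sum>i<n. x i) ^ m) + of_real (k * (1 - real n)) * (\<Sum>i<n. x i) ^ Suc m"
      unfolding e[symmetric] cherD_power_sum[OF assms(1)] by simp
    also have "\<dots> = of_nat (Suc m) * (\<Sum>\<eta>\<in>hom n (Suc m). b \<eta> * JE n k \<eta> x) +
        of_real (k * (1 - real n)) * (\<Sum>\<eta>\<in>hom n (Suc m). ?c \<eta> * JE n k \<eta> x)"
      unfolding r using cjack_expand by metis
    finally show ?thesis
      by (simp add: algebra_simps sum.distrib sum_subtractf sum_distrib_left)
  qed
  from JE_indep[OF k this raise_hom[OF assms]]
  show ?thesis using br[OF assms(2)] ebar_raise_last[OF assms(1), of k \<kappa>] by simp
qed

text \<open>Ranks are at most n - 1, so the number is at least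
  \<open>\<kappa> 0 + 1\<close>.\<close>

lemma ebar_shift_pos:
  assumes "0 < n"
  shows "0 < ebar n k \<kappa> 0 + 1 + k * (real n - 1)"
proof -
  have "real (rk n \<kappa> 0) \<le> real n - 1" using rk_lt[OF assms, of \<kappa>] by linarith
  from mult_left_mono[OF this k] show ?thesis by (simp add: ebar_def)
qed

lemma cjack_nonneg: "\<eta> \<in> multi n \<Longrightarrow> cjack n k \<eta> \<in> \<real>\<^sub>\<ge>\<^sub>0"
proof (induction rule: multi_induct)
  case zero
  have "cjack n k (\<lambda>_. 0) = 1" using cjack_expand[of "\<lambda>_. 0" 0] by (simp add: JE_zero[OF k])
  thus ?case by simp
next
  case (raise \<kappa>)
  let ?d = "ebar n k \<kappa> 0 + 1 + k * (real n - 1)"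
  have "cjack n k (raise n \<kappa>) * of_real ?d = of_nat (Suc (weight n \<kappa>)) * cjack n k \<kappa>"
    by (rule cjack_raise[OF raise(1) multi_hom[OF raise(2)]])
  moreover have "complex_of_real ?d \<noteq> 0"
    using ebar_shift_pos[OF raise(1), of \<kappa>] by (metis less_irrefl of_real_eq_0_iff)
  ultimately have "cjack n k (raise n \<kappa>) = of_nat (Suc (weight n \<kappa>)) * cjack n k \<kappa> / of_real ?d"
    by (metis nonzero_eq_divide_eq)
  also have "\<dots> = of_real (Suc (weight n \<kappa>) / ?d) * cjack n k \<kappa>"
    by (simp only: of_real_divide of_real_of_nat_eq times_divide_eq_left)
  also have "\<dots> \<in> \<real>\<^sub>\<ge>\<^sub>0"
    using ebar_shift_pos[OF raise(1), of \<kappa>]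
    by (intro nonneg_Reals_mult_I raise(3), subst nonneg_Reals_of_real_iff) simp
  finally show ?case .
next
  case (swap \<kappa> i)
  define d where "d = ebar n k \<kappa> (Suc i) - ebar n k \<kappa> i"
  have d: "1 + k \<le> d" unfolding d_def using ebar_diff_less[OF k] swap by blast
  \<comment> \<open>\<open>cjack_swap\<close> is used backwards, so one divides by this number; the
    gap of an ascent makes it positive.\<close>
  hence r: "0 < 1 - k / d" using k by (simp add: field_simps)
  have "cjack n k \<kappa> = of_real (1 - k / d) * cjack n k (\<kappa> \<circ> swp i (Suc i))"
    unfolding d_def by (rule cjack_swap[OF swap(1-3)])
  moreover have "of_real (1 / (1 - k / d)) * complex_of_real (1 - k / d) = 1"
    unfolding of_real_mult[symmetric] using r by (metis nonzero_eq_divide_eq less_irrefl of_real_1)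
  ultimately have "cjack n k (\<kappa> \<circ> swp i (Suc i)) = of_real (1 / (1 - k / d)) * cjack n k \<kappa>"
    by (metis mult.assoc mult_1)
  also have "\<dots> \<in> \<real>\<^sub>\<ge>\<^sub>0" using r by (intro nonneg_Reals_mult_I swap(4), subst nonneg_Reals_of_real_iff) simp
  finally show ?case .
qed

section \<open>Values at the point (1, ..., 1)\<close>

lemma JE_one: "\<eta> \<in> hom n m \<Longrightarrow> JE n k \<eta> (one_vec n) = (\<Sum>\<kappa>\<in>hom n m. jc n k \<eta> \<kappa>)"
  by (simp add: JE_hom[OF k] pol_def Defs.mono_def one_vec_def)

lemma jackL_one:
  assumes "\<eta> \<in> multi n"
  shows "jackL n k \<eta> (one_vec n) = of_real (ell n k \<eta>)" "0 \<le> ell n k \<eta>"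
proof -
  have "JE n k \<eta> (one_vec n) \<in> \<real>\<^sub>\<ge>\<^sub>0"
  proof -
    have "Im (jc n k \<eta> \<kappa>) = 0 \<and> 0 \<le> Re (jc n k \<eta> \<kappa>)" if "\<kappa> \<in> hom n (weight n \<eta>)" for \<kappa>
      using jc_nonneg[OF k multi_hom[OF assms] that] by (simp add: complex_nonneg_Reals_iff)
    thus ?thesis unfolding JE_one[OF multi_hom[OF assms]]
      by (simp add: complex_nonneg_Reals_iff Re_sum Im_sum sum_nonneg)
  qed
  hence "jackL n k \<eta> (one_vec n) \<in> \<real>\<^sub>\<ge>\<^sub>0"
    unfolding jackL_def jackE_eq_JE[OF k assms] using cjack_nonneg[OF assms] by (rule nonneg_Reals_mult_I[rotated])
  thus "jackL n k \<eta> (one_vec n) = of_real (ell n k \<eta>)" "0 \<le> ell n k \<eta>"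
    by (auto simp: ell_def complex_nonneg_Reals_iff complex_eq_iff)
qed

lemma ell_eq: "\<eta> \<in> multi n \<Longrightarrow> of_real (ell n k \<eta>) = cjack n k \<eta> * JE n k \<eta> (one_vec n)"
  by (metis jackL_def jackL_one(1) jackE_eq_JE[OF k])

text \<open>As all coefficients are nonnegative, the triangle inequality over the monomials yields
  exactly the value at \<open>one_vec n\<close>.\<close>

lemma norm_jackL_le:
  assumes "\<eta> \<in> hom n m"
  shows "cmod (jackL n k \<eta> z) \<le> supnorm n z ^ m * ell n k \<eta>"
proof -
  have J: "cmod (jc n k \<eta> \<kappa>) = Re (jc n k \<eta> \<kappa>)" if "\<kappa> \<in> hom n m" for \<kappa>
    using jc_nonneg[OF k assms that] by (auto simp: complex_nonneg_Reals_iff cmod_eq_Re)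
  have c: "cjack n k \<eta> = of_real (cmod (cjack n k \<eta>))"
    using cjack_nonneg[OF hom_multi[OF assms]] by (auto simp: complex_nonneg_Reals_iff cmod_eq_Re complex_eq_iff)
  have "cmod (JE n k \<eta> z) \<le> (\<Sum>\<kappa>\<in>hom n m. cmod (jc n k \<eta> \<kappa> * mon n \<kappa> z))"
    unfolding JE_hom[OF k assms] pol_def by (rule norm_sum)
  also have "\<dots> \<le> (\<Sum>\<kappa>\<in>hom n m. Re (jc n k \<eta> \<kappa>) * supnorm n z ^ m)"
    unfolding norm_mult using J by (intro sum_mono mult_mono norm_mon_le) (auto simp flip: J)
  also have "\<dots> = Re (JE n k \<eta> (one_vec n)) * supnorm n z ^ m"
    by (simp add: JE_one[OF assms] Re_sum sum_distrib_right)
  finally have "cmod (cjack n k \<eta>) * cmod (JE n k \<eta> z) \<le>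
      cmod (cjack n k \<eta>) * (Re (JE n k \<eta> (one_vec n)) * supnorm n z ^ m)"
    by (intro mult_left_mono) auto
  also have "\<dots> = supnorm n z ^ m * (cmod (cjack n k \<eta>) * Re (JE n k \<eta> (one_vec n)))" by simp
  also have "cmod (cjack n k \<eta>) * Re (JE n k \<eta> (one_vec n)) = Re (of_real (ell n k \<eta>))"
    unfolding ell_eq[OF hom_multi[OF assms]] by (subst (2) c) simp
  finally show ?thesis
    using hom_multi[OF assms] by (simp add: jackL_def jackE_eq_JE[OF k] norm_mult)
qed

lemma sum_ell: "(\<Sum>\<eta>\<in>hom n m. ell n k \<eta>) = real n ^ m"
proof -
  have "of_real (\<Sum>\<eta>\<in>hom n m. ell n k \<eta>) = (\<Sum>\<eta>\<in>hom n m. cjack n k \<eta> * JE n k \<eta> (one_vec n))"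
    unfolding of_real_sum by (intro sum.cong refl ell_eq hom_multi)
  also have "\<dots> = (\<Sum>i<n. one_vec n i) ^ m" by (rule cjack_expand[symmetric])
  also have "\<dots> = of_real (real n ^ m)" by (simp add: one_vec_def)
  finally show ?thesis by (simp only: of_real_eq_iff)
qed

section \<open>Moments of the spectrum and the binomial formula\<close>

lemma ell_raise:
  assumes "0 < n" "\<kappa> \<in> hom n m"
  shows "ell n k (raise n \<kappa>) * (ebar n k \<kappa> 0 + 1 + k * (real n - 1)) = real (Suc m) * ell n k \<kappa>"
proof -
  have one: "one_vec n \<circ> cyc n = one_vec n" using assms(1) by (auto simp: one_vec_def cyc_def fun_eq_iff)
  have "JE n k (raise n \<kappa>) (one_vec n) = one_vec n (n - 1) * JE n k \<kappa> (one_vec n)"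
    using JE_raise[OF k assms(1) hom_multi[OF assms(2)], of "one_vec n"] unfolding one .
  also have "one_vec n (n - 1) = 1" using assms(1) by (simp add: one_vec_def)
  finally have "JE n k (raise n \<kappa>) (one_vec n) = JE n k \<kappa> (one_vec n)" by simp
  hence "complex_of_real (ell n k (raise n \<kappa>) * (ebar n k \<kappa> 0 + 1 + k * (real n - 1))) = of_real (real (Suc m) * ell n k \<kappa>)"
    unfolding of_real_mult ell_eq[OF raise_multi[OF assms(1)]] ell_eq[OF hom_multi[OF assms(2)]]
    using cjack_raise[OF assms] by (simp add: mult_ac) 
  thus ?thesis by (simp only: of_real_eq_iff)
qed

text \<open>The value of E at (1, ..., 1) gains the factor 1 + k / d and the coefficient of E is
  divided by 1 - k / d; clearing denominators leaves \<open>d + k\<close> and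
  \<open>d - k\<close>.\<close>

lemma ell_swap:
  assumes "\<eta> \<in> multi n" "Suc i < n" "\<eta> i < \<eta> (Suc i)"
  defines "d \<equiv> ebar n k \<eta> (Suc i) - ebar n k \<eta> i"
  shows "ell n k (\<eta> \<circ> swp i (Suc i)) * (d - k) = (d + k) * ell n k \<eta>"
proof -
  let ?s = "swp i (Suc i)"
  have d: "1 + k \<le> d" unfolding d_def using ebar_diff_less[OF k] assms by blast
  hence d0: "d \<noteq> 0" using k by simp
  have m: "\<eta> \<circ> ?s \<in> multi n" using multi_swp[of i n "Suc i"] assms by simp
  have one: "one_vec n \<circ> ?s = one_vec n" using assms(2) by (auto simp: one_vec_def swp_def)
  have J: "JE n k (\<eta> \<circ> ?s) (one_vec n) = of_real (1 + k / d) * JE n k \<eta> (one_vec n)"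
    using JE_swap[OF k assms(1-3), of "one_vec n"] unfolding one d_def[symmetric] by (simp add: algebra_simps)
  have c: "cjack n k \<eta> = of_real (1 - k / d) * cjack n k (\<eta> \<circ> ?s)"
    unfolding d_def by (rule cjack_swap[OF assms(1-3)])
  have "complex_of_real (ell n k (\<eta> \<circ> ?s) * (1 - k / d)) = of_real ((1 + k / d) * ell n k \<eta>)"
    unfolding of_real_mult ell_eq[OF m] ell_eq[OF assms(1)] J c by simp
  hence "ell n k (\<eta> \<circ> ?s) * (1 - k / d) = (1 + k / d) * ell n k \<eta>" by (simp only: of_real_eq_iff)
  hence "d * (ell n k (\<eta> \<circ> ?s) * (1 - k / d)) = d * ((1 + k / d) * ell n k \<eta>)" by simp
  thus ?thesis using d0 by (simp add: algebra_simps)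
qed

text \<open>The terms of \<open>\<eta>\<close> and of its exchange cancel: for an ascent with gap d
  the brackets are - (d + k) and d - k, \<open>ell_swap\<close> balances them, and \<open>om\<close>
  does not change. For equal neighbours the bracket itself is 0.\<close>

lemma moment_diff:
  assumes "Suc i < n"
  shows "(\<Sum>\<eta>\<in>hom n m. om n k \<mu> \<eta> * ell n k \<eta> * (ebar n k \<eta> i - ebar n k \<eta> (Suc i) - k)) = 0"
proof -
  let ?s = "swp i (Suc i)"
  have i: "i < n" using assms by simp
  have s: "?s i = Suc i" "?s (Suc i) = i" by (simp_all add: swp_def)
  define F where "F \<eta> = om n k \<mu> \<eta> * ell n k \<eta> * (ebar n k \<eta> i - ebar n k \<eta> (Suc i) - k)" for \<eta>
  have lt: "F \<eta> + F (\<eta> \<circ> ?s) = 0" if "\<eta> \<in> multi n" "\<eta> i < \<eta> (Suc i)" for \<eta>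
  proof -
    define d where "d = ebar n k \<eta> (Suc i) - ebar n k \<eta> i"
    have "ebar n k (\<eta> \<circ> ?s) i - ebar n k (\<eta> \<circ> ?s) (Suc i) - k = d - k"
      using ebar_swp[OF assms, of \<eta> k] that(2) by (simp add: s d_def)
    hence "F (\<eta> \<circ> ?s) = om n k \<mu> \<eta> * (ell n k (\<eta> \<circ> ?s) * (d - k))"
      unfolding F_def om_swap[OF assms] by (simp only: mult.assoc)
    also have "ell n k (\<eta> \<circ> ?s) * (d - k) = (d + k) * ell n k \<eta>"
      using ell_swap[OF that(1) assms that(2)] by (simp only: d_def)
    finally have Fs: "F (\<eta> \<circ> ?s) = om n k \<mu> \<eta> * ((d + k) * ell n k \<eta>)" .
    show ?thesis unfolding Fs F_def[of \<eta>] by (simp add: d_def algebra_simps)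
  qed
  have "F \<eta> + F (\<eta> \<circ> ?s) = 0" if \<eta>: "\<eta> \<in> multi n" for \<eta>
  proof -
    consider "\<eta> i = \<eta> (Suc i)" | "\<eta> i < \<eta> (Suc i)" | "\<eta> (Suc i) < \<eta> i" by linarith
    thus ?thesis
    proof cases
      case 1
      have e: "\<eta> \<circ> ?s = \<eta>" using 1 by (auto simp: swp_def)
      have "F \<eta> = 0" using ebar_Suc_eq[OF assms 1, of k] by (simp add: F_def)
      thus ?thesis unfolding e by simp
    next
      case 2
      thus ?thesis using lt \<eta> by blast
    next
      case 3
      have "F (\<eta> \<circ> ?s) + F (\<eta> \<circ> ?s \<circ> ?s) = 0"
        by (rule lt) (use 3 \<eta> multi_swp[OF i assms] s in auto)
      thus ?thesis unfolding comp_swp_swp by simp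
    qed
  qed
  hence "(\<Sum>\<eta>\<in>hom n m. F \<eta> + F (\<eta> \<circ> ?s)) = 0" using hom_multi by (simp add: sum.neutral)
  hence "(\<Sum>\<eta>\<in>hom n m. F \<eta>) + (\<Sum>\<eta>\<in>hom n m. F (\<eta> \<circ> ?s)) = 0" unfolding sum.distrib .
  hence "(\<Sum>\<eta>\<in>hom n m. F \<eta>) = 0" unfolding sum_hom_swp[OF i assms, of F] by simp
  thus ?thesis by (simp add: F_def)
qed

text \<open>By \<open>moment_diff\<close> the sum is the same for every \<open>j\<close>. Added up
  over \<open>j\<close>, the bracket equals \<open>m\<close> for each composition, because ranks and
  positions have the same sum; so each sum carries the share m / n.\<close>

lemma moment:
  assumes "j < n"
  shows "real n * (\<Sum>\<eta>\<in>hom n m. om n k \<mu> \<eta> * ell n k \<eta> * (ebar n k \<eta> j + k * real j)) =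
    real m * (\<Sum>\<eta>\<in>hom n m. om n k \<mu> \<eta> * ell n k \<eta>)"
proof -
  define w where "w \<eta> = om n k \<mu> \<eta> * ell n k \<eta>" for \<eta>
  define S where "S j = (\<Sum>\<eta>\<in>hom n m. w \<eta> * (ebar n k \<eta> j + k * real j))" for j
  have "S j = S 0" if "j < n" for j
    using that
  proof (induction j)
    case (Suc j)
    have "S j - S (Suc j) = (\<Sum>\<eta>\<in>hom n m. w \<eta> * (ebar n k \<eta> j - ebar n k \<eta> (Suc j) - k))"
      unfolding S_def sum_subtractf[symmetric] by (intro sum.cong refl) (simp add: algebra_simps)
    also have "\<dots> = 0" unfolding w_def by (rule moment_diff[OF Suc.prems])
    finally show ?case using Suc by simp
  qed simp
  hence "S i = S j" if "i < n" for i using that assms by metis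
  hence "(\<Sum>i<n. S i) = (\<Sum>i<n. S j)" by (intro sum.cong refl) blast
  hence "(\<Sum>i<n. S i) = real n * S j" by simp
  moreover have "(\<Sum>i<n. S i) = (\<Sum>\<eta>\<in>hom n m. w \<eta> * (\<Sum>i<n. ebar n k \<eta> i + k * real i))"
    unfolding S_def by (subst sum.swap) (simp add: sum_distrib_left)
  moreover have "(\<Sum>i<n. ebar n k \<eta> i + k * real i) = real m" if "\<eta> \<in> hom n m" for \<eta>
  proof -
    have "(\<Sum>i<n. ebar n k \<eta> i + k * real i) =
        real (\<Sum>i<n. \<eta> i) - k * real (\<Sum>i<n. rk n \<eta> i) + k * real (\<Sum>i<n. i)"
      by (simp add: ebar_def sum.distrib sum_subtractf sum_distrib_left)
    moreover have "(\<Sum>i<n. \<eta> i) = m" using that by (simp add: hom_def weight_def)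
    ultimately show ?thesis unfolding sum_rk[OF hom_multi[OF that]] by simp
  qed
  ultimately show ?thesis by (simp add: S_def w_def sum_distrib_left mult_ac)
qed

text \<open>The value at \<open>(1,\<dots>,1)\<close> of the binomial series \<open>\<Prod>\<^sub>i (1 - z\<^sub>i) powr - \<mu>\<close>, in degree \<open>m\<close>.\<close>

lemma sum_om_ell: "(\<Sum>\<eta>\<in>hom n m. om n k \<mu> \<eta> * ell n k \<eta>) = pochhammer (real n * \<mu>) m"
proof (cases "n = 0")
  case True
  have "hom 0 (Suc m) = {}" for m by (auto simp: hom_def weight_def)
  moreover have "(\<Sum>\<eta>\<in>hom 0 0. om 0 k \<mu> \<eta> * ell 0 k \<eta>) = 1"
    using sum_ell[of 0] True by (simp add: om_def)
  ultimately show ?thesis using True by (cases m) (auto simp: pochhammer_rec)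
next
  case False
  hence n: "0 < n" by simp
  define T where "T m = (\<Sum>\<eta>\<in>hom n m. om n k \<mu> \<eta> * ell n k \<eta>)" for m
  have "T (Suc m) = (real n * \<mu> + real m) * T m" for m
  proof -
    \<comment> \<open>The shift makes the bracket vanish whenever the last entry is 0, so the sum
      runs over raised compositions; on these the bracket is the factor in
      \<open>ell_raise\<close>.\<close>
    let ?F = "\<lambda>\<eta>. om n k \<mu> \<eta> * ell n k \<eta> * (ebar n k \<eta> (n - 1) + k * real (n - 1))"
    have "(\<Sum>\<eta>\<in>hom n (Suc m). ?F \<eta>) = (\<Sum>\<kappa>\<in>hom n m. ?F (raise n \<kappa>))"
      by (rule sum_hom_raise[OF n]) (simp add: ebar_def rk_last[OF n, unfolded One_nat_def])
    also have "\<dots> = (\<Sum>\<kappa>\<in>hom n m. real (Suc m) * (\<mu> * (om n k \<mu> \<kappa> * ell n k \<kappa>) + om n k \<mu> \<kappa> * ell n k \<kappa> * (ebar n k \<kappa> 0 + k * real 0)))"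
    proof (intro sum.cong refl)
      fix \<kappa> assume \<kappa>: "\<kappa> \<in> hom n m"
      have "?F (raise n \<kappa>) = om n k \<mu> (raise n \<kappa>) * (ell n k (raise n \<kappa>) * (ebar n k \<kappa> 0 + 1 + k * (real n - 1)))"
        unfolding ebar_raise_last[OF n] using n by (simp add: of_nat_diff)
      also have "\<dots> = om n k \<mu> \<kappa> * (\<mu> + ebar n k \<kappa> 0) * (real (Suc m) * ell n k \<kappa>)"
        unfolding ell_raise[OF n \<kappa>] om_raise[OF n] ..
      finally show "?F (raise n \<kappa>) = real (Suc m) * (\<mu> * (om n k \<mu> \<kappa> * ell n k \<kappa>) + om n k \<mu> \<kappa> * ell n k \<kappa> * (ebar n k \<kappa> 0 + k * real 0))"
        by (simp add: algebra_simps)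
    qed
    also have "\<dots> = real (Suc m) * (\<mu> * T m + (\<Sum>\<kappa>\<in>hom n m. om n k \<mu> \<kappa> * ell n k \<kappa> * (ebar n k \<kappa> 0 + k * real 0)))"
      by (simp only: sum_distrib_left[symmetric] sum.distrib T_def)
    finally have 1: "(\<Sum>\<eta>\<in>hom n (Suc m). ?F \<eta>) =
      real (Suc m) * (\<mu> * T m + (\<Sum>\<kappa>\<in>hom n m. om n k \<mu> \<kappa> * ell n k \<kappa> * (ebar n k \<kappa> 0 + k * real 0)))" .
    have "n - 1 < n" using n by simp
    \<comment> \<open>The moment of the last position in degree \<open>Suc m\<close> and that of
      position 0 in degree \<open>m\<close> eliminate the spectrum and leave the factor n \<mu> +
      m.\<close>
    from moment[OF this, where m = "Suc m"] have 2: "real n * (\<Sum>\<eta>\<in>hom n (Suc m). ?F \<eta>) = real (Suc m) * T (Suc m)"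
      by (simp only: T_def)
    have 3: "real n * (\<Sum>\<kappa>\<in>hom n m. om n k \<mu> \<kappa> * ell n k \<kappa> * (ebar n k \<kappa> 0 + k * real 0)) = real m * T m"
      unfolding T_def by (rule moment[OF n])
    have "real (Suc m) * T (Suc m) = real (Suc m) * ((real n * \<mu> + real m) * T m)"
    proof -
      have "a * (b * (c * d + e)) = b * ((a * c + f) * d)" if "a * e = f * d" for a b c d e f :: real
        using that by algebra
      thus ?thesis unfolding 2[symmetric] 1 using 3 by blast
    qed
    thus ?thesis by simp
  qed
  moreover have "T 0 = 1" using sum_ell[of 0] by (simp add: T_def om_def)
  ultimately have "T m = pochhammer (real n * \<mu>) m"
    by (induction m) (simp_all add: pochhammer_Suc)
  thus ?thesis by (simp add: T_def)
qed

end

section \<open>Separately holomorphic functions and series\<close>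

lemma holo2_mult: "holo2 a b U F \<Longrightarrow> holo2 a b U G \<Longrightarrow> holo2 a b U (\<lambda>z w. F z w * G z w)"
  unfolding holo2_def case_prod_beta
  by (auto intro!: continuous_intros field_differentiable_mult)

lemma holo2_divide:
  assumes "holo2 a b U F" "holo2 a b U G" "\<And>z w. (z, w) \<in> U \<Longrightarrow> G z w \<noteq> 0"
  shows "holo2 a b U (\<lambda>z w. F z w / G z w)"
  using assms unfolding holo2_def case_prod_beta
  by (auto intro!: continuous_intros field_differentiable_divide)

lemma holo2_left:
  assumes "U \<subseteq> cvec a \<times> cvec b" "continuous_on UNIV P" "sephol P"
  shows "holo2 a b U (\<lambda>z w. P z)"
proof -
  have "continuous_on U (\<lambda>p. P (fst p))"
    by (rule continuous_on_compose2[OF assms(2)]) (auto intro: continuous_intros)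
  moreover have "(\<lambda>t. P (z(i := t))) field_differentiable at (z i)" for z i
    using assms(3) holomorphic_on_imp_differentiable_at[OF _ open_UNIV] by (auto simp: sephol_def)
  ultimately show ?thesis using assms(1) by (auto simp: holo2_def case_prod_beta)
qed

lemma holo2_right:
  assumes "U \<subseteq> cvec a \<times> cvec b" "continuous_on UNIV P" "sephol P"
  shows "holo2 a b U (\<lambda>z w. P w)"
proof -
  have "continuous_on U (\<lambda>p. P (snd p))"
    by (rule continuous_on_compose2[OF assms(2)]) (auto intro: continuous_intros)
  moreover have "(\<lambda>t. P (z(i := t))) field_differentiable at (z i)" for z i
    using assms(3) holomorphic_on_imp_differentiable_at[OF _ open_UNIV] by (auto simp: sephol_def)
  ultimately show ?thesis using assms(1) by (auto simp: holo2_def case_prod_beta)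
qed

lemma open_box:
  fixes z0 w0 :: "nat \<Rightarrow> complex"
  shows "open {(z, w). (\<forall>i<a. dist (z i) (z0 i) < e) \<and> (\<forall>i<b. dist (w i) (w0 i) < e)}"
proof -
  have 1: "open {p :: (nat \<Rightarrow> complex) \<times> (nat \<Rightarrow> complex). dist (fst p i) (z0 i) < e}" for i
    by (intro open_Collect_less continuous_on_dist continuous_on_const
        continuous_on_product_then_coordinatewise[OF continuous_on_fst[OF continuous_on_id]])
  have 2: "open {p :: (nat \<Rightarrow> complex) \<times> (nat \<Rightarrow> complex). dist (snd p i) (w0 i) < e}" for i
    by (intro open_Collect_less continuous_on_dist continuous_on_const
        continuous_on_product_then_coordinatewise[OF continuous_on_snd[OF continuous_on_id]])
  have "{(z, w). (\<forall>i<a. dist (z i) (z0 i) < e) \<and> (\<forall>i<b. dist (w i) (w0 i) < e)} =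
      (\<Inter>i<a. {p. dist (fst p i) (z0 i) < e}) \<inter> (\<Inter>i<b. {p. dist (snd p i) (w0 i) < e})"
    by auto
  thus ?thesis using 1 2 by (auto intro!: open_Int open_INT)
qed

lemma cvec_upd: "i < d \<Longrightarrow> z \<in> cvec d \<Longrightarrow> z(i := t) \<in> cvec d"
  by (auto simp: cvec_def)

lemma holomorphic_infsum:
  fixes f :: "'i \<Rightarrow> complex \<Rightarrow> complex"
  assumes "0 < e" "M summable_on I"
    and "\<And>\<eta> t. \<eta> \<in> I \<Longrightarrow> t \<in> ball z e \<Longrightarrow> f \<eta> field_differentiable at t"
    and "\<And>\<eta> t. \<eta> \<in> I \<Longrightarrow> t \<in> ball z e \<Longrightarrow> cmod (f \<eta> t) \<le> M \<eta>"
  shows "(\<lambda>t. infsum (\<lambda>\<eta>. f \<eta> t) I) field_differentiable at z"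
proof -
  have hol: "f \<eta> holomorphic_on ball z e" if "\<eta> \<in> I" for \<eta>
    using assms(3)[OF that] by (auto simp: holomorphic_on_def intro: field_differentiable_at_within)
  \<comment> \<open>Half the radius provides a closed disc inside the ball, since the limit theorem
    asks for continuity up to the boundary.\<close>
  have sub: "cball z (e / 2) \<subseteq> ball z e" using assms(1) by auto
  have ul: "uniform_limit (cball z (e / 2)) (\<lambda>X t. \<Sum>\<eta>\<in>X. f \<eta> t) (\<lambda>t. infsum (\<lambda>\<eta>. f \<eta> t) I) (finite_subsets_at_top I)"
    by (rule Weierstrass_m_test_general[OF _ assms(2)]) (use assms(4) sub in blast)
  have "eventually (\<lambda>X. continuous_on (cball z (e / 2)) (\<lambda>t. \<Sum>\<eta>\<in>X. f \<eta> t) \<and>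
      (\<lambda>t. \<Sum>\<eta>\<in>X. f \<eta> t) holomorphic_on ball z (e / 2)) (finite_subsets_at_top I)"
  proof (rule eventually_finite_subsets_at_top_weakI)
    fix X assume X: "X \<subseteq> I"
    have "(\<lambda>t. \<Sum>\<eta>\<in>X. f \<eta> t) holomorphic_on ball z e"
      using X hol by (intro holomorphic_intros) auto
    moreover have "ball z (e / 2) \<subseteq> ball z e" using assms(1) by auto
    ultimately show "continuous_on (cball z (e / 2)) (\<lambda>t. \<Sum>\<eta>\<in>X. f \<eta> t) \<and>
        (\<lambda>t. \<Sum>\<eta>\<in>X. f \<eta> t) holomorphic_on ball z (e / 2)"
      using sub holomorphic_on_subset holomorphic_on_imp_continuous_on by blast
  qed
  from holomorphic_uniform_limit[OF this ul] have "(\<lambda>t. infsum (\<lambda>\<eta>. f \<eta> t) I) holomorphic_on ball z (e / 2)"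
    by simp
  thus ?thesis using assms(1) by (intro holomorphic_on_imp_differentiable_at[of _ "ball z (e / 2)"]) auto
qed

text \<open>Locally uniform convergence by the Weierstrass test. Boxes in finitely many coordinates
  serve as neighbourhoods, being open in the product topology.\<close>

lemma holo2_infsum:
  assumes U: "U \<subseteq> cvec a \<times> cvec b"
    and hol: "\<And>\<eta>. \<eta> \<in> I \<Longrightarrow> holo2 a b U (f \<eta>)"
    and loc: "\<And>z0 w0. (z0, w0) \<in> U \<Longrightarrow> \<exists>e>0. \<exists>M. M summable_on I \<and>
      (\<forall>z\<in>cvec a. \<forall>w\<in>cvec b. (\<forall>i<a. dist (z i) (z0 i) < e) \<longrightarrow> (\<forall>i<b. dist (w i) (w0 i) < e) \<longrightarrow>
         (z, w) \<in> U \<and> (\<forall>\<eta>\<in>I. cmod (f \<eta> z w) \<le> M \<eta>))"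
  shows "holo2 a b U (\<lambda>z w. infsum (\<lambda>\<eta>. f \<eta> z w) I)"
  unfolding holo2_def
proof (intro conjI U)
  show "continuous_on U (\<lambda>(z, w). infsum (\<lambda>\<eta>. f \<eta> z w) I)"
    unfolding continuous_on_eq_continuous_within
  proof
    fix p assume p: "p \<in> U"
    obtain z0 w0 where zw: "p = (z0, w0)" by (cases p)
    from loc p zw obtain e M where e: "0 < e" "M summable_on I" and
      M: "\<And>z w. z \<in> cvec a \<Longrightarrow> w \<in> cvec b \<Longrightarrow> (\<forall>i<a. dist (z i) (z0 i) < e) \<Longrightarrow> (\<forall>i<b. dist (w i) (w0 i) < e) \<Longrightarrow>
         (z, w) \<in> U \<and> (\<forall>\<eta>\<in>I. cmod (f \<eta> z w) \<le> M \<eta>)" by metis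
    define W where "W = {(z, w). (\<forall>i<a. dist (z i) (z0 i) < e) \<and> (\<forall>i<b. dist (w i) (w0 i) < e)}"
    have W: "open W" unfolding W_def by (rule open_box)
    have pW: "p \<in> W" using e(1) by (simp add: W_def zw)
    have ul: "uniform_limit (U \<inter> W) (\<lambda>X p. \<Sum>\<eta>\<in>X. (\<lambda>(z, w). f \<eta> z w) p)
       (\<lambda>p. infsum (\<lambda>\<eta>. (\<lambda>(z, w). f \<eta> z w) p) I) (finite_subsets_at_top I)"
      by (rule Weierstrass_m_test_general[OF _ e(2)]) (use M U in \<open>auto simp: W_def\<close>)
    have "continuous_on (U \<inter> W) (\<lambda>p. infsum (\<lambda>\<eta>. (\<lambda>(z, w). f \<eta> z w) p) I)"
    proof (rule uniform_limit_theorem[OF _ ul])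
      show "eventually (\<lambda>X. continuous_on (U \<inter> W) (\<lambda>p. \<Sum>\<eta>\<in>X. (\<lambda>(z, w). f \<eta> z w) p)) (finite_subsets_at_top I)"
      proof (rule eventually_finite_subsets_at_top_weakI)
        fix X assume "X \<subseteq> I"
        hence "continuous_on (U \<inter> W) (\<lambda>(z, w). f \<eta> z w)" if "\<eta> \<in> X" for \<eta>
          using that hol continuous_on_subset unfolding holo2_def by (metis Int_lower1 subsetD)
        thus "continuous_on (U \<inter> W) (\<lambda>p. \<Sum>\<eta>\<in>X. (\<lambda>(z, w). f \<eta> z w) p)"
          by (intro continuous_on_sum)
      qed
    qed simp
    hence "continuous (at p within U \<inter> W) (\<lambda>p. infsum (\<lambda>\<eta>. (\<lambda>(z, w). f \<eta> z w) p) I)"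
      using p pW by (simp add: continuous_on_eq_continuous_within)
    moreover have "at p within U \<inter> W = at p within U"
      by (rule at_within_nhd[OF pW W]) auto
    ultimately show "continuous (at p within U) (\<lambda>(z, w). infsum (\<lambda>\<eta>. f \<eta> z w) I)"
      unfolding case_prod_unfold by simp
  qed
next
  show "\<forall>(z, w)\<in>U. (\<forall>i<a. (\<lambda>t. infsum (\<lambda>\<eta>. f \<eta> (z(i := t)) w) I) field_differentiable at (z i)) \<and>
      (\<forall>i<b. (\<lambda>t. infsum (\<lambda>\<eta>. f \<eta> z (w(i := t))) I) field_differentiable at (w i))"
  proof (safe)
    fix z0 w0 i assume p: "(z0, w0) \<in> U"
    from loc[OF p] obtain e M where e: "0 < e" "M summable_on I" and
      M: "\<And>z w. z \<in> cvec a \<Longrightarrow> w \<in> cvec b \<Longrightarrow> (\<forall>i<a. dist (z i) (z0 i) < e) \<Longrightarrow> (\<forall>i<b. dist (w i) (w0 i) < e) \<Longrightarrow>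
         (z, w) \<in> U \<and> (\<forall>\<eta>\<in>I. cmod (f \<eta> z w) \<le> M \<eta>)" by metis
    have cv: "z0 \<in> cvec a" "w0 \<in> cvec b" using p U by auto
    show "(\<lambda>t. infsum (\<lambda>\<eta>. f \<eta> (z0(i := t)) w0) I) field_differentiable at (z0 i)" if i: "i < a"
    proof (rule holomorphic_infsum[OF e])
      fix \<eta> t assume \<eta>: "\<eta> \<in> I" and t: "t \<in> ball (z0 i) e"
      have *: "(z0(i := t), w0) \<in> U \<and> (\<forall>\<eta>\<in>I. cmod (f \<eta> (z0(i := t)) w0) \<le> M \<eta>)"
        by (rule M) (use cv cvec_upd i t e(1) in \<open>auto simp: dist_commute\<close>)
      thus "cmod (f \<eta> (z0(i := t)) w0) \<le> M \<eta>" using \<eta> by blast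
      have "(\<lambda>u. f \<eta> ((z0(i := t))(i := u)) w0) field_differentiable at ((z0(i := t)) i)"
        using * hol[OF \<eta>] i unfolding holo2_def by blast
      thus "(\<lambda>t. f \<eta> (z0(i := t)) w0) field_differentiable at t" by simp
    qed
    show "(\<lambda>t. infsum (\<lambda>\<eta>. f \<eta> z0 (w0(i := t))) I) field_differentiable at (w0 i)" if i: "i < b"
    proof (rule holomorphic_infsum[OF e])
      fix \<eta> t assume \<eta>: "\<eta> \<in> I" and t: "t \<in> ball (w0 i) e"
      have *: "(z0, w0(i := t)) \<in> U \<and> (\<forall>\<eta>\<in>I. cmod (f \<eta> z0 (w0(i := t))) \<le> M \<eta>)"
        by (rule M) (use cv cvec_upd i t e(1) in \<open>auto simp: dist_commute\<close>)
      thus "cmod (f \<eta> z0 (w0(i := t))) \<le> M \<eta>" using \<eta> by blast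
      have "(\<lambda>u. f \<eta> z0 ((w0(i := t))(i := u))) field_differentiable at ((w0(i := t)) i)"
        using * hol[OF \<eta>] i unfolding holo2_def by blast
      thus "(\<lambda>t. f \<eta> z0 (w0(i := t))) field_differentiable at t" by simp
    qed
  qed
qed

lemma continuous_on_coord: "continuous_on A (\<lambda>x :: nat \<Rightarrow> complex. x i)"
  by (rule continuous_on_subset[OF continuous_on_product_coordinates]) simp

lemma continuous_on_pol: "continuous_on A (pol n m a)"
  unfolding pol_def[abs_def] Defs.mono_def
  by (intro continuous_on_sum continuous_on_mult continuous_on_const continuous_on_prod
      continuous_on_power continuous_on_coord)

section \<open>Growth of Pochhammer symbols\<close>

text \<open>At most \<open>N\<close> factors need the crude bound \<open>K\<close>. The exponent
  \<open>min m N\<close>, which counts those met so far, is what the induction can carry.\<close>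

lemma prod_bound:
  fixes x :: "nat \<Rightarrow> real"
  assumes "\<And>i. 0 \<le> x i" "\<And>i. i < N \<Longrightarrow> x i \<le> K" "\<And>i. N \<le> i \<Longrightarrow> x i \<le> s" "1 \<le> K" "1 \<le> s"
  shows "(\<Prod>i<m. x i) \<le> K ^ N * s ^ m"
proof -
  have "(\<Prod>i<m. x i) \<le> K ^ (min m N) * s ^ m"
  proof (induction m)
    case (Suc m)
    show ?case
    proof (cases "m < N")
      case True
      have "(\<Prod>i<Suc m. x i) \<le> (K ^ min m N * s ^ m) * (K * s)"
      proof (simp, intro mult_mono Suc)
        show "x m \<le> K * s" using assms(2)[OF True] assms(4,5) by (metis mult.right_neutral mult_left_mono order_trans zero_le_one)
      qed (use assms in \<open>auto intro: prod_nonneg\<close>)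
      thus ?thesis using True by (simp add: min_def mult_ac)
    next
      case False
      have "(\<Prod>i<Suc m. x i) \<le> (K ^ min m N * s ^ m) * s"
        unfolding prod.lessThan_Suc using False assms(1,3-5)
        by (intro mult_mono Suc) (auto intro: prod_nonneg)
      thus ?thesis using False by (simp add: min_absorb2 mult_ac)
    qed
  qed simp
  also have "\<dots> \<le> K ^ N * s ^ m" using assms by (intro mult_right_mono power_increasing) auto
  finally show ?thesis .
qed

lemma fact_prod_real: "fact m = (\<Prod>i<m. real i + 1)"
  by (simp add: fact_prod_Suc lessThan_atLeast0 add.commute)

lemma norm_pochhammer: "cmod (pochhammer a m) = (\<Prod>i<m. cmod (a + of_nat i))"
  by (simp add: pochhammer_prod lessThan_atLeast0 flip: prod_norm)

lemma pochhammer_upper: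
  assumes "1 < s" "0 \<le> \<rho>"
  obtains C where "1 \<le> C" "\<And>a m. cmod a \<le> \<rho> \<Longrightarrow> cmod (pochhammer a m) \<le> C * s ^ m * fact m"
proof -
  \<comment> \<open>From this index on \<rho> \<le> i (s - 1), so the factor |a + i| / (i + 1) is at
    most \<open>s\<close>, uniformly for |a| \<le> \<rho>.\<close>
  define N where "N = nat \<lceil>\<rho> / (s - 1)\<rceil>"
  have *: "cmod (pochhammer a m) \<le> (\<rho> + 1) ^ N * s ^ m * fact m" if a: "cmod a \<le> \<rho>" for a m
  proof -
    define x where "x i = cmod (a + of_nat i) / (real i + 1)" for i
    have le: "cmod (a + of_nat i) \<le> \<rho> + real i" for i
      using a norm_triangle_ineq[of a "of_nat i"] by simp
    have "(\<Prod>i<m. x i) \<le> (\<rho> + 1) ^ N * s ^ m"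
    proof (rule prod_bound)
      show "x i \<le> \<rho> + 1" for i
      proof -
        have "\<rho> + real i \<le> (\<rho> + 1) * (real i + 1)" using assms by (simp add: algebra_simps)
        thus ?thesis using le[of i] by (simp add: x_def divide_le_eq)
      qed
      show "x i \<le> s" if "N \<le> i" for i
      proof -
        have "\<rho> / (s - 1) \<le> real i" using that by (simp add: N_def ceiling_le_iff nat_le_iff)
        hence "\<rho> \<le> real i * (s - 1)" using assms by (simp add: divide_le_eq)
        hence "\<rho> + real i \<le> s * (real i + 1)" using assms by (simp add: algebra_simps)
        thus ?thesis using le[of i] by (simp add: x_def divide_le_eq)
      qed
    qed (use assms in \<open>auto simp: x_def\<close>)
    moreover have "cmod (pochhammer a m) = (\<Prod>i<m. x i) * fact m"
      unfolding norm_pochhammer fact_prod_real prod.distrib[symmetric]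
      by (intro prod.cong refl) (simp add: x_def add_nonneg_pos[THEN less_imp_neq, symmetric])
    ultimately show ?thesis by (simp add: mult_right_mono)
  qed
  have "1 \<le> (\<rho> + 1) ^ N" using assms by simp
  thus thesis using * that by blast
qed

lemma dist_nonpos_ints:
  fixes b :: complex
  assumes "\<And>m. b \<noteq> - of_nat m"
  obtains \<delta> where "0 < \<delta>" "\<delta> \<le> 1" "\<And>m. \<delta> \<le> cmod (b + of_nat m)"
proof -
  \<comment> \<open>Beyond \<open>N\<close> the distance is at least m - |b| \<ge> 1, so a minimum
    over finitely many \<open>m\<close> and 1 bounds all of them.\<close>
  define N where "N = nat \<lceil>cmod b\<rceil> + 1"
  define D where "D = insert 1 ((\<lambda>m. cmod (b + of_nat m)) ` {..N})"
  have D: "finite D" "D \<noteq> {}" by (auto simp: D_def)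
  have "0 < d" if "d \<in> D" for d
    using that assms by (auto simp: D_def add_eq_0_iff2)
  hence pos: "0 < Min D" using D by simp
  have "Min D \<le> cmod (b + of_nat m)" for m
  proof (cases "m \<le> N")
    case True
    thus ?thesis using D by (intro Min_le) (auto simp: D_def)
  next
    case False
    have "cmod b \<le> real (nat \<lceil>cmod b\<rceil>)" by (rule real_nat_ceiling_ge)
    hence "1 \<le> real m - cmod b" using False unfolding N_def by linarith
    also have "\<dots> \<le> cmod (b + of_nat m)"
      using norm_triangle_ineq2[of "of_nat m" "- b"] by (simp add: add.commute)
    finally show ?thesis using Min_le[OF D(1), of 1] by (simp add: D_def)
  qed
  moreover have "Min D \<le> 1" using D by (intro Min_le) (auto simp: D_def)
  ultimately show thesis using that pos by blast
qed

lemma pochhammer_lower: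
  assumes "1 < s" "\<And>m. b0 \<noteq> - of_nat m"
  obtains e C where "0 < e" "1 \<le> C" "\<And>b m. dist b b0 < e \<Longrightarrow> b \<noteq> - of_nat m"
    "\<And>b m. dist b b0 < e \<Longrightarrow> fact m \<le> C * s ^ m * cmod (pochhammer b m)"
proof -
  obtain \<delta> where \<delta>: "0 < \<delta>" "\<delta> \<le> 1" "\<And>m. \<delta> \<le> cmod (b0 + of_nat m)" using dist_nonpos_ints assms(2) by blast
  define \<rho> where "\<rho> = cmod b0 + 1"
  \<comment> \<open>From here on i + 1 \<le> s (i - \<rho>), while |b + i| \<ge> i - \<rho> near
    \<open>b0\<close>. Below \<open>N\<close> the factor is at most N + 1 divided by half of
    \<open>\<delta>\<close>, which gives \<open>K\<close>.\<close>
  define N where "N = nat \<lceil>(1 + s * \<rho>) / (s - 1)\<rceil>"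
  define K where "K = 2 * (real N + 1) / \<delta>"
  have K: "1 \<le> K" using \<delta> by (simp add: K_def le_divide_eq)
  have low: "\<delta> / 2 \<le> cmod (b + of_nat i)" if b: "dist b b0 < \<delta> / 2" for b i
    using \<delta>(3)[of i] norm_triangle_ineq3[of "b + of_nat i" "b0 + of_nat i"] b by (simp add: dist_norm)
  have ne: "b \<noteq> - of_nat m" if b: "dist b b0 < \<delta> / 2" for b m
    using low[OF b, of m] \<delta>(1) by auto
  have "fact m \<le> K ^ N * s ^ m * cmod (pochhammer b m)" if b: "dist b b0 < \<delta> / 2" for b m
  proof -
    have nb: "cmod b \<le> \<rho>" using b \<delta>(2) norm_triangle_ineq2[of b b0] by (simp add: dist_norm \<rho>_def)
    have pos: "0 < cmod (b + of_nat i)" for i using low[OF b, of i] \<delta>(1) by linarith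
    define x where "x i = (real i + 1) / cmod (b + of_nat i)" for i
    have "(\<Prod>i<m. x i) \<le> K ^ N * s ^ m"
    proof (rule prod_bound)
      show "x i \<le> K" if "i < N" for i
      proof -
        have "x i \<le> (real N + 1) / (\<delta> / 2)"
          unfolding x_def using that low[OF b, of i] \<delta>(1) by (intro frac_le) auto
        thus ?thesis by (simp add: K_def mult.commute)
      qed
      show "x i \<le> s" if "N \<le> i" for i
      proof -
        have "(1 + s * \<rho>) / (s - 1) \<le> real i" using that by (simp add: N_def ceiling_le_iff nat_le_iff)
        hence "1 + s * \<rho> \<le> real i * (s - 1)" using assms by (simp add: divide_le_eq)
        hence "real i + 1 \<le> s * (real i - \<rho>)" by (simp add: algebra_simps)
        also have "\<dots> \<le> s * cmod (b + of_nat i)"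
          using norm_triangle_ineq2[of "of_nat i" "- b"] nb assms(1) by (intro mult_left_mono) (auto simp: add.commute)
        finally show ?thesis using pos[of i] by (simp add: x_def divide_le_eq)
      qed
    qed (use assms K in \<open>auto simp: x_def\<close>)
    hence "(\<Prod>i<m. x i) * cmod (pochhammer b m) \<le> K ^ N * s ^ m * cmod (pochhammer b m)"
      by (rule mult_right_mono) simp
    moreover have "(\<Prod>i<m. x i) * cmod (pochhammer b m) = fact m"
      unfolding norm_pochhammer fact_prod_real prod.distrib[symmetric]
      using pos by (intro prod.cong refl) (simp add: x_def less_imp_neq[symmetric])
    ultimately show ?thesis by simp
  qed
  thus thesis using that[of "\<delta> / 2" "K ^ N"] \<delta>(1) K ne by simp
qed

section \<open>Multivariate Pochhammer symbols against products of factorials\<close>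

definition Hf :: "nat \<Rightarrow> (nat \<Rightarrow> nat) \<Rightarrow> real" where
  "Hf n la = (\<Prod>j<n. fact (la j))"

lemma Hf_ge_1: "1 \<le> Hf n la"
  unfolding Hf_def by (rule prod_ge_1) simp

lemma Hf_plus_part: "\<eta> \<in> multi n \<Longrightarrow> Hf n (plus_part n \<eta>) = Hf n \<eta>"
proof -
  assume "\<eta> \<in> multi n"
  then obtain w where "w permutes {..<n}" "plus_part n \<eta> = \<eta> \<circ> w" using plus_part_permutes by blast
  thus ?thesis using prod.permute[of w "{..<n}" "\<lambda>j. fact (\<eta> j) :: real"] by (simp add: Hf_def comp_def)
qed

text \<open>Ranks stay below \<open>n\<close>, so for \<mu> = 1 + k n every base is at least 1 and
  each Pochhammer symbol dominates the factorial.\<close>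

lemma Hf_le_om:
  assumes "0 \<le> k"
  shows "Hf n \<eta> \<le> om n k (1 + k * real n) \<eta>"
  unfolding Hf_def om_def
proof (rule prod_mono, intro conjI)
  fix j assume "j \<in> {..<n}"
  hence "real (rk n \<eta> j) \<le> real n" using rk_lt[of j n \<eta>] by simp
  from mult_left_mono[OF this assms] have "1 \<le> 1 + k * real n - k * real (rk n \<eta> j)" by simp
  thus "fact (\<eta> j) \<le> pochhammer (1 + k * real n - k * real (rk n \<eta> j)) (\<eta> j)"
    unfolding pochhammer_fact pochhammer_prod by (intro prod_mono) auto
qed simp

lemma gpoch_upper:
  assumes "1 < s" "0 \<le> \<rho>" "0 \<le> k"
  obtains C where "1 \<le> C" "\<And>\<mu> la. cmod \<mu> \<le> \<rho> \<Longrightarrow> cmod (gpoch n k \<mu> la) \<le> C * s ^ weight n la * Hf n la"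
proof -
  obtain C where C: "1 \<le> C" "\<And>a m. cmod a \<le> \<rho> + k * real n \<Longrightarrow> cmod (pochhammer a m) \<le> C * s ^ m * fact m"
    using pochhammer_upper[OF assms(1), of "\<rho> + k * real n"] assms by auto
  have "cmod (gpoch n k \<mu> la) \<le> C ^ n * s ^ weight n la * Hf n la" if "cmod \<mu> \<le> \<rho>" for \<mu> la
  proof -
    have "cmod (gpoch n k \<mu> la) = (\<Prod>j<n. cmod (pochhammer (\<mu> - of_real (k * real j)) (la j)))"
      by (simp add: gpoch_def flip: prod_norm)
    also have "\<dots> \<le> (\<Prod>j<n. C * s ^ la j * fact (la j))"
    proof (intro prod_mono conjI C(2))
      fix j assume "j \<in> {..<n}"
      hence "k * real j \<le> k * real n" using assms(3) by (intro mult_left_mono) auto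
      moreover have "cmod (of_real (k * real j)) = k * real j" using assms(3) by (simp add: norm_mult)
      ultimately show "cmod (\<mu> - of_real (k * real j)) \<le> \<rho> + k * real n"
        using that norm_triangle_ineq4[of \<mu> "of_real (k * real j)"] by linarith
    qed simp
    also have "\<dots> = C ^ n * s ^ weight n la * Hf n la"
      by (simp add: prod.distrib weight_def Hf_def power_sum)
    finally show ?thesis .
  qed
  moreover have "1 \<le> C ^ n" using C(1) by simp
  ultimately show thesis using that by blast
qed

lemma gpoch_lower:
  assumes "1 < s" "\<And>j m. j < n \<Longrightarrow> \<nu>0 \<noteq> of_real (k * real j) - of_nat m"
  obtains e C where "0 < e" "1 \<le> C"
    "\<And>\<nu> j m. dist \<nu> \<nu>0 < e \<Longrightarrow> j < n \<Longrightarrow> \<nu> \<noteq> of_real (k * real j) - of_nat m"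
    "\<And>\<nu> la. dist \<nu> \<nu>0 < e \<Longrightarrow> Hf n la \<le> C * s ^ weight n la * cmod (gpoch n k \<nu> la)"
proof -
  have "\<forall>j\<in>{..<n}. \<exists>e C. 0 < e \<and> 1 \<le> C \<and> (\<forall>b m. dist b (\<nu>0 - of_real (k * real j)) < e \<longrightarrow> b \<noteq> - of_nat m \<and>
      fact m \<le> C * s ^ m * cmod (pochhammer b m))"
  proof
    fix j assume "j \<in> {..<n}"
    hence "\<nu>0 - of_real (k * real j) \<noteq> - of_nat m" for m
      using assms(2)[of j m] by (auto simp: algebra_simps)
    from pochhammer_lower[OF assms(1) this] show "\<exists>e C. 0 < e \<and> 1 \<le> C \<and>
      (\<forall>b m. dist b (\<nu>0 - of_real (k * real j)) < e \<longrightarrow> b \<noteq> - of_nat m \<and> fact m \<le> C * s ^ m * cmod (pochhammer b m))"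
      by metis
  qed
  then obtain e C where eC: "\<And>j. j < n \<Longrightarrow> 0 < e j" "\<And>j. j < n \<Longrightarrow> (1::real) \<le> C j"
    "\<And>j b m. j < n \<Longrightarrow> dist b (\<nu>0 - of_real (k * real j)) < e j \<Longrightarrow> b \<noteq> - of_nat m"
    "\<And>j b m. j < n \<Longrightarrow> dist b (\<nu>0 - of_real (k * real j)) < e j \<Longrightarrow> fact m \<le> C j * s ^ m * cmod (pochhammer b m)"
    by (metis lessThan_iff)
  \<comment> \<open>The inserted 1 keeps the minimum defined for \<open>n = 0\<close>.\<close>
  define d where "d = Min (insert 1 (e ` {..<n}))"
  have d: "0 < d" unfolding d_def using eC(1) by simp
  have dist: "dist (\<nu> - of_real (k * real j)) (\<nu>0 - of_real (k * real j)) < e j" if "dist \<nu> \<nu>0 < d" "j < n" for \<nu> j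
  proof -
    have "d \<le> e j" unfolding d_def using that by (intro Min_le) auto
    thus ?thesis using that by (simp add: dist_norm)
  qed
  have "Hf n la \<le> (\<Prod>j<n. C j) * s ^ weight n la * cmod (gpoch n k \<nu> la)" if "dist \<nu> \<nu>0 < d" for \<nu> la
  proof -
    have "Hf n la \<le> (\<Prod>j<n. C j * s ^ la j * cmod (pochhammer (\<nu> - of_real (k * real j)) (la j)))"
      unfolding Hf_def using eC(4) dist that by (intro prod_mono) auto
    also have "\<dots> = (\<Prod>j<n. C j) * s ^ weight n la * cmod (gpoch n k \<nu> la)"
      by (simp add: prod.distrib weight_def gpoch_def power_sum prod_norm)
    finally show ?thesis .
  qed
  moreover have "\<nu> \<noteq> of_real (k * real j) - of_nat m" if "dist \<nu> \<nu>0 < d" "j < n" for \<nu> j m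
    using eC(3)[OF that(2) dist[OF that], of m] by auto
  moreover have "1 \<le> (\<Prod>j<n. C j)" using eC(2) by (intro prod_ge_1) auto
  ultimately show thesis using that d by blast
qed

lemma gpochv_nonzero:
  assumes "(\<mu>, \<nu>) \<in> params n k p q"
  shows "gpochv n k q \<nu> la \<noteq> 0"
proof -
  have "pochhammer (\<nu> i - of_real (k * real j)) m \<noteq> 0" if "i < q" "j < n" for i j m
  proof -
    have "\<nu> i - of_real (k * real j) \<noteq> - of_nat l" for l
      using assms that unfolding params_def by (auto simp: algebra_simps)
    thus ?thesis by (auto simp: pochhammer_eq_0_iff)
  qed
  thus ?thesis by (auto simp: gpochv_def gpoch_def)
qed

text \<open>Each of the \<open>p + q\<close> symbols agrees with \<open>Hf\<close> up to a constant
  and a power of a number slightly above 1, in the direction required and uniformly near the given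
  parameters.\<close>

lemma ratio_bound:
  assumes "1 < S" "0 \<le> k" "(\<mu>0, \<nu>0) \<in> params n k p q"
  obtains e C where "0 < e" "0 \<le> C"
    "\<And>\<mu> \<nu>. \<mu> \<in> cvec p \<Longrightarrow> \<nu> \<in> cvec q \<Longrightarrow> (\<forall>i<p. dist (\<mu> i) (\<mu>0 i) < e) \<Longrightarrow> (\<forall>i<q. dist (\<nu> i) (\<nu>0 i) < e) \<Longrightarrow>
      (\<mu>, \<nu>) \<in> params n k p q \<and>
      (\<forall>la. cmod (gpochv n k p \<mu> la / gpochv n k q \<nu> la) \<le> C * S ^ weight n la * (Hf n la ^ p / Hf n la ^ q))"
proof -
  \<comment> \<open>Every symbol costs a factor \<open>s\<close> per unit of weight; the additional
    1 keeps the order of the root positive when \<open>p\<close> and \<open>q\<close> are 0.\<close>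
  define s where "s = root (p + q + 1) S"
  have s: "1 < s" unfolding s_def using assms(1) by (intro real_root_gt_1_iff[THEN iffD2]) auto
  have sS: "s ^ (p + q + 1) = S" unfolding s_def using assms(1) by (intro real_root_pow_pos2) auto
  have "s ^ (p + q) \<le> s ^ (p + q + 1)" using s by (intro power_increasing) auto
  hence sS: "s ^ (p + q) \<le> S" using sS by simp
  define \<rho> where "\<rho> = (\<Sum>i<p. cmod (\<mu>0 i)) + 1"
  have \<rho>: "0 \<le> \<rho>" by (auto simp: \<rho>_def intro!: add_nonneg_nonneg sum_nonneg)
  obtain A where A: "1 \<le> A" "\<And>\<mu> la. cmod \<mu> \<le> \<rho> \<Longrightarrow> cmod (gpoch n k \<mu> la) \<le> A * s ^ weight n la * Hf n la"
    using gpoch_upper[OF s \<rho> assms(2)] by metis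
  have "\<forall>i\<in>{..<q}. \<exists>e B. 0 < e \<and> 1 \<le> B \<and> (\<forall>\<nu>. dist \<nu> (\<nu>0 i) < e \<longrightarrow>
      (\<forall>j<n. \<forall>m. \<nu> \<noteq> of_real (k * real j) - of_nat m) \<and> (\<forall>la. Hf n la \<le> B * s ^ weight n la * cmod (gpoch n k \<nu> la)))"
  proof
    fix i assume "i \<in> {..<q}"
    hence "\<nu>0 i \<noteq> of_real (k * real j) - of_nat m" if "j < n" for j m
      using assms(3) that unfolding params_def by auto
    from gpoch_lower[OF s this] show "\<exists>e B. 0 < e \<and> 1 \<le> B \<and> (\<forall>\<nu>. dist \<nu> (\<nu>0 i) < e \<longrightarrow>
      (\<forall>j<n. \<forall>m. \<nu> \<noteq> of_real (k * real j) - of_nat m) \<and> (\<forall>la. Hf n la \<le> B * s ^ weight n la * cmod (gpoch n k \<nu> la)))"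
      by metis
  qed
  then obtain e B where eB: "\<And>i. i < q \<Longrightarrow> 0 < e i" "\<And>i. i < q \<Longrightarrow> (1::real) \<le> B i"
    "\<And>i \<nu> j m. i < q \<Longrightarrow> dist \<nu> (\<nu>0 i) < e i \<Longrightarrow> j < n \<Longrightarrow> \<nu> \<noteq> of_real (k * real j) - of_nat m"
    "\<And>i \<nu> la. i < q \<Longrightarrow> dist \<nu> (\<nu>0 i) < e i \<Longrightarrow> Hf n la \<le> B i * s ^ weight n la * cmod (gpoch n k \<nu> la)"
    by (metis lessThan_iff)
  \<comment> \<open>A radius of at most 1 keeps the moduli of the upper parameters below
    \<open>\<rho>\<close>.\<close>
  define d where "d = Min (insert 1 (e ` {..<q}))"
  have d: "0 < d" unfolding d_def using eB(1) by simp
  have d1: "d \<le> 1" unfolding d_def by (intro Min_le) auto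
  have de: "d \<le> e i" if "i < q" for i unfolding d_def using that by (intro Min_le) auto
  define C where "C = A ^ p * (\<Prod>i<q. B i)"
  have C: "0 \<le> C" using A(1) eB(2) unfolding C_def by (intro mult_nonneg_nonneg prod_nonneg) (auto intro: order_trans[of 0 1])
  show thesis
  proof (rule that[OF d C])
    fix \<mu> \<nu> assume cv: "\<mu> \<in> cvec p" "\<nu> \<in> cvec q" and
      close: "\<forall>i<p. dist (\<mu> i) (\<mu>0 i) < d" "\<forall>i<q. dist (\<nu> i) (\<nu>0 i) < d"
    have close2: "dist (\<nu> i) (\<nu>0 i) < e i" if "i < q" for i using close(2) de that by force
    have par: "(\<mu>, \<nu>) \<in> params n k p q"
      using cv eB(3) close2 by (auto simp: params_def)
    have "cmod (gpochv n k p \<mu> la / gpochv n k q \<nu> la) \<le> C * S ^ weight n la * (Hf n la ^ p / Hf n la ^ q)" for la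
    proof -
      let ?w = "weight n la" and ?H = "Hf n la"
      have H: "1 \<le> ?H" by (rule Hf_ge_1)
      have "cmod (\<mu> i) \<le> \<rho>" if "i < p" for i
      proof -
        have "cmod (\<mu> i) \<le> cmod (\<mu>0 i) + 1"
          using close(1) that d1 norm_triangle_ineq2[of "\<mu> i" "\<mu>0 i"] by (force simp: dist_norm)
        moreover have "cmod (\<mu>0 i) \<le> (\<Sum>i<p. cmod (\<mu>0 i))" using that by (intro member_le_sum) auto
        ultimately show ?thesis by (simp add: \<rho>_def)
      qed
      hence "(\<Prod>i<p. cmod (gpoch n k (\<mu> i) la)) \<le> (\<Prod>i<p. A * s ^ ?w * ?H)"
        using A(2) by (intro prod_mono) auto
      hence up: "cmod (gpochv n k p \<mu> la) \<le> A ^ p * s ^ (p * ?w) * ?H ^ p"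
        by (simp add: gpochv_def prod_norm power_mult_distrib power_mult mult.commute[of p])
      have "(\<Prod>i<q. ?H) \<le> (\<Prod>i<q. B i * s ^ ?w * cmod (gpoch n k (\<nu> i) la))"
        using eB(4) close2 H by (intro prod_mono) auto
      hence lo: "?H ^ q \<le> (\<Prod>i<q. B i) * s ^ (q * ?w) * cmod (gpochv n k q \<nu> la)"
        by (simp add: gpochv_def prod_norm prod.distrib power_mult mult.commute[of q])
      have g: "0 < cmod (gpochv n k q \<nu> la)" using gpochv_nonzero[OF par] by simp
      have Hq: "0 < ?H ^ q" using H by simp
      have "cmod (gpochv n k p \<mu> la) * ?H ^ q \<le>
          (A ^ p * s ^ (p * ?w) * ?H ^ p) * ((\<Prod>i<q. B i) * s ^ (q * ?w) * cmod (gpochv n k q \<nu> la))"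
        using up lo A(1) s H Hq by (intro mult_mono) auto
      also have "\<dots> = C * (s ^ (p + q)) ^ ?w * ?H ^ p * cmod (gpochv n k q \<nu> la)"
        by (simp add: C_def power_add power_mult_distrib mult_ac flip: power_mult)
      also have "\<dots> \<le> C * S ^ ?w * ?H ^ p * cmod (gpochv n k q \<nu> la)"
        using C s H sS by (intro mult_right_mono mult_left_mono power_mono) auto
      finally show ?thesis using g Hq by (simp add: norm_divide field_simps)
    qed
    thus "(\<mu>, \<nu>) \<in> params n k p q \<and>
      (\<forall>la. cmod (gpochv n k p \<mu> la / gpochv n k q \<nu> la) \<le> C * S ^ weight n la * (Hf n la ^ p / Hf n la ^ q))"
      using par by blast
  qed
qed

section \<open>Summable majorants\<close>

lemma summable_on_multi:
  fixes M :: "(nat \<Rightarrow> nat) \<Rightarrow> real"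
  assumes "\<And>\<eta>. 0 \<le> M \<eta>" "\<And>m. (\<Sum>\<eta>\<in>hom n m. M \<eta>) \<le> \<beta> m" "summable \<beta>"
  shows "M summable_on multi n"
proof (rule nonneg_bdd_above_summable_on)
  have \<beta>: "0 \<le> \<beta> m" for m using assms(2)[of m] sum_nonneg[of "hom n m" M] assms(1) by force
  show "bdd_above (sum M ` {F. F \<subseteq> multi n \<and> finite F})"
  proof (rule bdd_aboveI)
    fix y assume "y \<in> sum M ` {F. F \<subseteq> multi n \<and> finite F}"
    then obtain F where F: "F \<subseteq> multi n" "finite F" "y = sum M F" by blast
    define N where "N = Suc (Max (insert 0 (weight n ` F)))"
    have "weight n \<eta> < N" if "\<eta> \<in> F" for \<eta>
      unfolding N_def less_Suc_eq_le using that F(2) by (intro Max_ge) auto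
    hence sub: "F \<subseteq> (\<Union>m<N. hom n m)" using F(1) by (auto simp: hom_def)
    have "y \<le> sum M (\<Union>m<N. hom n m)" unfolding F(3) using sub assms(1) by (intro sum_mono2) auto
    also have "\<dots> = (\<Sum>m<N. \<Sum>\<eta>\<in>hom n m. M \<eta>)"
    proof (rule sum.UNION_disjoint)
      show "\<forall>i\<in>{..<N}. \<forall>j\<in>{..<N}. i \<noteq> j \<longrightarrow> hom n i \<inter> hom n j = {}" by (auto simp: hom_def)
    qed auto
    also have "\<dots> \<le> (\<Sum>m<N. \<beta> m)" by (intro sum_mono assms(2))
    also have "\<dots> \<le> suminf \<beta>" using assms(3) \<beta> by (intro sum_le_suminf) auto
    finally show "y \<le> suminf \<beta>" .
  qed
qed (rule assms(1))

definition fiber :: "nat \<Rightarrow> (nat \<Rightarrow> nat) \<Rightarrow> (nat \<Rightarrow> nat) set" where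
  "fiber n la = {\<eta> \<in> multi n. plus_part n \<eta> = la}"

lemma finite_fiber: "finite (fiber n la)"
  by (rule finite_subset[OF _ finite_hom[of n "weight n la"]])
     (auto simp: fiber_def hom_def weight_plus_part)

text \<open>Fibres over distinct partitions are disjoint, so a finite sum over partitions is a
  finite sum of \<open>M\<close>.\<close>

lemma summable_on_fiber:
  fixes M :: "(nat \<Rightarrow> nat) \<Rightarrow> real"
  assumes "\<And>\<eta>. 0 \<le> M \<eta>" "M summable_on multi n"
  shows "(\<lambda>la. \<Sum>\<eta>\<in>fiber n la. M \<eta>) summable_on partitions n"
proof (rule nonneg_bdd_above_summable_on)
  show "bdd_above (sum (\<lambda>la. \<Sum>\<eta>\<in>fiber n la. M \<eta>) ` {F. F \<subseteq> partitions n \<and> finite F})"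
  proof (rule bdd_aboveI)
    fix y assume "y \<in> sum (\<lambda>la. \<Sum>\<eta>\<in>fiber n la. M \<eta>) ` {F. F \<subseteq> partitions n \<and> finite F}"
    then obtain F where F: "finite F" "y = (\<Sum>la\<in>F. \<Sum>\<eta>\<in>fiber n la. M \<eta>)" by blast
    have "y = sum M (\<Union>la\<in>F. fiber n la)"
      unfolding F(2) by (rule sum.UNION_disjoint[symmetric]) (use F(1) finite_fiber in \<open>auto simp: fiber_def\<close>)
    also have "\<dots> \<le> infsum M (multi n)"
      by (rule finite_sum_le_infsum[OF assms(2)]) (use F(1) finite_fiber assms(1) in \<open>auto simp: fiber_def\<close>)
    finally show "y \<le> infsum M (multi n)" .
  qed
qed (simp add: sum_nonneg assms(1))

text \<open>\<open>R\<close> bounds the product of the two sup norms. Both regimes of convergence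
  are put into one condition so that a single argument serves both.\<close>

definition adm :: "nat \<Rightarrow> nat \<Rightarrow> real \<Rightarrow> bool" where
  "adm p q R \<longleftrightarrow> 0 \<le> R \<and> (p \<le> q \<or> p = q + 1 \<and> R < 1)"

lemma majorant:
  assumes "0 \<le> k" "adm p q R" "(\<mu>0, \<nu>0) \<in> params n k p q"
  obtains e M where "0 < e" "\<And>\<eta>. 0 \<le> M \<eta>" "M summable_on multi n"
    "\<And>\<mu> \<nu>. \<mu> \<in> cvec p \<Longrightarrow> \<nu> \<in> cvec q \<Longrightarrow> (\<forall>i<p. dist (\<mu> i) (\<mu>0 i) < e) \<Longrightarrow> (\<forall>i<q. dist (\<nu> i) (\<nu>0 i) < e) \<Longrightarrow>
      (\<mu>, \<nu>) \<in> params n k p q \<and>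
      (\<forall>\<eta>\<in>multi n. cmod (gpochv n k p \<mu> (plus_part n \<eta>) / gpochv n k q \<nu> (plus_part n \<eta>)) *
         (R ^ weight n \<eta> * ell n k \<eta> / fact (weight n \<eta>)) \<le> M \<eta>)"
proof -
  have R: "0 \<le> R" using assms(2) by (simp add: adm_def)
  \<comment> \<open>\<open>C\<close> is quantified after \<open>S\<close> because
    \<open>ratio_bound\<close> delivers it only once \<open>S\<close> is fixed. The absolute value
    makes the majorant nonnegative also off \<open>multi n\<close>, where the sign of
    \<open>ell\<close> is not known.\<close>
  have "\<exists>S>1. \<forall>C\<ge>0. (\<lambda>\<eta>. C * S ^ weight n \<eta> * (Hf n \<eta> ^ p / Hf n \<eta> ^ q) *
      (R ^ weight n \<eta> * \<bar>ell n k \<eta>\<bar> / fact (weight n \<eta>))) summable_on multi n"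
  proof (cases "p \<le> q")
    \<comment> \<open>The quotient of powers of \<open>Hf\<close> is at most 1, and with S = 2 the
      factorial still beats (2 R n)^m.\<close>
    case True
    have "(\<lambda>\<eta>. C * 2 ^ weight n \<eta> * (Hf n \<eta> ^ p / Hf n \<eta> ^ q) *
      (R ^ weight n \<eta> * \<bar>ell n k \<eta>\<bar> / fact (weight n \<eta>))) summable_on multi n" if C: "0 \<le> C" for C
    proof (rule summable_on_multi)
      fix m
      have "(\<Sum>\<eta>\<in>hom n m. C * 2 ^ weight n \<eta> * (Hf n \<eta> ^ p / Hf n \<eta> ^ q) *
          (R ^ weight n \<eta> * \<bar>ell n k \<eta>\<bar> / fact (weight n \<eta>))) \<le>
          (\<Sum>\<eta>\<in>hom n m. C * 2 ^ m * 1 * (R ^ m * ell n k \<eta> / fact m))"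
      proof (rule sum_mono)
        fix \<eta> assume \<eta>: "\<eta> \<in> hom n m"
        have "Hf n \<eta> ^ p \<le> Hf n \<eta> ^ q" using True Hf_ge_1 by (intro power_increasing) auto
        hence "Hf n \<eta> ^ p / Hf n \<eta> ^ q \<le> 1" using Hf_ge_1[of n \<eta>] by (simp add: divide_le_eq_1)
        moreover have "0 \<le> ell n k \<eta>" using jackL_one(2)[OF assms(1) hom_multi[OF \<eta>]] .
        moreover have "weight n \<eta> = m" using \<eta> by (simp add: hom_def)
        ultimately show "C * 2 ^ weight n \<eta> * (Hf n \<eta> ^ p / Hf n \<eta> ^ q) *
          (R ^ weight n \<eta> * \<bar>ell n k \<eta>\<bar> / fact (weight n \<eta>)) \<le> C * 2 ^ m * 1 * (R ^ m * ell n k \<eta> / fact m)"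
          using C R by (simp only: abs_of_nonneg) (intro mult_right_mono mult_left_mono, auto)
      qed
      also have "\<dots> = C * 2 ^ m * (R ^ m * (\<Sum>\<eta>\<in>hom n m. ell n k \<eta>) / fact m)"
        by (simp add: sum_distrib_left sum_divide_distrib)
      also have "\<dots> = C * (inverse (fact m) * (2 * R * real n) ^ m)"
        unfolding sum_ell[OF assms(1)] by (simp add: power_mult_distrib field_simps)
      finally show "(\<Sum>\<eta>\<in>hom n m. C * 2 ^ weight n \<eta> * (Hf n \<eta> ^ p / Hf n \<eta> ^ q) *
          (R ^ weight n \<eta> * \<bar>ell n k \<eta>\<bar> / fact (weight n \<eta>))) \<le> C * (inverse (fact m) * (2 * R * real n) ^ m)" .
    next
      show "summable (\<lambda>m. C * (inverse (fact m) * (2 * R * real n) ^ m))"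
        by (intro summable_mult summable_exp)
    qed (use C R Hf_ge_1 in \<open>auto intro!: mult_nonneg_nonneg divide_nonneg_nonneg zero_le_power order_trans[OF zero_le_one Hf_ge_1]\<close>)
    thus ?thesis by (intro exI[of _ 2]) auto
  next
    case False
    hence pq: "p = q + 1" "R < 1" using assms(2) by (auto simp: adm_def)
    \<comment> \<open>Two factors \<open>S\<close> per degree arise, from \<open>ratio_bound\<close>
      and from \<open>pochhammer_upper\<close>. This choice gives S S R \<le> R + 3 \<epsilon> <
      1.\<close>
    define \<epsilon> where "\<epsilon> = (1 - R) / 4"
    define S where "S = 1 + \<epsilon>"
    have \<epsilon>: "0 < \<epsilon>" "\<epsilon> \<le> 1" using pq R by (auto simp: \<epsilon>_def)
    hence S: "1 < S" by (simp add: S_def)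
    have SR: "S * S * R < 1"
    proof -
      have "\<epsilon> * \<epsilon> \<le> \<epsilon>" using \<epsilon> by (simp add: mult_left_le)
      hence "S * S \<le> 1 + 3 * \<epsilon>" by (simp add: S_def algebra_simps)
      hence "S * S * R \<le> (1 + 3 * \<epsilon>) * R" using R by (rule mult_right_mono)
      also have "\<dots> \<le> R + 3 * \<epsilon>" using \<epsilon> pq mult_left_le[of R "3 * \<epsilon>"] by (simp add: algebra_simps)
      also have "\<dots> < 1" using pq by (simp add: \<epsilon>_def field_simps)
      finally show ?thesis .
    qed
    define \<mu>1 where "\<mu>1 = 1 + k * real n"
    have \<mu>1: "0 \<le> real n * \<mu>1" using assms(1) by (simp add: \<mu>1_def)
    obtain A where A: "1 \<le> A" "\<And>a m. cmod a \<le> real n * \<mu>1 \<Longrightarrow> cmod (pochhammer a m) \<le> A * S ^ m * fact m"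
      using pochhammer_upper[OF S \<mu>1] by metis
    have poch: "pochhammer (real n * \<mu>1) m \<le> A * S ^ m * fact m" for m
    proof -
      have "pochhammer (real n * \<mu>1) m = cmod (pochhammer (of_real (real n * \<mu>1)) m)"
        using \<mu>1 by (simp only: pochhammer_of_real norm_of_real) (simp add: pochhammer_nonneg pochhammer_prod prod_nonneg)
      also have "\<dots> \<le> A * S ^ m * fact m" by (rule A(2)) (use \<mu>1 in \<open>simp only: norm_of_real\<close>)
      finally show ?thesis .
    qed
    have "(\<lambda>\<eta>. C * S ^ weight n \<eta> * (Hf n \<eta> ^ p / Hf n \<eta> ^ q) *
      (R ^ weight n \<eta> * \<bar>ell n k \<eta>\<bar> / fact (weight n \<eta>))) summable_on multi n" if C: "0 \<le> C" for C
    proof (rule summable_on_multi)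
      fix m
      have "(\<Sum>\<eta>\<in>hom n m. C * S ^ weight n \<eta> * (Hf n \<eta> ^ p / Hf n \<eta> ^ q) *
          (R ^ weight n \<eta> * \<bar>ell n k \<eta>\<bar> / fact (weight n \<eta>))) \<le>
          (\<Sum>\<eta>\<in>hom n m. C * S ^ m * om n k \<mu>1 \<eta> * (R ^ m * ell n k \<eta> / fact m))"
      proof (rule sum_mono)
        fix \<eta> assume \<eta>: "\<eta> \<in> hom n m"
        have "Hf n \<eta> ^ p / Hf n \<eta> ^ q = Hf n \<eta>" using Hf_ge_1[of n \<eta>] by (simp add: pq)
        also have "\<dots> \<le> om n k \<mu>1 \<eta>" unfolding \<mu>1_def by (rule Hf_le_om[OF assms(1)])
        finally have "Hf n \<eta> ^ p / Hf n \<eta> ^ q \<le> om n k \<mu>1 \<eta>" .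
        moreover have "0 \<le> ell n k \<eta>" using jackL_one(2)[OF assms(1) hom_multi[OF \<eta>]] .
        moreover have "weight n \<eta> = m" using \<eta> by (simp add: hom_def)
        ultimately show "C * S ^ weight n \<eta> * (Hf n \<eta> ^ p / Hf n \<eta> ^ q) *
          (R ^ weight n \<eta> * \<bar>ell n k \<eta>\<bar> / fact (weight n \<eta>)) \<le> C * S ^ m * om n k \<mu>1 \<eta> * (R ^ m * ell n k \<eta> / fact m)"
          using C R S by (simp only: abs_of_nonneg) (intro mult_right_mono mult_left_mono, auto)
      qed
      also have "\<dots> = C * S ^ m * (R ^ m * (\<Sum>\<eta>\<in>hom n m. om n k \<mu>1 \<eta> * ell n k \<eta>) / fact m)"
        by (simp add: sum_distrib_left sum_divide_distrib mult_ac)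
      also have "\<dots> \<le> C * S ^ m * (R ^ m * (A * S ^ m * fact m) / fact m)"
        unfolding sum_om_ell[OF assms(1)] using C R S poch[of m]
        by (intro mult_left_mono divide_right_mono) auto
      also have "\<dots> = C * A * (S * S * R) ^ m"
        by (simp add: power_mult_distrib)
      finally show "(\<Sum>\<eta>\<in>hom n m. C * S ^ weight n \<eta> * (Hf n \<eta> ^ p / Hf n \<eta> ^ q) *
          (R ^ weight n \<eta> * \<bar>ell n k \<eta>\<bar> / fact (weight n \<eta>))) \<le> C * A * (S * S * R) ^ m" .
    next
      show "summable (\<lambda>m. C * A * (S * S * R) ^ m)"
        using SR S R by (intro summable_mult summable_geometric) auto
    qed (use C R S Hf_ge_1 in \<open>auto intro!: mult_nonneg_nonneg divide_nonneg_nonneg zero_le_power order_trans[OF zero_le_one Hf_ge_1]\<close>)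
    thus ?thesis using S by blast
  qed
  then obtain S where S: "1 < S" "\<And>C. 0 \<le> C \<Longrightarrow> (\<lambda>\<eta>. C * S ^ weight n \<eta> * (Hf n \<eta> ^ p / Hf n \<eta> ^ q) *
      (R ^ weight n \<eta> * \<bar>ell n k \<eta>\<bar> / fact (weight n \<eta>))) summable_on multi n" by blast
  obtain e C where e: "0 < e" and C: "0 \<le> C" and
    *: "\<And>\<mu> \<nu>. \<mu> \<in> cvec p \<Longrightarrow> \<nu> \<in> cvec q \<Longrightarrow> (\<forall>i<p. dist (\<mu> i) (\<mu>0 i) < e) \<Longrightarrow> (\<forall>i<q. dist (\<nu> i) (\<nu>0 i) < e) \<Longrightarrow>
      (\<mu>, \<nu>) \<in> params n k p q \<and>
      (\<forall>la. cmod (gpochv n k p \<mu> la / gpochv n k q \<nu> la) \<le> C * S ^ weight n la * (Hf n la ^ p / Hf n la ^ q))"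
    using ratio_bound[OF S(1) assms(1,3)] by blast
  show thesis
  proof (rule that[OF e _ S(2)[OF C]])
    show "0 \<le> C * S ^ weight n \<eta> * (Hf n \<eta> ^ p / Hf n \<eta> ^ q) * (R ^ weight n \<eta> * \<bar>ell n k \<eta>\<bar> / fact (weight n \<eta>))" for \<eta>
      using C R S(1) by (auto intro!: mult_nonneg_nonneg divide_nonneg_nonneg zero_le_power order_trans[OF zero_le_one Hf_ge_1])
  next
    fix \<mu> \<nu> assume cv: "\<mu> \<in> cvec p" "\<nu> \<in> cvec q" and
      close: "\<forall>i<p. dist (\<mu> i) (\<mu>0 i) < e" "\<forall>i<q. dist (\<nu> i) (\<nu>0 i) < e"
    note ** = *[OF cv close]
    have "cmod (gpochv n k p \<mu> (plus_part n \<eta>) / gpochv n k q \<nu> (plus_part n \<eta>)) *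
         (R ^ weight n \<eta> * ell n k \<eta> / fact (weight n \<eta>)) \<le>
         C * S ^ weight n \<eta> * (Hf n \<eta> ^ p / Hf n \<eta> ^ q) * (R ^ weight n \<eta> * \<bar>ell n k \<eta>\<bar> / fact (weight n \<eta>))"
      if \<eta>: "\<eta> \<in> multi n" for \<eta>
    proof -
      have "cmod (gpochv n k p \<mu> (plus_part n \<eta>) / gpochv n k q \<nu> (plus_part n \<eta>)) \<le>
          C * S ^ weight n \<eta> * (Hf n \<eta> ^ p / Hf n \<eta> ^ q)"
        using ** Hf_plus_part[OF \<eta>] weight_plus_part[OF \<eta>] by metis
      moreover have "0 \<le> ell n k \<eta>" using jackL_one(2)[OF assms(1) \<eta>] .
      ultimately show ?thesis using R by (simp only: abs_of_nonneg) (intro mult_right_mono, auto)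
    qed
    thus "(\<mu>, \<nu>) \<in> params n k p q \<and>
      (\<forall>\<eta>\<in>multi n. cmod (gpochv n k p \<mu> (plus_part n \<eta>) / gpochv n k q \<nu> (plus_part n \<eta>)) *
         (R ^ weight n \<eta> * ell n k \<eta> / fact (weight n \<eta>)) \<le>
         C * S ^ weight n \<eta> * (Hf n \<eta> ^ p / Hf n \<eta> ^ q) * (R ^ weight n \<eta> * \<bar>ell n k \<eta>\<bar> / fact (weight n \<eta>)))"
      using ** by blast
  qed
qed

text \<open>Both numerators are bounded by multiples of the same \<open>l\<close>, one of which
  cancels. For \<open>l = 0\<close> the quotient is 0 by the convention for division, so positivity
  of L_\<eta>(1) does not have to be known.\<close>

lemma norm_quotient_le:
  fixes a b :: complex and l A B R F :: real
  assumes "cmod a \<le> A ^ m * l" "cmod b \<le> B ^ m * l" "A * B \<le> R" "0 \<le> A" "0 \<le> B" "0 \<le> l" "0 < F"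
  shows "cmod (a * b / (of_real F * of_real l)) \<le> R ^ m * l / F"
proof (cases "l = 0")
  case False
  hence l: "0 < l" using assms by simp
  have "cmod a * cmod b \<le> (A ^ m * l) * (B ^ m * l)" using assms by (intro mult_mono) auto
  also have "\<dots> = (A * B) ^ m * (l * l)" by (simp add: power_mult_distrib mult_ac)
  also have "\<dots> \<le> R ^ m * (l * l)" using assms by (intro mult_right_mono power_mono) auto
  finally show ?thesis using l assms(7)
    by (simp add: norm_divide norm_mult divide_le_eq mult_ac)
qed (use assms in simp)

section \<open>Bounds and holomorphy of the individual terms\<close>

lemma sephol_jackL: "0 \<le> k \<Longrightarrow> \<eta> \<in> multi n \<Longrightarrow> sephol (jackL n k \<eta>)"
  unfolding jackL_def[abs_def] jackE_eq_JE by (intro sephol_mult sephol_const sephol_JE)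

lemma continuous_on_jackL: "0 \<le> k \<Longrightarrow> \<eta> \<in> multi n \<Longrightarrow> continuous_on A (jackL n k \<eta>)"
  unfolding jackL_def[abs_def] jackE_eq_JE JE_def
  by (intro continuous_on_mult continuous_on_const continuous_on_pol)

lemma jackC_eq: "jackC n k la z = (\<Sum>\<eta>\<in>fiber n la. jackL n k \<eta> z)"
  by (simp add: jackC_def fiber_def)

lemma sephol_jackC: "0 \<le> k \<Longrightarrow> sephol (jackC n k la)"
  unfolding jackC_eq[abs_def] by (intro sephol_sum sephol_jackL) (auto simp: fiber_def)

lemma continuous_on_jackC: "0 \<le> k \<Longrightarrow> continuous_on A (jackC n k la)"
  unfolding jackC_eq[abs_def] by (intro continuous_on_sum continuous_on_jackL) (auto simp: fiber_def)

lemma sephol_gpochv: "sephol (\<lambda>\<mu>. gpochv n k p \<mu> la)"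
  unfolding gpochv_def gpoch_def pochhammer_prod diff_conv_add_uminus
  by (intro sephol_prod sephol_add sephol_const sephol_coord)

lemma continuous_on_gpochv: "continuous_on A (\<lambda>\<mu>. gpochv n k p \<mu> la)"
  unfolding gpochv_def gpoch_def pochhammer_prod
  by (intro continuous_on_prod continuous_on_add continuous_on_diff continuous_on_const continuous_on_coord)

lemma fiber_hom: "\<eta> \<in> fiber n la \<Longrightarrow> \<eta> \<in> hom n (weight n la)"
  by (auto simp: fiber_def hom_def weight_plus_part)

lemma norm_jackC_le:
  assumes "0 \<le> k"
  shows "cmod (jackC n k la z) \<le> supnorm n z ^ weight n la * (\<Sum>\<eta>\<in>fiber n la. ell n k \<eta>)"
proof -
  have "cmod (jackC n k la z) \<le> (\<Sum>\<eta>\<in>fiber n la. cmod (jackL n k \<eta> z))"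
    unfolding jackC_eq by (rule norm_sum)
  also have "\<dots> \<le> (\<Sum>\<eta>\<in>fiber n la. supnorm n z ^ weight n la * ell n k \<eta>)"
    by (intro sum_mono norm_jackL_le assms fiber_hom)
  finally show ?thesis by (simp add: sum_distrib_left)
qed

lemma jackC_one:
  assumes "0 \<le> k"
  shows "jackC n k la (one_vec n) = of_real (\<Sum>\<eta>\<in>fiber n la. ell n k \<eta>)"
  unfolding jackC_eq of_real_sum by (intro sum.cong refl jackL_one(1) assms) (auto simp: fiber_def)

lemma norm_Kterm_le:
  assumes "0 \<le> k" "\<eta> \<in> multi n" "supnorm n z * supnorm n w \<le> R"
  shows "cmod (Kterm n k p q \<mu> \<nu> z w \<eta>) \<le>
    cmod (gpochv n k p \<mu> (plus_part n \<eta>) / gpochv n k q \<nu> (plus_part n \<eta>)) *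
      (R ^ weight n \<eta> * ell n k \<eta> / fact (weight n \<eta>))"
proof -
  have h: "\<eta> \<in> hom n (weight n \<eta>)" using assms(2) by (rule multi_hom)
  have "cmod (jackL n k \<eta> z * jackL n k \<eta> w / (of_real (fact (weight n \<eta>)) * of_real (ell n k \<eta>))) \<le>
      R ^ weight n \<eta> * ell n k \<eta> / fact (weight n \<eta>)"
    by (rule norm_quotient_le[where A = "supnorm n z" and B = "supnorm n w"])
       (use assms norm_jackL_le[OF assms(1) h] jackL_one(2) supnorm_nonneg in auto)
  thus ?thesis
    unfolding Kterm_def jackL_one(1)[OF assms(1,2)] norm_mult by (intro mult_left_mono) simp_all
qed

text \<open>C_\<lambda> is a sum over a fibre on which weight and Pochhammer quotient are constant,
  so adding the bounds for the nonsymmetric terms over the fibre bounds the symmetric term.\<close>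

lemma norm_Fterm_le:
  assumes "0 \<le> k" "supnorm n z * supnorm n w \<le> R"
  shows "cmod (Fterm n k p q \<mu> \<nu> z w la) \<le> (\<Sum>\<eta>\<in>fiber n la.
    cmod (gpochv n k p \<mu> (plus_part n \<eta>) / gpochv n k q \<nu> (plus_part n \<eta>)) *
      (R ^ weight n \<eta> * ell n k \<eta> / fact (weight n \<eta>)))"
proof -
  let ?l = "\<Sum>\<eta>\<in>fiber n la. ell n k \<eta>"
  have l: "0 \<le> ?l" by (intro sum_nonneg jackL_one(2) assms) (auto simp: fiber_def)
  have "cmod (jackC n k la z * jackC n k la w / (of_real (fact (weight n la)) * of_real ?l)) \<le>
      R ^ weight n la * ?l / fact (weight n la)"
    by (rule norm_quotient_le[where A = "supnorm n z" and B = "supnorm n w"])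
       (use assms l norm_jackC_le[OF assms(1)] supnorm_nonneg in auto)
  hence "cmod (Fterm n k p q \<mu> \<nu> z w la) \<le>
      cmod (gpochv n k p \<mu> la / gpochv n k q \<nu> la) * (R ^ weight n la * ?l / fact (weight n la))"
    unfolding Fterm_def jackC_one[OF assms(1)] norm_mult by (intro mult_left_mono) simp_all
  also have "\<dots> = (\<Sum>\<eta>\<in>fiber n la. cmod (gpochv n k p \<mu> la / gpochv n k q \<nu> la) *
      (R ^ weight n la * ell n k \<eta> / fact (weight n la)))"
    by (simp only: sum_distrib_left sum_divide_distrib)
  also have "\<dots> = (\<Sum>\<eta>\<in>fiber n la. cmod (gpochv n k p \<mu> (plus_part n \<eta>) / gpochv n k q \<nu> (plus_part n \<eta>)) *
      (R ^ weight n \<eta> * ell n k \<eta> / fact (weight n \<eta>)))"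
    by (intro sum.cong refl) (auto simp: fiber_def weight_plus_part)
  finally show ?thesis .
qed

lemma holo2_const: "U \<subseteq> cvec a \<times> cvec b \<Longrightarrow> holo2 a b U (\<lambda>z w. c)"
  by (rule holo2_left) (auto simp: sephol_const)

lemma holo2_Kterm:
  assumes "0 \<le> k" "\<eta> \<in> multi n" "U \<subseteq> cvec n \<times> cvec n"
  shows "holo2 n n U (\<lambda>z w. Kterm n k p q \<mu> \<nu> z w \<eta>)"
proof -
  have "holo2 n n U (\<lambda>z w. gpochv n k p \<mu> (plus_part n \<eta>) / gpochv n k q \<nu> (plus_part n \<eta>) *
     (jackL n k \<eta> z * jackL n k \<eta> w * inverse (of_nat (fact (weight n \<eta>)) * jackL n k \<eta> (one_vec n))))"
    by (intro holo2_mult holo2_const holo2_left holo2_right assms sephol_jackL continuous_on_jackL)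
  thus ?thesis by (simp add: Kterm_def divide_inverse)
qed

lemma holo2_Fterm:
  assumes "0 \<le> k" "U \<subseteq> cvec n \<times> cvec n"
  shows "holo2 n n U (\<lambda>z w. Fterm n k p q \<mu> \<nu> z w la)"
proof -
  have "holo2 n n U (\<lambda>z w. gpochv n k p \<mu> la / gpochv n k q \<nu> la *
     (jackC n k la z * jackC n k la w * inverse (of_nat (fact (weight n la)) * jackC n k la (one_vec n))))"
    by (intro holo2_mult holo2_const holo2_left holo2_right assms sephol_jackC continuous_on_jackC)
  thus ?thesis by (simp add: Fterm_def divide_inverse)
qed

lemma params_subset: "params n k p q \<subseteq> cvec p \<times> cvec q"
  by (auto simp: params_def)

lemma holo2_ratio:
  "holo2 p q (params n k p q) (\<lambda>\<mu> \<nu>. gpochv n k p \<mu> la / gpochv n k q \<nu> la * c)"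
  by (intro holo2_mult holo2_divide holo2_const holo2_left[where P = "\<lambda>\<mu>. gpochv n k p \<mu> la"]
      holo2_right[where P = "\<lambda>\<nu>. gpochv n k q \<nu> la"] params_subset
      sephol_gpochv continuous_on_gpochv gpochv_nonzero)

lemma summable_on_dominated:
  fixes f :: "'a \<Rightarrow> complex"
  assumes "M summable_on A" "\<And>x. x \<in> A \<Longrightarrow> cmod (f x) \<le> M x"
  shows "f summable_on A"
  using Infinite_Sum.abs_summable_on_comparison_test'[OF assms] Infinite_Sum.abs_summable_summable by blast

text \<open>\<open>D\<close> enters only through \<open>loc\<close>: near each of its points the
  product of norms stays below an admissible \<open>R\<close>. The majorants in \<open>bnd\<close>
  are uniform both in nearby parameters and in all such arguments; freezing one pair of variables
  gives holomorphy in the other.\<close>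

lemma holo2_series:
  assumes k: "0 \<le> k" and D: "D \<subseteq> cvec n \<times> cvec n"
    and loc: "\<And>z0 w0. (z0, w0) \<in> D \<Longrightarrow> \<exists>R. adm p q R \<and> (\<exists>e>0. \<forall>z\<in>cvec n. \<forall>w\<in>cvec n.
      (\<forall>i<n. dist (z i) (z0 i) < e) \<longrightarrow> (\<forall>i<n. dist (w i) (w0 i) < e) \<longrightarrow>
      (z, w) \<in> D \<and> supnorm n z * supnorm n w \<le> R)"
  shows "\<forall>(\<mu>, \<nu>)\<in>params n k p q.
         (\<forall>(z, w)\<in>D. Kterm n k p q \<mu> \<nu> z w summable_on multi n \<and> Fterm n k p q \<mu> \<nu> z w summable_on partitions n) \<and>
         holo2 n n D (Kser n k p q \<mu> \<nu>) \<and> holo2 n n D (Fser n k p q \<mu> \<nu>)"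
    and "\<forall>(z, w)\<in>D. holo2 p q (params n k p q) (\<lambda>\<mu> \<nu>. Kser n k p q \<mu> \<nu> z w) \<and>
         holo2 p q (params n k p q) (\<lambda>\<mu> \<nu>. Fser n k p q \<mu> \<nu> z w)"
proof -
  have bnd: "\<exists>e>0. \<exists>M MF. M summable_on multi n \<and> MF summable_on partitions n \<and>
      (\<forall>\<mu>\<in>cvec p. \<forall>\<nu>\<in>cvec q. (\<forall>i<p. dist (\<mu> i) (\<mu>0 i) < e) \<longrightarrow> (\<forall>i<q. dist (\<nu> i) (\<nu>0 i) < e) \<longrightarrow>
        (\<mu>, \<nu>) \<in> params n k p q \<and> (\<forall>z w. supnorm n z * supnorm n w \<le> R \<longrightarrow>
           (\<forall>\<eta>\<in>multi n. cmod (Kterm n k p q \<mu> \<nu> z w \<eta>) \<le> M \<eta>) \<and>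
           (\<forall>la\<in>partitions n. cmod (Fterm n k p q \<mu> \<nu> z w la) \<le> MF la)))"
    if par: "(\<mu>0, \<nu>0) \<in> params n k p q" and R: "adm p q R" for \<mu>0 \<nu>0 R
  proof -
    obtain e M where e: "0 < e" and M0: "\<And>\<eta>. 0 \<le> M \<eta>" and Ms: "M summable_on multi n" and
      M: "\<And>\<mu> \<nu>. \<mu> \<in> cvec p \<Longrightarrow> \<nu> \<in> cvec q \<Longrightarrow> (\<forall>i<p. dist (\<mu> i) (\<mu>0 i) < e) \<Longrightarrow> (\<forall>i<q. dist (\<nu> i) (\<nu>0 i) < e) \<Longrightarrow>
        (\<mu>, \<nu>) \<in> params n k p q \<and>
        (\<forall>\<eta>\<in>multi n. cmod (gpochv n k p \<mu> (plus_part n \<eta>) / gpochv n k q \<nu> (plus_part n \<eta>)) *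
         (R ^ weight n \<eta> * ell n k \<eta> / fact (weight n \<eta>)) \<le> M \<eta>)"
      using majorant[OF k R par] by blast
    have *: "(\<mu>, \<nu>) \<in> params n k p q \<and> (\<forall>z w. supnorm n z * supnorm n w \<le> R \<longrightarrow>
           (\<forall>\<eta>\<in>multi n. cmod (Kterm n k p q \<mu> \<nu> z w \<eta>) \<le> M \<eta>) \<and>
           (\<forall>la\<in>partitions n. cmod (Fterm n k p q \<mu> \<nu> z w la) \<le> (\<Sum>\<eta>\<in>fiber n la. M \<eta>)))"
      if cv: "\<mu> \<in> cvec p" "\<nu> \<in> cvec q" and
        close: "\<forall>i<p. dist (\<mu> i) (\<mu>0 i) < e" "\<forall>i<q. dist (\<nu> i) (\<nu>0 i) < e" for \<mu> \<nu>
    proof (intro conjI allI impI ballI)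
      note m = M[OF cv close]
      show "(\<mu>, \<nu>) \<in> params n k p q" using m by blast
      fix z w assume zw: "supnorm n z * supnorm n w \<le> R"
      show "cmod (Kterm n k p q \<mu> \<nu> z w \<eta>) \<le> M \<eta>" if "\<eta> \<in> multi n" for \<eta>
        using norm_Kterm_le[OF k that zw] m that by (meson order_trans)
      show "cmod (Fterm n k p q \<mu> \<nu> z w la) \<le> (\<Sum>\<eta>\<in>fiber n la. M \<eta>)" if "la \<in> partitions n" for la
        using norm_Fterm_le[OF k zw] by (rule order_trans) (intro sum_mono, use m in \<open>auto simp: fiber_def\<close>)
    qed
    show ?thesis
      by (rule exI[of _ e], rule conjI[OF e], rule exI[of _ M], rule exI[of _ "\<lambda>la. \<Sum>\<eta>\<in>fiber n la. M \<eta>"],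
          rule conjI[OF Ms], rule conjI[OF summable_on_fiber[OF M0 Ms]]) (use * in simp)
  qed
  have K: "holo2 n n D (Kser n k p q \<mu> \<nu>)" "holo2 n n D (Fser n k p q \<mu> \<nu>)"
    if par: "(\<mu>, \<nu>) \<in> params n k p q" for \<mu> \<nu>
  proof -
    have cv: "\<mu> \<in> cvec p" "\<nu> \<in> cvec q" using par by (auto simp: params_def)
    have ex: "\<exists>e>0. \<exists>M MF. M summable_on multi n \<and> MF summable_on partitions n \<and>
       (\<forall>z\<in>cvec n. \<forall>w\<in>cvec n. (\<forall>i<n. dist (z i) (z0 i) < e) \<longrightarrow> (\<forall>i<n. dist (w i) (w0 i) < e) \<longrightarrow>
         (z, w) \<in> D \<and> (\<forall>\<eta>\<in>multi n. cmod (Kterm n k p q \<mu> \<nu> z w \<eta>) \<le> M \<eta>) \<and>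
          (\<forall>la\<in>partitions n. cmod (Fterm n k p q \<mu> \<nu> z w la) \<le> MF la))" if D0: "(z0, w0) \<in> D" for z0 w0
    proof -
      obtain R e where R: "adm p q R" and e: "0 < e" "\<And>z w. z \<in> cvec n \<Longrightarrow> w \<in> cvec n \<Longrightarrow>
        (\<forall>i<n. dist (z i) (z0 i) < e) \<Longrightarrow> (\<forall>i<n. dist (w i) (w0 i) < e) \<Longrightarrow>
        (z, w) \<in> D \<and> supnorm n z * supnorm n w \<le> R" using loc[OF D0] by metis
      obtain e' M MF where M: "0 < e'" "M summable_on multi n" "MF summable_on partitions n" and
        b: "\<And>\<mu>' \<nu>'. \<mu>' \<in> cvec p \<Longrightarrow> \<nu>' \<in> cvec q \<Longrightarrow> (\<forall>i<p. dist (\<mu>' i) (\<mu> i) < e') \<Longrightarrow> (\<forall>i<q. dist (\<nu>' i) (\<nu> i) < e') \<Longrightarrow>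
        (\<mu>', \<nu>') \<in> params n k p q \<and> (\<forall>z w. supnorm n z * supnorm n w \<le> R \<longrightarrow>
           (\<forall>\<eta>\<in>multi n. cmod (Kterm n k p q \<mu>' \<nu>' z w \<eta>) \<le> M \<eta>) \<and>
           (\<forall>la\<in>partitions n. cmod (Fterm n k p q \<mu>' \<nu>' z w la) \<le> MF la))"
        using bnd[OF par R] by metis
      have *: "\<forall>z w. supnorm n z * supnorm n w \<le> R \<longrightarrow>
           (\<forall>\<eta>\<in>multi n. cmod (Kterm n k p q \<mu> \<nu> z w \<eta>) \<le> M \<eta>) \<and>
           (\<forall>la\<in>partitions n. cmod (Fterm n k p q \<mu> \<nu> z w la) \<le> MF la)"
        using b[OF cv] M(1) by simp
      show ?thesis
        by (rule exI[of _ e], rule conjI[OF e(1)], rule exI[of _ M], rule exI[of _ MF],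
          rule conjI[OF M(2)], rule conjI[OF M(3)]) (use * e(2) in simp)
    qed
    have "holo2 n n D (\<lambda>z w. infsum (\<lambda>\<eta>. Kterm n k p q \<mu> \<nu> z w \<eta>) (multi n))"
    proof (rule holo2_infsum[OF D holo2_Kterm[OF k _ D]])
      fix z0 w0 assume "(z0, w0) \<in> D"
      from ex[OF this] show "\<exists>e>0. \<exists>M. M summable_on multi n \<and>
       (\<forall>z\<in>cvec n. \<forall>w\<in>cvec n. (\<forall>i<n. dist (z i) (z0 i) < e) \<longrightarrow> (\<forall>i<n. dist (w i) (w0 i) < e) \<longrightarrow>
         (z, w) \<in> D \<and> (\<forall>\<eta>\<in>multi n. cmod (Kterm n k p q \<mu> \<nu> z w \<eta>) \<le> M \<eta>))" by metis
    qed
    thus "holo2 n n D (Kser n k p q \<mu> \<nu>)" by (simp add: Kser_def[abs_def])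
    have "holo2 n n D (\<lambda>z w. infsum (\<lambda>la. Fterm n k p q \<mu> \<nu> z w la) (partitions n))"
    proof (rule holo2_infsum[OF D holo2_Fterm[OF k D]])
      fix z0 w0 assume "(z0, w0) \<in> D"
      from ex[OF this] show "\<exists>e>0. \<exists>M. M summable_on partitions n \<and>
       (\<forall>z\<in>cvec n. \<forall>w\<in>cvec n. (\<forall>i<n. dist (z i) (z0 i) < e) \<longrightarrow> (\<forall>i<n. dist (w i) (w0 i) < e) \<longrightarrow>
         (z, w) \<in> D \<and> (\<forall>la\<in>partitions n. cmod (Fterm n k p q \<mu> \<nu> z w la) \<le> M la))" by metis
    qed
    thus "holo2 n n D (Fser n k p q \<mu> \<nu>)" by (simp add: Fser_def[abs_def])
  qed
  have P: "\<exists>e>0. \<exists>M MF. M summable_on multi n \<and> MF summable_on partitions n \<and>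
      (\<forall>\<mu>\<in>cvec p. \<forall>\<nu>\<in>cvec q. (\<forall>i<p. dist (\<mu> i) (\<mu>0 i) < e) \<longrightarrow> (\<forall>i<q. dist (\<nu> i) (\<nu>0 i) < e) \<longrightarrow>
        (\<mu>, \<nu>) \<in> params n k p q \<and> (\<forall>\<eta>\<in>multi n. cmod (Kterm n k p q \<mu> \<nu> z w \<eta>) \<le> M \<eta>) \<and>
           (\<forall>la\<in>partitions n. cmod (Fterm n k p q \<mu> \<nu> z w la) \<le> MF la))"
    if zw: "(z, w) \<in> D" and par: "(\<mu>0, \<nu>0) \<in> params n k p q" for z w \<mu>0 \<nu>0
  proof -
    have cv: "z \<in> cvec n" "w \<in> cvec n" using zw D by auto
    obtain R where R: "adm p q R" "supnorm n z * supnorm n w \<le> R"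
      using loc[OF zw] cv by fastforce
    show ?thesis using bnd[OF par R(1)] R(2) by metis
  qed
  have S: "Kterm n k p q \<mu> \<nu> z w summable_on multi n" "Fterm n k p q \<mu> \<nu> z w summable_on partitions n"
    if zw: "(z, w) \<in> D" and par: "(\<mu>, \<nu>) \<in> params n k p q" for z w \<mu> \<nu>
  proof -
    have cv: "\<mu> \<in> cvec p" "\<nu> \<in> cvec q" using par by (auto simp: params_def)
    obtain e M MF where e: "0 < e" and M: "M summable_on multi n" "MF summable_on partitions n" and
      b: "\<And>\<mu>' \<nu>'. \<mu>' \<in> cvec p \<Longrightarrow> \<nu>' \<in> cvec q \<Longrightarrow> (\<forall>i<p. dist (\<mu>' i) (\<mu> i) < e) \<Longrightarrow> (\<forall>i<q. dist (\<nu>' i) (\<nu> i) < e) \<Longrightarrow>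
        (\<forall>\<eta>\<in>multi n. cmod (Kterm n k p q \<mu>' \<nu>' z w \<eta>) \<le> M \<eta>) \<and>
           (\<forall>la\<in>partitions n. cmod (Fterm n k p q \<mu>' \<nu>' z w la) \<le> MF la)"
      using P[OF zw par] by metis
    have "\<forall>\<eta>\<in>multi n. cmod (Kterm n k p q \<mu> \<nu> z w \<eta>) \<le> M \<eta>"
      "\<forall>la\<in>partitions n. cmod (Fterm n k p q \<mu> \<nu> z w la) \<le> MF la"
      using b[OF cv] e by auto
    thus "Kterm n k p q \<mu> \<nu> z w summable_on multi n" "Fterm n k p q \<mu> \<nu> z w summable_on partitions n"
      using summable_on_dominated[OF M(1)] summable_on_dominated[OF M(2)] by blast+
  qed
  show "\<forall>(\<mu>, \<nu>)\<in>params n k p q.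
         (\<forall>(z, w)\<in>D. Kterm n k p q \<mu> \<nu> z w summable_on multi n \<and> Fterm n k p q \<mu> \<nu> z w summable_on partitions n) \<and>
         holo2 n n D (Kser n k p q \<mu> \<nu>) \<and> holo2 n n D (Fser n k p q \<mu> \<nu>)"
    using S K by blast
  have "holo2 p q (params n k p q) (\<lambda>\<mu> \<nu>. Kser n k p q \<mu> \<nu> z w)"
    "holo2 p q (params n k p q) (\<lambda>\<mu> \<nu>. Fser n k p q \<mu> \<nu> z w)" if zw: "(z, w) \<in> D" for z w
  proof -
    have hK: "holo2 p q (params n k p q) (\<lambda>\<mu> \<nu>. Kterm n k p q \<mu> \<nu> z w \<eta>)" for \<eta>
      unfolding Kterm_def by (rule holo2_ratio)
    have hF: "holo2 p q (params n k p q) (\<lambda>\<mu> \<nu>. Fterm n k p q \<mu> \<nu> z w la)" for la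
      unfolding Fterm_def by (rule holo2_ratio)
    have "holo2 p q (params n k p q) (\<lambda>\<mu> \<nu>. infsum (\<lambda>\<eta>. Kterm n k p q \<mu> \<nu> z w \<eta>) (multi n))"
    proof (rule holo2_infsum[OF params_subset hK])
      fix \<mu>0 \<nu>0 assume "(\<mu>0, \<nu>0) \<in> params n k p q"
      from P[OF zw this] show "\<exists>e>0. \<exists>M. M summable_on multi n \<and>
       (\<forall>\<mu>\<in>cvec p. \<forall>\<nu>\<in>cvec q. (\<forall>i<p. dist (\<mu> i) (\<mu>0 i) < e) \<longrightarrow> (\<forall>i<q. dist (\<nu> i) (\<nu>0 i) < e) \<longrightarrow>
         (\<mu>, \<nu>) \<in> params n k p q \<and> (\<forall>\<eta>\<in>multi n. cmod (Kterm n k p q \<mu> \<nu> z w \<eta>) \<le> M \<eta>))" by metis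
    qed
    thus "holo2 p q (params n k p q) (\<lambda>\<mu> \<nu>. Kser n k p q \<mu> \<nu> z w)" by (simp add: Kser_def)
    have "holo2 p q (params n k p q) (\<lambda>\<mu> \<nu>. infsum (\<lambda>la. Fterm n k p q \<mu> \<nu> z w la) (partitions n))"
    proof (rule holo2_infsum[OF params_subset hF])
      fix \<mu>0 \<nu>0 assume "(\<mu>0, \<nu>0) \<in> params n k p q"
      from P[OF zw this] show "\<exists>e>0. \<exists>M. M summable_on partitions n \<and>
       (\<forall>\<mu>\<in>cvec p. \<forall>\<nu>\<in>cvec q. (\<forall>i<p. dist (\<mu> i) (\<mu>0 i) < e) \<longrightarrow> (\<forall>i<q. dist (\<nu> i) (\<nu>0 i) < e) \<longrightarrow>
         (\<mu>, \<nu>) \<in> params n k p q \<and> (\<forall>la\<in>partitions n. cmod (Fterm n k p q \<mu> \<nu> z w la) \<le> M la))" by metis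
    qed
    thus "holo2 p q (params n k p q) (\<lambda>\<mu> \<nu>. Fser n k p q \<mu> \<nu> z w)" by (simp add: Fser_def)
  qed
  thus "\<forall>(z, w)\<in>D. holo2 p q (params n k p q) (\<lambda>\<mu> \<nu>. Kser n k p q \<mu> \<nu> z w) \<and>
         holo2 p q (params n k p q) (\<lambda>\<mu> \<nu>. Fser n k p q \<mu> \<nu> z w)" by blast
qed

lemma supnorm_close:
  assumes "0 < e" "\<forall>i<n. dist (z i) (z0 i) < e"
  shows "supnorm n z \<le> supnorm n z0 + e"
proof -
  have "cmod (z i) \<le> supnorm n z0 + e" if "i < n" for i
  proof -
    have "cmod (z i) - cmod (z0 i) < e" using assms(2) that norm_triangle_ineq2[of "z i" "z0 i"]
      by (force simp: dist_norm)
    moreover have "cmod (z0 i) \<le> supnorm n z0" using supnorm_ge[OF that] .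
    ultimately show ?thesis by linarith
  qed
  thus ?thesis unfolding supnorm_def[of n z] using assms(1) supnorm_nonneg[of n z0] by auto
qed

lemma supnorm_mult_close:
  assumes "supnorm n z0 * supnorm n w0 < R"
  obtains e where "0 < e" "\<And>z w. (\<forall>i<n. dist (z i) (z0 i) < e) \<Longrightarrow> (\<forall>i<n. dist (w i) (w0 i) < e) \<Longrightarrow>
    supnorm n z * supnorm n w \<le> R"
proof -
  let ?a = "supnorm n z0" and ?b = "supnorm n w0"
  have ab: "0 \<le> ?a" "0 \<le> ?b" using supnorm_nonneg by auto
  have "((\<lambda>e. (?a + e) * (?b + e)) \<longlongrightarrow> (?a + 0) * (?b + 0)) (at_right 0)"
    by (intro tendsto_intros)
  hence "eventually (\<lambda>e. (?a + e) * (?b + e) < R) (at_right 0)"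
    using assms by (intro order_tendstoD(2)) auto
  moreover have "eventually (\<lambda>e::real. 0 < e) (at_right 0)" by (rule eventually_at_right_less)
  ultimately have "eventually (\<lambda>e. (?a + e) * (?b + e) < R \<and> 0 < e) (at_right 0)" by eventually_elim simp
  then obtain e where e: "(?a + e) * (?b + e) < R" "0 < e"
    using eventually_happens'[of "at_right (0::real)"] trivial_limit_at_right_real by blast
  have "supnorm n z * supnorm n w \<le> R" if "\<forall>i<n. dist (z i) (z0 i) < e" "\<forall>i<n. dist (w i) (w0 i) < e" for z w
  proof -
    have "supnorm n z * supnorm n w \<le> (?a + e) * (?b + e)"
      using supnorm_close[OF e(2)] that ab e(2) supnorm_nonneg by (intro mult_mono) auto
    thus ?thesis using e(1) by simp
  qed
  thus thesis using that e(2) by blast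
qed

theorem theorem6p4:
  fixes n p q :: nat and k :: real
  assumes "k \<ge> 0"
  shows
   "(p \<le> q \<longrightarrow>
      (\<forall>(\<mu>, \<nu>)\<in>params n k p q.
         (\<forall>z\<in>cvec n. \<forall>w\<in>cvec n.
            Kterm n k p q \<mu> \<nu> z w summable_on multi n \<and>
            Fterm n k p q \<mu> \<nu> z w summable_on partitions n) \<and>
         holo2 n n (cvec n \<times> cvec n) (Kser n k p q \<mu> \<nu>) \<and>
         holo2 n n (cvec n \<times> cvec n) (Fser n k p q \<mu> \<nu>)) \<and>
      (\<forall>z\<in>cvec n. \<forall>w\<in>cvec n.
         holo2 p q (params n k p q) (\<lambda>\<mu> \<nu>. Kser n k p q \<mu> \<nu> z w) \<and>
         holo2 p q (params n k p q) (\<lambda>\<mu> \<nu>. Fser n k p q \<mu> \<nu> z w)))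
    \<and>
    (p = q + 1 \<longrightarrow>
      (\<forall>(\<mu>, \<nu>)\<in>params n k p q.
         (\<forall>(z, w)\<in>bidisc n.
            Kterm n k p q \<mu> \<nu> z w summable_on multi n \<and>
            Fterm n k p q \<mu> \<nu> z w summable_on partitions n) \<and>
         holo2 n n (bidisc n) (Kser n k p q \<mu> \<nu>) \<and>
         holo2 n n (bidisc n) (Fser n k p q \<mu> \<nu>)) \<and>
      (\<forall>(z, w)\<in>bidisc n.
         holo2 p q (params n k p q) (\<lambda>\<mu> \<nu>. Kser n k p q \<mu> \<nu> z w) \<and>
         holo2 p q (params n k p q) (\<lambda>\<mu> \<nu>. Fser n k p q \<mu> \<nu> z w)))"
proof (intro conjI impI)
  assume pq: "p \<le> q"
  have loc: "\<exists>R. adm p q R \<and> (\<exists>e>0. \<forall>z\<in>cvec n. \<forall>w\<in>cvec n.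
      (\<forall>i<n. dist (z i) (z0 i) < e) \<longrightarrow> (\<forall>i<n. dist (w i) (w0 i) < e) \<longrightarrow>
      (z, w) \<in> cvec n \<times> cvec n \<and> supnorm n z * supnorm n w \<le> R)" for z0 w0
  proof -
    \<comment> \<open>Every nonnegative bound is admissible here; the added 1 leaves room for a
      neighbourhood.\<close>
    let ?R = "supnorm n z0 * supnorm n w0 + 1"
    obtain e where "0 < e" "\<And>z w. (\<forall>i<n. dist (z i) (z0 i) < e) \<Longrightarrow> (\<forall>i<n. dist (w i) (w0 i) < e) \<Longrightarrow>
      supnorm n z * supnorm n w \<le> ?R" using supnorm_mult_close[of n z0 w0 ?R] by auto
    moreover have "adm p q ?R"
      using pq supnorm_nonneg by (simp add: adm_def add_nonneg_nonneg)
    ultimately show ?thesis by blast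
  qed
  show "\<forall>(\<mu>, \<nu>)\<in>params n k p q.
         (\<forall>z\<in>cvec n. \<forall>w\<in>cvec n.
            Kterm n k p q \<mu> \<nu> z w summable_on multi n \<and>
            Fterm n k p q \<mu> \<nu> z w summable_on partitions n) \<and>
         holo2 n n (cvec n \<times> cvec n) (Kser n k p q \<mu> \<nu>) \<and>
         holo2 n n (cvec n \<times> cvec n) (Fser n k p q \<mu> \<nu>)"
    using holo2_series(1)[OF assms subset_refl loc] by blast
  show "\<forall>z\<in>cvec n. \<forall>w\<in>cvec n.
         holo2 p q (params n k p q) (\<lambda>\<mu> \<nu>. Kser n k p q \<mu> \<nu> z w) \<and>
         holo2 p q (params n k p q) (\<lambda>\<mu> \<nu>. Fser n k p q \<mu> \<nu> z w)"
    using holo2_series(2)[OF assms subset_refl loc] by blast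
next
  assume pq: "p = q + 1"
  have D: "bidisc n \<subseteq> cvec n \<times> cvec n" by (auto simp: bidisc_def)
  have loc: "\<exists>R. adm p q R \<and> (\<exists>e>0. \<forall>z\<in>cvec n. \<forall>w\<in>cvec n.
      (\<forall>i<n. dist (z i) (z0 i) < e) \<longrightarrow> (\<forall>i<n. dist (w i) (w0 i) < e) \<longrightarrow>
      (z, w) \<in> bidisc n \<and> supnorm n z * supnorm n w \<le> R)" if "(z0, w0) \<in> bidisc n" for z0 w0
  proof -
    have "supnorm n z0 * supnorm n w0 < 1" using that by (simp add: bidisc_def)
    \<comment> \<open>\<open>R\<close> leaves room for a neighbourhood and, being below 1, keeps
      that neighbourhood inside \<open>bidisc n\<close>.\<close>
    then obtain R where R: "supnorm n z0 * supnorm n w0 < R" "R < 1" using dense by blast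
    obtain e where e: "0 < e" "\<And>z w. (\<forall>i<n. dist (z i) (z0 i) < e) \<Longrightarrow> (\<forall>i<n. dist (w i) (w0 i) < e) \<Longrightarrow>
      supnorm n z * supnorm n w \<le> R" using supnorm_mult_close[OF R(1)] by auto
    have "0 \<le> supnorm n z0 * supnorm n w0" using supnorm_nonneg by simp
    hence "adm p q R" using pq R by (simp add: adm_def)
    moreover have "(z, w) \<in> bidisc n \<and> supnorm n z * supnorm n w \<le> R" if "z \<in> cvec n" "w \<in> cvec n"
      "\<forall>i<n. dist (z i) (z0 i) < e" "\<forall>i<n. dist (w i) (w0 i) < e" for z w
      using e(2)[OF that(3,4)] that(1,2) R(2) by (simp add: bidisc_def)
    ultimately show ?thesis using e(1) by blast
  qed
  show "\<forall>(\<mu>, \<nu>)\<in>params n k p q.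
         (\<forall>(z, w)\<in>bidisc n.
            Kterm n k p q \<mu> \<nu> z w summable_on multi n \<and>
            Fterm n k p q \<mu> \<nu> z w summable_on partitions n) \<and>
         holo2 n n (bidisc n) (Kser n k p q \<mu> \<nu>) \<and>
         holo2 n n (bidisc n) (Fser n k p q \<mu> \<nu>)"
    by (rule holo2_series(1)[OF assms D loc])
  show "\<forall>(z, w)\<in>bidisc n.
         holo2 p q (params n k p q) (\<lambda>\<mu> \<nu>. Kser n k p q \<mu> \<nu> z w) \<and>
         holo2 p q (params n k p q) (\<lambda>\<mu> \<nu>. Fser n k p q \<mu> \<nu> z w)"
    by (rule holo2_series(2)[OF assms D loc])
qed

end
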